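(* Let $\nu>0$ and let $\mathcal{J}^\nu:=\mathcal{G}^\nu\circ(\mathcal{B}^\nu_{\mathbb{H}})^{-1}$ on $\mathcal{F}^{2,\nu}_{slice,i}(\mathbb{H})$. The image of $\mathcal{J}^\nu$ coincides with $$\mathcal{A}^{2,\nu}(\mathbb{C}^2)=\left\{F\in\mathcal{F}^{2,\nu}(\mathbb{C}^2);\ \left(\frac{\partial}{\partial z}+i\frac{\partial}{\partial w}\right)F=0\right\},$$ and its action on any $F\in\mathcal{F}^{2,\nu}_{slice,i}(\mathbb{H})$ is given by $$\mathcal{J}^\nu F(z,w)=\left(\frac{\nu}{\pi}\right)^{\frac12}F\left(\frac{z+iw}{\sqrt2}\right).$$ Moreover, for every fixed $\xi\in\mathbb{C}$, we have $$\mathcal{J}^\nu\big(K^\nu_{\mathbb{H}}(\cdot,\xi)\big)(z,w)=K^\nu_2\left(\left(\frac{\xi}{\sqrt2},\frac{-i\xi}{\sqrt2}\right),(z,w)\right),$$ where $K^\nu_{\mathbb{H}}(q,\xi)$ and $K^\nu_2((u,v),(z,w))$ are the reproducing kernels of $\mathcal{F}^{2,\nu}_{slice}(\mathbb{H})$ and $\mathcal{F}^{2,\nu}(\mathbb{C}^2)$, respectively.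
   Context: Let $\nu>0$. Let $\mathbb{H}$ be the quaternions, $\mathbb{S}=\{I\in\mathbb{H}: I^2=-1\}$, and $\mathbb{C}_I=\mathbb{R}+\mathbb{R}I$ for $I\in\mathbb{S}$. Fix $i\in\mathbb{S}$ and identify $\mathbb{C}$ with $\mathbb{C}_i\subset\mathbb{H}$. $L^{2,\nu}(\mathbb{R},\mathbb{C})$ (respectively $L^{2,\nu}(\mathbb{R},\mathbb{H})$) is the Hilbert space of $\mathbb{C}$-valued (respectively $\mathbb{H}$-valued) functions that are square integrable with respect to $e^{-\nu x^2}dx$. The Bargmann-Fock space $\mathcal{F}^{2,\nu}(\mathbb{C}^d)$ consists of the holomorphic functions on $\mathbb{C}^d$ that are square integrable with respect to $e^{-\nu|z|^2}d\lambda$, with $d\lambda$ the Lebesgue measure. The reproducing kernel of $\mathcal{F}^{2,\nu}(\mathbb{C}^2)$ is $$K^\nu_2((u,v),(z,w))=\left(\frac{\nu}{\pi}\right)^2e^{\nu(u\overline{z}+v\overline{w})}.$$ Slice regular functions: $F:\mathbb{H}\to\mathbb{H}$ (real differentiable) is (left) slice regular if for every $I\in\mathbb{S}$ its restriction to $\mathbb{C}_I$ satisfies $\left(\frac{\partial}{\partial x}+I\frac{\partial}{\partial y}\right)F(x+yI)=0$. The space $\mathcal{F}^{2,\nu}_{slice}(\mathbb{H})$ is the right $\mathbb{H}$-vector space of slice regular functions $F$ on $\mathbb{H}$ with $\int_{\mathbb{C}_I}|F(q)|^2e^{-\nu|q|^2}d\lambda_I(q)<\infty$ for some (equivalently, any)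 $I\in\mathbb{S}$, where $d\lambda_I(x+yI)=dx\,dy$. Its reproducing kernel is $$K^\nu_{\mathbb{H}}(q,p)=\frac{\nu}{\pi}\sum_{m=0}^{\infty}\frac{\nu^m q^m\overline{p}^m}{m!},\qquad p,q\in\mathbb{H}.$$ The subspace $\mathcal{F}^{2,\nu}_{slice,i}(\mathbb{H})$ is $\{F\in\mathcal{F}^{2,\nu}_{slice}(\mathbb{H}): F(\mathbb{C}_i)\subset\mathbb{C}_i\}$. Transforms: the one-dimensional Segal-Bargmann transform, unitary from $L^{2,\nu}(\mathbb{R},\mathbb{C})$ onto $\mathcal{F}^{2,\nu}(\mathbb{C})$, is $\mathcal{B}^{1,\nu}f(z)=\left(\frac{\nu}{\pi}\right)^{\frac34}\int_{\mathbb{R}}f(x)e^{-\nu\left(x-\frac{z}{\sqrt2}\right)^2}dx$. The transform $\mathcal{G}^\nu:L^{2,\nu}(\mathbb{R},\mathbb{C})\to\mathcal{F}^{2,\nu}(\mathbb{C}^2)$ is $$\mathcal{G}^\nu f(z,w)=\left(\frac{\nu}{\pi}\right)^{\frac12}(\mathcal{B}^{1,\nu}f)\left(\frac{z+iw}{\sqrt2}\right).$$ The quaternionic Segal-Bargmann transform, mapping $L^{2,\nu}(\mathbb{R},\mathbb{H})$ bijectively onto $\mathcal{F}^{2,\nu}_{slice}(\mathbb{H})$, is $$\mathcal{B}^\nu_{\mathbb{H}}f(q)=\left(\frac{\nu}{\pi}\right)^{\frac34}\int_{\mathbb{R}}f(x)\,e^{-\nu\left(x-\frac{q}{\sqrt2}\right)^2}dx,\qquad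 q\in\mathbb{H}.$$ Its inverse maps $\mathcal{F}^{2,\nu}_{slice,i}(\mathbb{H})$ into $L^{2,\nu}(\mathbb{R},\mathbb{C})$ (with $\mathbb{C}=\mathbb{C}_i$), so that $\mathcal{J}^\nu$ is well defined.
   Formalization: The kernel identity, false as printed (e.g. ν=1, ξ=0), is proved with the arguments of K_2 swapped and a factor (π/ν)^{1/2} added; in the quaternionic Segal-Bargmann transform the exponential stands left of f(x), as needed for left slice regular values. *)

theory Defs
  imports "HOL-Analysis.Analysis"
begin

datatype quat = Quat (qRe: real) (qI: real) (qJ: real) (qK: real)

lemma quat_eq_iff:
  "p = q \<longleftrightarrow> qRe p = qRe q \<and> qI p = qI q \<and> qJ p = qJ q \<and> qK p = qK q"
  by (cases p; cases q) simp

instantiation quat :: ab_group_add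
begin

definition "0 = Quat 0 0 0 0"
definition "p + q = Quat (qRe p + qRe q) (qI p + qI q) (qJ p + qJ q) (qK p + qK q)"
definition "p - q = Quat (qRe p - qRe q) (qI p - qI q) (qJ p - qJ q) (qK p - qK q)"
definition "- q = Quat (- qRe q) (- qI q) (- qJ q) (- qK q)"

lemma quat_add_sel [simp]:
  "qRe 0 = 0" "qI 0 = 0" "qJ 0 = 0" "qK 0 = 0"
  "qRe (p + q) = qRe p + qRe q" "qI (p + q) = qI p + qI q"
  "qJ (p + q) = qJ p + qJ q" "qK (p + q) = qK p + qK q"
  "qRe (p - q) = qRe p - qRe q" "qI (p - q) = qI p - qI q"
  "qJ (p - q) = qJ p - qJ q" "qK (p - q) = qK p - qK q"
  "qRe (- q) = - qRe q" "qI (- q) = - qI q"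
  "qJ (- q) = - qJ q" "qK (- q) = - qK q"
  by (simp_all add: zero_quat_def plus_quat_def minus_quat_def uminus_quat_def)

instance
  by standard (simp_all add: quat_eq_iff)

end

instantiation quat :: real_algebra_1
begin

definition "1 = Quat 1 0 0 0"
definition "p * q = Quat
  (qRe p * qRe q - qI p * qI q - qJ p * qJ q - qK p * qK q)
  (qRe p * qI q + qI p * qRe q + qJ p * qK q - qK p * qJ q)
  (qRe p * qJ q - qI p * qK q + qJ p * qRe q + qK p * qI q)
  (qRe p * qK q + qI p * qJ q - qJ p * qI q + qK p * qRe q)"
definition "r *\<^sub>R q = Quat (r * qRe q) (r * qI q) (r * qJ q) (r * qK q)"

lemma quat_mult_sel [simp]:
  "qRe 1 = 1" "qI 1 = 0" "qJ 1 = 0" "qK 1 = 0"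
  "qRe (p * q) = qRe p * qRe q - qI p * qI q - qJ p * qJ q - qK p * qK q"
  "qI (p * q) = qRe p * qI q + qI p * qRe q + qJ p * qK q - qK p * qJ q"
  "qJ (p * q) = qRe p * qJ q - qI p * qK q + qJ p * qRe q + qK p * qI q"
  "qK (p * q) = qRe p * qK q + qI p * qJ q - qJ p * qI q + qK p * qRe q"
  "qRe (r *\<^sub>R q) = r * qRe q" "qI (r *\<^sub>R q) = r * qI q"
  "qJ (r *\<^sub>R q) = r * qJ q" "qK (r *\<^sub>R q) = r * qK q"
  by (simp_all add: one_quat_def times_quat_def scaleR_quat_def)

instance
  by standard (simp_all add: quat_eq_iff algebra_simps)

end

instantiation quat :: real_inner
begin

definition "inner p q = qRe p * qRe q + qI p * qI q + qJ p * qJ q + qK p * qK q"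
definition "norm (q :: quat) = sqrt (inner q q)"
definition "dist (p :: quat) q = norm (p - q)"
definition "sgn (q :: quat) = q /\<^sub>R norm q"
definition "(uniformity :: (quat \<times> quat) filter) = (INF e\<in>{0<..}. principal {(x, y). dist x y < e})"
definition "open (U :: quat set) \<longleftrightarrow>
  (\<forall>x\<in>U. \<forall>\<^sub>F (x', y) in uniformity. x' = x \<longrightarrow> y \<in> U)"

instance
proof
  fix x y z :: quat and r :: real and S :: "quat set"
  show "dist x y = norm (x - y)" by (simp add: dist_quat_def)
  show "sgn x = x /\<^sub>R norm x" by (simp add: sgn_quat_def)
  show "(uniformity :: (quat \<times> quat) filter) = (INF e\<in>{0<..}. principal {(x, y). dist x y < e})"
    by (rule uniformity_quat_def)
  show "open S \<longleftrightarrow> (\<forall>x\<in>S. \<forall>\<^sub>F (x', y) in uniformity. x' = x \<longrightarrow> y \<in> S)"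
    by (rule open_quat_def)
  show "inner x y = inner y x" by (simp add: inner_quat_def mult.commute)
  show "inner (x + y) z = inner x z + inner y z" by (simp add: inner_quat_def algebra_simps)
  show "inner (r *\<^sub>R x) y = r * inner x y" by (simp add: inner_quat_def algebra_simps)
  show "0 \<le> inner x x" by (simp add: inner_quat_def)
  show "inner x x = 0 \<longleftrightarrow> x = 0"
    by (simp add: inner_quat_def quat_eq_iff add_nonneg_eq_0_iff)
  show "norm x = sqrt (inner x x)" by (simp add: norm_quat_def)
qed

end

definition quat_cnj :: "quat \<Rightarrow> quat" where
  "quat_cnj q = Quat (qRe q) (- qI q) (- qJ q) (- qK q)"

lemma quat_cnj_sel [simp]:
  "qRe (quat_cnj q) = qRe q" "qI (quat_cnj q) = - qI q"
  "qJ (quat_cnj q) = - qJ q" "qK (quat_cnj q) = - qK q"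
  by (simp_all add: quat_cnj_def)

instantiation quat :: real_normed_div_algebra
begin

definition "inverse q = quat_cnj q /\<^sub>R inner q q"
definition "p div q = p * inverse q" for p q :: quat

lemma quat_mult_cnj: "q * quat_cnj q = inner q q *\<^sub>R 1" "quat_cnj q * q = inner q q *\<^sub>R 1"
  by (simp_all add: quat_eq_iff inner_quat_def)

instance
proof
  fix x y :: quat
  show "x \<noteq> 0 \<Longrightarrow> inverse x * x = 1" by (simp add: inverse_quat_def quat_mult_cnj)
  show "x \<noteq> 0 \<Longrightarrow> x * inverse x = 1" by (simp add: inverse_quat_def quat_mult_cnj)
  show "x div y = x * inverse y" by (rule divide_quat_def)
  show "inverse (0 :: quat) = 0" by (simp add: inverse_quat_def)
  have "inner (x * y) (x * y) = inner x x * inner y y"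
    by (simp add: inner_quat_def algebra_simps)
  then show "norm (x * y) = norm x * norm y"
    by (simp add: norm_quat_def real_sqrt_mult)
qed

end

instantiation quat :: euclidean_space
begin

definition "Basis = {Quat 1 0 0 0, Quat 0 1 0 0, Quat 0 0 1 0, Quat 0 0 0 1}"

instance
proof
  show "(Basis :: quat set) \<noteq> {}" "finite (Basis :: quat set)"
    by (simp_all add: Basis_quat_def)
  fix u v :: quat
  assume "u \<in> Basis" "v \<in> Basis"
  then show "inner u v = (if u = v then 1 else 0)"
    unfolding Basis_quat_def by (elim insertE emptyE) (simp_all add: inner_quat_def)
next
  fix x :: quat
  show "(\<forall>u\<in>Basis. inner x u = 0) \<longleftrightarrow> x = 0"
    by (cases x) (simp add: Basis_quat_def inner_quat_def zero_quat_def)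
qed

end

definition quat_sphere :: "quat set" where
  "quat_sphere = {I. I\<^sup>2 = -1}"

text \<open>For \<open>I \<in> quat_sphere\<close> this is the embedding \<open>x + y\<i> \<mapsto> x + yI\<close> that identifies the
  complex numbers with the slice \<open>\<complex>\<^sub>I\<close>.\<close>

definition slice_emb :: "quat \<Rightarrow> complex \<Rightarrow> quat" where
  "slice_emb I z = of_real (Re z) + of_real (Im z) * I"

definition quat_slice :: "quat \<Rightarrow> quat set" where
  "quat_slice I = range (slice_emb I)"

text \<open>Weighted square integrable functions on the line; the Hilbert space \<open>L2\<close> consists of
  their classes modulo equality almost everywhere.\<close>

definition L2_fun :: "real \<Rightarrow> (real \<Rightarrow> 'a::real_normed_vector) set" where
  "L2_fun \<nu> = {f. f \<in> borel_measurable lborel \<and>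
     integrable lborel (\<lambda>x. (norm (f x))\<^sup>2 * exp (- \<nu> * x\<^sup>2))}"

definition L2_rel :: "real \<Rightarrow> ((real \<Rightarrow> 'a::real_normed_vector) \<times> (real \<Rightarrow> 'a)) set" where
  "L2_rel \<nu> = {(f, g). f \<in> L2_fun \<nu> \<and> g \<in> L2_fun \<nu> \<and> (AE x in lborel. f x = g x)}"

definition L2 :: "real \<Rightarrow> (real \<Rightarrow> 'a::real_normed_vector) set set" where
  "L2 \<nu> = L2_fun \<nu> // L2_rel \<nu>"

text \<open>The value on a class of a map that does not depend on the representative.\<close>

definition on_class :: "('f \<Rightarrow> 'b) \<Rightarrow> 'f set \<Rightarrow> 'b" where
  "on_class T c = the_elem (T ` c)"

text \<open>\<open>L\<^sup>2(\<real>, \<complex>)\<close> as a subspace of \<open>L\<^sup>2(\<real>, \<bbbH>)\<close>, via \<open>\<complex> = \<complex>\<^sub>i\<close>.\<close>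

definition L2_incl :: "quat \<Rightarrow> real \<Rightarrow> (real \<Rightarrow> complex) set \<Rightarrow> (real \<Rightarrow> quat) set" where
  "L2_incl i \<nu> = on_class (\<lambda>f. L2_rel \<nu> `` {slice_emb i \<circ> f})"

text \<open>Holomorphy on \<open>\<complex>\<^sup>2\<close> is complex differentiability in both variables jointly. The norm on
  the product type is the Euclidean one, \<open>\<bar>(z, w)\<bar>\<^sup>2 = \<bar>z\<bar>\<^sup>2 + \<bar>w\<bar>\<^sup>2\<close>, and \<open>lborel\<close> is
  Lebesgue measure on \<open>\<real>\<^sup>4\<close>.\<close>

definition holomorphic2 :: "(complex \<times> complex \<Rightarrow> complex) \<Rightarrow> bool" where
  "holomorphic2 F \<longleftrightarrow> (\<forall>p. \<exists>a b. (F has_derivative (\<lambda>(h, k). a * h + b * k)) (at p))"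

definition Fock2 :: "real \<Rightarrow> (complex \<times> complex \<Rightarrow> complex) set" where
  "Fock2 \<nu> = {F. holomorphic2 F \<and>
     integrable lborel (\<lambda>p. (norm (F p))\<^sup>2 * exp (- \<nu> * (norm p)\<^sup>2))}"

definition A2 :: "real \<Rightarrow> (complex \<times> complex \<Rightarrow> complex) set" where
  "A2 \<nu> = {F \<in> Fock2 \<nu>. \<forall>z w.
     deriv (\<lambda>\<zeta>. F (\<zeta>, w)) z + \<i> * deriv (\<lambda>\<omega>. F (z, \<omega>)) w = 0}"

definition slice_regular :: "(quat \<Rightarrow> quat) \<Rightarrow> bool" where
  "slice_regular F \<longleftrightarrow> (\<forall>q. F differentiable (at q)) \<and>
     (\<forall>I\<in>quat_sphere. \<forall>x y :: real.
        vector_derivative (\<lambda>t. F (of_real t + of_real y * I)) (at x) +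
        I * vector_derivative (\<lambda>t. F (of_real x + of_real t * I)) (at y) = 0)"

definition Fock_slice :: "real \<Rightarrow> (quat \<Rightarrow> quat) set" where
  "Fock_slice \<nu> = {F. slice_regular F \<and> (\<exists>I\<in>quat_sphere.
     integrable lborel (\<lambda>z. (norm (F (slice_emb I z)))\<^sup>2 * exp (- \<nu> * (norm (slice_emb I z))\<^sup>2)))}"

definition Fock_slice_pres :: "quat \<Rightarrow> real \<Rightarrow> (quat \<Rightarrow> quat) set" where
  "Fock_slice_pres i \<nu> = {F \<in> Fock_slice \<nu>. F ` quat_slice i \<subseteq> quat_slice i}"

text \<open>Both kernels are (slice) regular in the first argument and anti-regular in the second.\<close>

definition K_H :: "real \<Rightarrow> quat \<Rightarrow> quat \<Rightarrow> quat" where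
  "K_H \<nu> q p = of_real (\<nu> / pi) * (\<Sum>m. of_real (\<nu> ^ m / fact m) * (q ^ m * quat_cnj p ^ m))"

definition K2 :: "real \<Rightarrow> complex \<times> complex \<Rightarrow> complex \<times> complex \<Rightarrow> complex" where
  "K2 \<nu> = (\<lambda>(u, v) (z, w). of_real ((\<nu> / pi)\<^sup>2) * exp (of_real \<nu> * (u * cnj z + v * cnj w)))"

definition B1 :: "real \<Rightarrow> (real \<Rightarrow> complex) \<Rightarrow> complex \<Rightarrow> complex" where
  "B1 \<nu> f z = of_real ((\<nu> / pi) powr (3/4)) *
     (LINT x|lborel. f x * exp (- of_real \<nu> * (of_real x - z / of_real (sqrt 2))\<^sup>2))"

definition G :: "real \<Rightarrow> (real \<Rightarrow> complex) \<Rightarrow> complex \<times> complex \<Rightarrow> complex" where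
  "G \<nu> f = (\<lambda>(z, w). of_real (sqrt (\<nu> / pi)) * B1 \<nu> f ((z + \<i> * w) / of_real (sqrt 2)))"

text \<open>The kernel stands to the left of \<open>f x\<close>: the values \<open>f x\<close> are then right coefficients, so that
  the transform is right linear and takes values in the (left) slice regular functions. With the
  kernel on the right one would obtain right slice regular functions instead.\<close>

definition B_H :: "real \<Rightarrow> (real \<Rightarrow> quat) \<Rightarrow> quat \<Rightarrow> quat" where
  "B_H \<nu> f q = of_real ((\<nu> / pi) powr (3/4)) *
     (LINT x|lborel. exp (- of_real \<nu> * (of_real x - q / of_real (sqrt 2))\<^sup>2) * f x)"

text \<open>The composition \<open>G \<circ> B_H\<inverse>\<close> on \<open>Fock_slice_pres i \<nu>\<close>. The inverse of \<open>B_H\<close> is taken on all of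
  \<open>L\<^sup>2(\<real>, \<bbbH>)\<close>; its value lies in \<open>L\<^sup>2(\<real>, \<complex>)\<close>, and is read as an element of the latter by
  inverting the inclusion.\<close>

definition J :: "quat \<Rightarrow> real \<Rightarrow> (quat \<Rightarrow> quat) \<Rightarrow> complex \<times> complex \<Rightarrow> complex" where
  "J i \<nu> = (\<lambda>F\<in>Fock_slice_pres i \<nu>.
     on_class (G \<nu>) (inv_into (L2 \<nu>) (L2_incl i \<nu>) (inv_into (L2 \<nu>) (on_class (B_H \<nu>)) F)))"

end

theory Submission
  imports Defs "HOL-Probability.Probability" "HOL-Complex_Analysis.Complex_Analysis"
    "HOL-Real_Asymp.Real_Asymp"
begin

text \<open>
  A function \<open>F\<close> in the slice Fock space that preserves \<open>\<complex>\<^sub>i\<close> is a series \<open>F q = \<Sum> q\<^sup>n c\<^sub>n\<close> with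
  \<open>c\<^sub>n \<in> \<complex>\<^sub>i\<close>, and by Parseval's identity on circles its norm on any slice is a multiple of
  \<open>\<Sum> \<bar>c\<^sub>n\<bar>\<^sup>2 n! / \<nu>\<^sup>n\<close>. The Segal--Bargmann transform sends the Hermite polynomials to multiples of
  the monomials, so that every such coefficient sequence comes from some \<open>f \<in> L\<^sup>2(\<real>, \<complex>)\<close>, which is
  unique because the transform restricted to the imaginary axis is a Fourier transform. Hence
  \<open>J F (z, w) = (\<nu> / \<pi>)\<^sup>1\<^sup>/\<^sup>2 \<Sum> c\<^sub>n ((z + \<i>w) / \<surd>2)\<^sup>n\<close>. On the other side, the equation
  \<open>(\<partial>\<^sub>z + \<i>\<partial>\<^sub>w) H = 0\<close> says that \<open>H\<close> is constant in the direction \<open>(1, \<i>)\<close>, that is, a function of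
  \<open>z + \<i>w\<close> alone, and a unitary change of variables turns its norm on \<open>\<complex>\<^sup>2\<close> into the Fock norm of a
  function of one variable.
\<close>

text \<open>The map \<open>J\<close> is built from two applications of \<open>inv_into\<close>.
  Nothing about it can be computed before both maps are known to be injective on classes, and for
  \<open>B_H\<close> this concerns all quaternion valued functions, although only
  \<open>\<complex>\<^sub>i\<close> valued ones occur in the answer. As quaternions do not commute,
  functions on the line are split into real components: the complex transform is applied to each,
  and the components are separated again by the symmetry \<open>B1 f (cnj z) = cnj (B1 f z)\<close>
  for real \<open>f\<close>.

  The other obstacle is that integrability in \<open>Fock_slice\<close> is given on some slice
  \<open>I\<close> that may have nothing to do with \<open>i\<close>. There a series with
  coefficients in \<open>\<complex>\<^sub>i\<close> has values filling more than a plane.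
  Complexified real functionals turn it into ordinary entire functions. All slices share the real
  axis, and agreement there is enough to identify coefficients.\<close>

section \<open>Lebesgue measure and Gaussian integrals\<close>

text \<open>Uniqueness of Haar measure: integrating \<open>1\<^sub>A(T x) 1\<^sub>B(T x - y)\<close> in both orders gives
  \<open>\<mu>(A) \<lambda>(B) = \<lambda>(A) \<lambda>(T\<^sup>-\<^sup>1 B)\<close>, where \<open>\<mu>\<close> is the image measure and \<open>B\<close> the unit ball.\<close>

lemma distr_lborel_orthogonal:
  fixes T :: "'a::euclidean_space \<Rightarrow> 'a"
  assumes T: "orthogonal_transformation T"
  shows "distr lborel borel T = lborel"
proof (rule measure_eqI)
  fix A assume "A \<in> sets (distr lborel borel T)"
  then have A [measurable]: "A \<in> sets borel" by simp
  have "linear T" using T by (simp add: orthogonal_transformation_def)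
  then have cont: "continuous_on UNIV T"
    by (simp add: linear_continuous_on linear_conv_bounded_linear)
  then have [measurable]: "T \<in> borel_measurable borel"
    by (rule borel_measurable_continuous_onI)
  have nT: "norm (T x) = norm x" for x using T by (rule orthogonal_transformation_norm)
  have surj: "surj T" using T by (rule orthogonal_transformation_surj)
  define B :: "'a set" where "B = ball 0 1"
  have B [measurable]: "B \<in> sets borel" by (simp add: B_def)
  have Bpos: "emeasure lborel B \<noteq> 0"
    using content_ball_pos[of 1 "0::'a"] by (auto simp: B_def measure_def)
  have Bfin: "emeasure lborel B \<noteq> \<infinity>"
    using emeasure_lborel_ball_finite[of "0::'a" 1] by (auto simp: B_def)
  have trans: "(\<integral>\<^sup>+x. f (c + x) \<partial>lborel) = (\<integral>\<^sup>+x. f x \<partial>lborel)"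
    if [measurable]: "f \<in> borel_measurable borel" for f :: "'a \<Rightarrow> ennreal" and c
  proof -
    have "(\<integral>\<^sup>+x. f x \<partial>distr lborel borel ((+) c)) = (\<integral>\<^sup>+x. f (c + x) \<partial>lborel)"
      by (subst nn_integral_distr) auto
    then show ?thesis by (simp add: lborel_distr_plus)
  qed
  let ?d = "emeasure (distr lborel borel T) A"
  have d: "?d = (\<integral>\<^sup>+x. indicator A (T x) \<partial>lborel)"
    using nn_integral_distr[of T lborel borel "indicator A"] by simp
  have "?d * emeasure lborel B = (\<integral>\<^sup>+x. indicator A (T x) * emeasure lborel B \<partial>lborel)"
    unfolding d by (subst nn_integral_multc) auto
  also have "\<dots> = (\<integral>\<^sup>+x. \<integral>\<^sup>+y. indicator A (T x) * indicator B (T x - y) \<partial>lborel \<partial>lborel)"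
  proof (rule nn_integral_cong)
    fix x
    have "(\<integral>\<^sup>+y. indicator B (T x - y) \<partial>lborel) = (\<integral>\<^sup>+y. indicator B (- y) \<partial>(lborel :: 'a measure))"
      using trans[of "\<lambda>y. indicator B (T x - y)" "T x"] by (simp add: algebra_simps)
    also have "\<dots> = (\<integral>\<^sup>+y. indicator B y \<partial>(lborel :: 'a measure))"
      by (intro nn_integral_cong) (auto simp: indicator_def B_def)
    finally show "indicator A (T x) * emeasure lborel B = (\<integral>\<^sup>+y. indicator A (T x) * indicator B (T x - y) \<partial>lborel)"
      by (subst nn_integral_cmult) auto
  qed
  also have "\<dots> = (\<integral>\<^sup>+y. \<integral>\<^sup>+x. indicator A (T x) * indicator B (T x - y) \<partial>lborel \<partial>lborel)"
    by (rule lborel_pair.Fubini') measurable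
  also have "\<dots> = (\<integral>\<^sup>+y. \<integral>\<^sup>+x. indicator A (T x + y) * indicator B (T x) \<partial>lborel \<partial>lborel)"
  proof (rule nn_integral_cong)
    fix y
    obtain c where c: "T c = y" using surj by (metis surjD)
    show "(\<integral>\<^sup>+x. indicator A (T x) * indicator B (T x - y) \<partial>lborel) = (\<integral>\<^sup>+x. indicator A (T x + y) * indicator B (T x) \<partial>lborel)"
      using trans[of "\<lambda>x. indicator A (T x) * indicator B (T x - y)" c]
      by (simp add: linear_add[OF \<open>linear T\<close>] c algebra_simps)
  qed
  also have "\<dots> = (\<integral>\<^sup>+x. \<integral>\<^sup>+y. indicator A (T x + y) * indicator B (T x) \<partial>lborel \<partial>lborel)"
    by (rule lborel_pair.Fubini') measurable
  also have "\<dots> = (\<integral>\<^sup>+x. emeasure lborel A * indicator B x \<partial>lborel)"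
  proof (rule nn_integral_cong)
    fix x
    show "(\<integral>\<^sup>+y. indicator A (T x + y) * indicator B (T x) \<partial>lborel) = emeasure lborel A * indicator B x"
    proof -
      have "(\<integral>\<^sup>+y. indicator A (T x + y) \<partial>lborel) = emeasure lborel A"
        using trans[of "indicator A" "T x"] by simp
      \<comment> \<open>The unit ball is invariant under a norm preserving map, so the same finite
        positive factor appears on both sides and can be cancelled.\<close>
      moreover have "indicator B (T x) = (indicator B x :: ennreal)"
        by (simp add: B_def indicator_def nT)
      ultimately show ?thesis by (simp add: nn_integral_multc)
    qed
  qed
  also have "\<dots> = emeasure lborel A * emeasure lborel B"
    by (subst nn_integral_cmult) auto
  finally show "?d = emeasure lborel A"
    using Bpos Bfin by (metis ennreal_divide_times ennreal_mult_divide_eq mult.commute infinity_ennreal_def)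
qed simp

lemma distr_lborel_Complex: "distr (lborel \<Otimes>\<^sub>M lborel) borel (\<lambda>(x, y). Complex x y) = lborel"
proof (rule lborel_eqI[symmetric])
  have meas: "(\<lambda>(x, y). Complex x y) \<in> borel_measurable (lborel \<Otimes>\<^sub>M lborel)"
    unfolding Complex_eq by measurable
  fix l u :: complex
  assume le: "\<And>b. b \<in> Basis \<Longrightarrow> l \<bullet> b \<le> u \<bullet> b"
  have le': "Re l \<le> Re u" "Im l \<le> Im u" using le[of 1] le[of \<i>] by (auto simp: Basis_complex_def)
  have "(\<lambda>(x, y). Complex x y) -` box l u \<inter> space (lborel \<Otimes>\<^sub>M lborel) = {Re l<..<Re u} \<times> {Im l<..<Im u}"
    by (auto simp: box_def Basis_complex_def space_pair_measure)
  then show "emeasure (distr (lborel \<Otimes>\<^sub>M lborel) borel (\<lambda>(x, y). Complex x y)) (box l u) = (\<Prod>b\<in>Basis. (u - l) \<bullet> b)"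
    using le' meas
    by (simp add: emeasure_distr lborel.emeasure_pair_measure_Times Basis_complex_def ennreal_mult[symmetric])
qed simp

lemma nn_integral_lborel_complex:
  assumes [measurable]: "f \<in> borel_measurable borel"
  shows "(\<integral>\<^sup>+z. f z \<partial>lborel) = (\<integral>\<^sup>+x. \<integral>\<^sup>+y. f (Complex x y) \<partial>lborel \<partial>lborel)"
proof -
  have [measurable]: "(\<lambda>(x, y). Complex x y) \<in> borel_measurable (lborel \<Otimes>\<^sub>M lborel)"
    unfolding Complex_eq by measurable
  have "(\<integral>\<^sup>+z. f z \<partial>lborel) = (\<integral>\<^sup>+p. f (case p of (x, y) \<Rightarrow> Complex x y) \<partial>(lborel \<Otimes>\<^sub>M lborel))"
    by (subst distr_lborel_Complex[symmetric], subst nn_integral_distr) auto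
  also have "\<dots> = (\<integral>\<^sup>+x. \<integral>\<^sup>+y. f (Complex x y) \<partial>lborel \<partial>lborel)"
    by (subst lborel.nn_integral_fst[symmetric]) auto
  finally show ?thesis .
qed

text \<open>Completing the square makes the integrand a multiple of the normal density with mean
  \<open>a / (2 * \<nu>)\<close> and variance \<open>1 / (2 * \<nu>)\<close>.\<close>

lemma has_bochner_integral_gaussian:
  fixes a \<nu> :: real
  assumes "\<nu> > 0"
  shows "has_bochner_integral lborel (\<lambda>x. exp (a * x - \<nu> * x\<^sup>2)) (sqrt (pi / \<nu>) * exp (a\<^sup>2 / (4 * \<nu>)))"
proof -
  define s where "s = 1 / sqrt (2 * \<nu>)"
  have s: "s > 0" "s\<^sup>2 = 1 / (2 * \<nu>)" using assms by (auto simp: s_def power_divide)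
  define m where "m = a / (2 * \<nu>)"
  have "has_bochner_integral lborel (\<lambda>x. normal_density m s x) 1"
    using s by (simp add: has_bochner_integral_iff)
  then have "has_bochner_integral lborel (\<lambda>x. (sqrt (pi / \<nu>) * exp (a\<^sup>2 / (4 * \<nu>))) * normal_density m s x) ((sqrt (pi / \<nu>) * exp (a\<^sup>2 / (4 * \<nu>))) * 1)"
    by (rule has_bochner_integral_mult_right)
  moreover have "(sqrt (pi / \<nu>) * exp (a\<^sup>2 / (4 * \<nu>))) * normal_density m s x = exp (a * x - \<nu> * x\<^sup>2)" for x
  proof -
    have "a\<^sup>2 / (4 * \<nu>) + - (x - m)\<^sup>2 / (2 * s\<^sup>2) = a * x - \<nu> * x\<^sup>2"
      unfolding s m_def using assms by (simp add: field_simps power2_eq_square)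
    moreover have "sqrt (pi / \<nu>) * (1 / sqrt (2 * pi * s\<^sup>2)) = 1"
      unfolding s using assms by simp
    ultimately show ?thesis
      unfolding normal_density_def using assms by (simp add: exp_add[symmetric])
  qed
  ultimately show ?thesis by simp
qed

lemma nn_integral_gaussian:
  fixes a \<nu> :: real
  assumes "\<nu> > 0"
  shows "(\<integral>\<^sup>+x. exp (a * x - \<nu> * x\<^sup>2) \<partial>lborel) = ennreal (sqrt (pi / \<nu>) * exp (a\<^sup>2 / (4 * \<nu>)))"
  using has_bochner_integral_gaussian[OF assms, of a]
  by (subst nn_integral_eq_integral) (auto simp: has_bochner_integral_iff)

text \<open>With z = x + iy the weight and the squared modulus of exp (a z) both factor into a
  function of x and one of y, which leaves two real Gaussian integrals. Seen as a function of |a|,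
  the value is a generating function for the moments of the weight.\<close>

lemma nn_integral_exp_gaussian_complex:
  fixes a :: complex
  assumes "\<nu> > 0"
  shows "(\<integral>\<^sup>+z. (norm (exp (a * z)))\<^sup>2 * exp (- \<nu> * (norm z)\<^sup>2) \<partial>lborel) = ennreal (pi / \<nu> * exp ((norm a)\<^sup>2 / \<nu>))"
proof -
  have eq: "(norm (exp (a * Complex x y)))\<^sup>2 * exp (- \<nu> * (norm (Complex x y))\<^sup>2) =
     exp (2 * Re a * x - \<nu> * x\<^sup>2) * exp (- 2 * Im a * y - \<nu> * y\<^sup>2)" for x y
    by (simp add: cmod_power2 exp_double[symmetric] exp_add[symmetric] algebra_simps)
  have "(\<integral>\<^sup>+z. (norm (exp (a * z)))\<^sup>2 * exp (- \<nu> * (norm z)\<^sup>2) \<partial>lborel) =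
     (\<integral>\<^sup>+x. \<integral>\<^sup>+y. ennreal (exp (2 * Re a * x - \<nu> * x\<^sup>2)) * ennreal (exp (- 2 * Im a * y - \<nu> * y\<^sup>2)) \<partial>lborel \<partial>lborel)"
    by (subst nn_integral_lborel_complex) (measurable, simp only: eq, simp add: ennreal_mult)
  also have "\<dots> = ennreal (sqrt (pi / \<nu>) * exp ((2 * Re a)\<^sup>2 / (4 * \<nu>))) * ennreal (sqrt (pi / \<nu>) * exp ((- 2 * Im a)\<^sup>2 / (4 * \<nu>)))"
    using nn_integral_gaussian[OF assms, of "2 * Re a"] nn_integral_gaussian[OF assms, of "- 2 * Im a"]
    by (simp add: nn_integral_cmult nn_integral_multc)
  also have "\<dots> = ennreal (pi / \<nu> * exp ((norm a)\<^sup>2 / \<nu>))"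
  proof -
    have "(2 * Re a)\<^sup>2 / (4 * \<nu>) + (- 2 * Im a)\<^sup>2 / (4 * \<nu>) = (norm a)\<^sup>2 / \<nu>"
      by (simp add: cmod_power2 power_mult_distrib add_divide_distrib)
    moreover have "sqrt (pi / \<nu>) * sqrt (pi / \<nu>) = pi / \<nu>" using assms by simp
    moreover have "sqrt (pi / \<nu>) * exp p * (sqrt (pi / \<nu>) * exp q) = (sqrt (pi / \<nu>) * sqrt (pi / \<nu>)) * exp (p + q)" for p q
      by (simp only: exp_add mult_ac)
    ultimately show ?thesis using assms
      by (subst ennreal_mult[symmetric]) auto
  qed
  finally show ?thesis .
qed

text \<open>A nonzero power series has an isolated zero at the origin, while the difference of the
  two series vanishes on a half line. Only nonnegative reals are tested because the moment identity
  is available for these alone, and because on slices the real axis is the only common part.\<close>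

lemma powser_unique:
  fixes a b :: "nat \<Rightarrow> 'a::{real_normed_field,banach}"
  assumes a: "\<And>x::real. x \<ge> 0 \<Longrightarrow> (\<lambda>n. a n * of_real x ^ n) sums f x"
    and b: "\<And>x::real. x \<ge> 0 \<Longrightarrow> (\<lambda>n. b n * of_real x ^ n) sums f x"
  shows "a = b"
proof (rule ccontr)
  assume "a \<noteq> b"
  then obtain m where m: "a m \<noteq> b m" by auto
  define d where "d n = a n - b n" for n
  have z: "(\<lambda>n. d n * of_real x ^ n) sums 0" if "x \<ge> 0" for x :: real
    using sums_diff[OF a[OF that] b[OF that]] by (simp add: d_def algebra_simps)
  \<comment> \<open>\<open>powser_0_nonzero\<close> asks for a series that vanishes at 0 and for a
    nonzero coefficient of positive index.\<close>
  have d0: "d 0 = 0" using z[of 0] by simp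
  with m have "m > 0" by (cases m) (auto simp: d_def)
  define g where "g w = (\<Sum>n. d n * w ^ n)" for w :: 'a
  have sm: "(\<lambda>n. d n * (w - 0) ^ n) sums g w" if "norm (w - 0) < 1" for w
    unfolding g_def using that sums_summable[OF z[of 1]] powser_inside[of d 1 w]
    by (auto intro: summable_sums)
  have g0: "g 0 = 0" using sm[of 0] d0 by (metis diff_0_right norm_zero powser_sums_zero_iff sums_unique2 zero_less_one diff_self)
  obtain s where s: "0 < s" "\<And>w. w \<in> cball 0 s - {0} \<Longrightarrow> g w \<noteq> 0"
    using powser_0_nonzero[of 1 0 d g m, OF _ sm g0] m \<open>m > 0\<close> by (auto simp: d_def)
  have "g (of_real s) = 0" unfolding g_def using z[of s] s(1) by (simp add: sums_iff)
  moreover have "of_real s \<in> cball 0 s - {0 :: 'a}" using s(1) by simp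
  ultimately show False using s(2) by blast
qed

section \<open>The Fock norm of a power series\<close>

lemma borel_measurable_cnj [measurable (raw)]:
  "f \<in> borel_measurable M \<Longrightarrow> (\<lambda>x. cnj (f x)) \<in> borel_measurable M"
  by (rule borel_measurable_continuous_on[OF continuous_on_cnj[OF continuous_on_id]])

text \<open>Orthogonality of the characters on the circle. Absolute summability bounds the sum
  uniformly in the angle, which justifies both term by term integrations.\<close>

lemma circle_parseval:
  fixes b :: "nat \<Rightarrow> complex"
  assumes s: "summable (\<lambda>n. norm (b n))"
  shows "(\<integral>\<^sup>+\<theta>. (norm (\<Sum>n. b n * cis (real n * \<theta>)))\<^sup>2 \<partial>restrict_space lborel {0..2 * pi})
    = ennreal (2 * pi * (\<Sum>n. (norm (b n))\<^sup>2))"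
proof -
  define M where "M = restrict_space lborel {0..2 * pi}"
  have spM: "emeasure M (space M) = ennreal (2 * pi)"
    by (simp add: M_def emeasure_restrict_space space_restrict_space)
  interpret finite_measure M by standard (simp add: spM)
  have mM: "measure M (space M) = 2 * pi" by (simp add: measure_def spM)
  have cis_m [measurable]: "(\<lambda>\<theta>. cis (real n * \<theta>)) \<in> borel_measurable M" for n
    unfolding M_def by (intro measurable_restrict_space1) (auto intro!: borel_measurable_continuous_onI continuous_intros)
  have int1: "(LINT \<theta>|M. cis (real n * \<theta>) * cnj (cis (real m * \<theta>))) = (if n = m then of_real (2 * pi) else 0)" for n m
  proof (cases "n = m")
    case True
    then have "(LINT \<theta>|M. cis (real n * \<theta>) * cnj (cis (real m * \<theta>))) = (LINT \<theta>|M. 1)"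
      by (simp add: cis_cnj cis_mult)
    then show ?thesis using True by (simp add: mM scaleR_conv_of_real)
  next
    case False
    define k where "k = real n - real m"
    have k: "k \<noteq> 0" using False by (simp add: k_def)
    have "(LINT \<theta>|M. cis (real n * \<theta>) * cnj (cis (real m * \<theta>))) = (LINT \<theta>|lborel. indicator {0..2*pi} \<theta> *\<^sub>R cis (k * \<theta>))"
      unfolding M_def by (subst integral_restrict_space) (auto simp: k_def cis_cnj cis_mult algebra_simps)
    also have "\<dots> = cis (k * (2*pi)) / (\<i> * k) - cis (k * 0) / (\<i> * k)"
    proof (rule integral_FTC_atLeastAtMost)
      show "((\<lambda>\<theta>. cis (k * \<theta>) / (\<i> * k)) has_vector_derivative cis (k * x)) (at x within {0..2*pi})" for x
        unfolding has_vector_derivative_def using k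
        by (auto intro!: derivative_eq_intros simp: scaleR_conv_of_real algebra_simps)
    qed (auto intro!: continuous_intros)
    also have "cis (k * (2*pi)) = 1"
      using cis_multiple_2pi[of k] by (simp add: k_def mult_ac)
    finally show ?thesis using False by simp
  qed
  define G where "G \<theta> = (\<Sum>n. b n * cis (real n * \<theta>))" for \<theta>
  have [measurable]: "G \<in> borel_measurable M" unfolding G_def by measurable
  have sb: "summable (\<lambda>n. norm (b n * cis (real n * \<theta>)))" for \<theta>
    using s by (simp add: norm_mult)
  define B where "B = (\<Sum>n. norm (b n))"
  have Gb: "norm (G \<theta>) \<le> B" for \<theta>
    unfolding G_def B_def using summable_norm[OF sb[of \<theta>]] by (simp add: norm_mult)
  have bint: "integrable M f" if "f \<in> borel_measurable M" "\<And>x. norm (f x) \<le> C" for f :: "real \<Rightarrow> complex" and C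
    using that by (intro integrable_const_bound[where B=C]) auto
  have int2: "(LINT \<theta>|M. cis (real n * \<theta>) * cnj (G \<theta>)) = 2 * pi * cnj (b n)" for n
  proof -
    have eq: "cis (real n * \<theta>) * cnj (G \<theta>) = (\<Sum>m. cnj (b m) * (cis (real n * \<theta>) * cnj (cis (real m * \<theta>))))" for \<theta>
    proof -
      have "cnj (G \<theta>) = (\<Sum>m. cnj (b m * cis (real m * \<theta>)))"
        unfolding G_def by (rule bounded_linear.suminf[OF bounded_linear_cnj]) (rule summable_norm_cancel[OF sb])
      moreover have "summable (\<lambda>m. cnj (b m * cis (real m * \<theta>)))"
        by (rule summable_norm_cancel) (use s in \<open>simp add: norm_mult\<close>)
      ultimately show ?thesis by (simp add: suminf_mult[symmetric] mult_ac)
    qed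
    have "(LINT \<theta>|M. cis (real n * \<theta>) * cnj (G \<theta>)) = (\<Sum>m. LINT \<theta>|M. cnj (b m) * (cis (real n * \<theta>) * cnj (cis (real m * \<theta>))))"
      unfolding eq
    proof (rule integral_suminf)
      show "integrable M (\<lambda>\<theta>. cnj (b m) * (cis (real n * \<theta>) * cnj (cis (real m * \<theta>))))" for m
        by (rule bint[where C="norm (b m)"]) (auto simp: norm_mult)
    qed (use s in \<open>auto simp: norm_mult mM summable_mult2\<close>)
    also have "\<dots> = (\<Sum>m. if m = n then 2 * pi * cnj (b n) else 0)"
      by (intro suminf_cong) (auto simp: int1)
    also have "\<dots> = 2 * pi * cnj (b n)" by (rule sums_unique[symmetric]) (rule sums_single)
    finally show ?thesis .
  qed
  \<comment> \<open>Only one of the two factors of |G|^2 is expanded. Each integration then runs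
    over a single series, and the Fourier coefficients \<open>int2\<close> finish the
    computation.\<close>
  have eqG: "complex_of_real ((norm (G \<theta>))\<^sup>2) = (\<Sum>n. b n * (cis (real n * \<theta>) * cnj (G \<theta>)))" for \<theta>
  proof -
    have "complex_of_real ((norm (G \<theta>))\<^sup>2) = G \<theta> * cnj (G \<theta>)" by (rule complex_norm_square)
    also have "\<dots> = (\<Sum>n. b n * cis (real n * \<theta>) * cnj (G \<theta>))"
      unfolding G_def by (rule suminf_mult2) (rule summable_norm_cancel[OF sb])
    finally show ?thesis by (simp add: mult_ac)
  qed
  have "(LINT \<theta>|M. complex_of_real ((norm (G \<theta>))\<^sup>2)) = (\<Sum>n. LINT \<theta>|M. b n * (cis (real n * \<theta>) * cnj (G \<theta>)))"
    unfolding eqG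
  proof (rule integral_suminf)
    have le: "norm (b n * (cis (real n * \<theta>) * cnj (G \<theta>))) \<le> norm (b n) * B" for n \<theta>
      using Gb[of \<theta>] by (simp add: norm_mult mult_left_mono)
    show i: "integrable M (\<lambda>\<theta>. b n * (cis (real n * \<theta>) * cnj (G \<theta>)))" for n
      by (rule bint[OF _ le]) auto
    show "AE \<theta> in M. summable (\<lambda>n. norm (b n * (cis (real n * \<theta>) * cnj (G \<theta>))))"
    proof (intro AE_I2 summable_comparison_test'[OF summable_mult2[OF s, of B]])
      show "norm (norm (b n * (cis (real n * \<theta>) * cnj (G \<theta>)))) \<le> norm (b n) * B" for n \<theta>
        using le by simp
    qed
    show "summable (\<lambda>n. LINT \<theta>|M. norm (b n * (cis (real n * \<theta>) * cnj (G \<theta>))))"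
    proof (rule summable_comparison_test'[OF summable_mult2[OF s, of "B * (2 * pi)"]])
      fix n
      have "(LINT \<theta>|M. norm (b n * (cis (real n * \<theta>) * cnj (G \<theta>)))) \<le> (LINT \<theta>|M. norm (b n) * B)"
        by (intro integral_mono integrable_norm i le) simp
      then show "norm (LINT \<theta>|M. norm (b n * (cis (real n * \<theta>) * cnj (G \<theta>)))) \<le> norm (b n) * (B * (2 * pi))"
        by (simp add: mM mult_ac)
    qed
  qed
  also have "\<dots> = (\<Sum>n. complex_of_real (2 * pi * (norm (b n))\<^sup>2))"
    unfolding integral_mult_right_zero int2
    by (intro suminf_cong) (simp only: of_real_mult of_real_numeral complex_norm_square mult_ac)
  finally have R: "complex_of_real (LINT \<theta>|M. (norm (G \<theta>))\<^sup>2) = (\<Sum>n. complex_of_real (2 * pi * (norm (b n))\<^sup>2))"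
    by (simp only: integral_complex_of_real)
  have s2: "summable (\<lambda>n. (norm (b n))\<^sup>2)"
  proof (rule summable_comparison_test_ev[OF _ s])
    have "eventually (\<lambda>n. norm (b n) < 1) sequentially"
      using summable_LIMSEQ_zero[OF s] by (rule order_tendstoD) simp
    then show "eventually (\<lambda>n. norm ((norm (b n))\<^sup>2) \<le> norm (b n)) sequentially"
      by eventually_elim (simp add: power2_eq_square mult_left_le)
  qed
  have "(\<Sum>n. complex_of_real (2 * pi * (norm (b n))\<^sup>2)) = complex_of_real (2 * pi * (\<Sum>n. (norm (b n))\<^sup>2))"
    using bounded_linear.suminf[OF bounded_linear_of_real summable_mult[OF s2, of "2 * pi"], symmetric]
    by (simp only: suminf_mult[OF s2])
  with R have L: "(LINT \<theta>|M. (norm (G \<theta>))\<^sup>2) = 2 * pi * (\<Sum>n. (norm (b n))\<^sup>2)"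
    by (metis of_real_eq_iff)
  have "(\<integral>\<^sup>+\<theta>. (norm (G \<theta>))\<^sup>2 \<partial>M) = ennreal (LINT \<theta>|M. (norm (G \<theta>))\<^sup>2)"
    by (intro nn_integral_eq_integral integrable_const_bound[where B="B\<^sup>2"])
       (auto intro!: power_mono Gb)
  then show ?thesis by (simp only: L) (simp only: M_def G_def)
qed

lemma nn_integral_lborel_rotate:
  assumes [measurable]: "f \<in> borel_measurable borel"
  shows "(\<integral>\<^sup>+z. f (cis \<theta> * z) \<partial>lborel) = (\<integral>\<^sup>+z. f z \<partial>lborel)"
proof -
  have "orthogonal_transformation (\<lambda>z. cis \<theta> * z)"
    by (simp add: orthogonal_transformation norm_mult linear_times)
  from distr_lborel_orthogonal[OF this]
  have "(\<integral>\<^sup>+z. f z \<partial>lborel) = (\<integral>\<^sup>+z. f z \<partial>distr lborel borel (\<lambda>z. cis \<theta> * z))"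
    by simp
  also have "\<dots> = (\<integral>\<^sup>+z. f (cis \<theta> * z) \<partial>lborel)"
    by (rule nn_integral_distr) auto
  finally show ?thesis by simp
qed

text \<open>Averaging over rotations takes the place of polar coordinates: the integral does not
  change when \<open>z\<close> is replaced by \<open>cis \<theta> * z\<close>, and after exchanging
  the integrals the mean over the angle at fixed \<open>z\<close> is given by Parseval. Both sides
  may be infinite, so the identity also decides integrability.\<close>

lemma nn_integral_power_series_gaussian:
  fixes c :: "nat \<Rightarrow> complex"
  assumes s: "\<And>r. summable (\<lambda>n. norm (c n) * r ^ n)"
  shows "(\<integral>\<^sup>+z. (norm (\<Sum>n. c n * z ^ n))\<^sup>2 * exp (- \<nu> * (norm z)\<^sup>2) \<partial>lborel)
    = (\<Sum>n. ennreal ((norm (c n))\<^sup>2) * (\<integral>\<^sup>+z. norm (z :: complex) ^ (2 * n) * exp (- \<nu> * (norm z)\<^sup>2) \<partial>lborel))"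
proof -
  define g where "g z = (\<Sum>n. c n * z ^ n)" for z
  define w where "w z = exp (- \<nu> * (norm z)\<^sup>2)" for z :: complex
  have [measurable]: "g \<in> borel_measurable borel" unfolding g_def by measurable
  have [measurable]: "w \<in> borel_measurable borel" unfolding w_def by measurable
  define L where "L = (\<integral>\<^sup>+z. ennreal ((norm (g z))\<^sup>2 * w z) \<partial>lborel)"
  define M where "M = restrict_space lborel {0..2 * pi}"
  have spM: "emeasure M (space M) = ennreal (2 * pi)"
    by (simp add: M_def emeasure_restrict_space space_restrict_space)
  interpret finite_measure M by standard (simp add: spM)
  interpret P: pair_sigma_finite M "lborel :: complex measure" ..
  have M1 [measurable]: "(\<lambda>x. x) \<in> measurable M borel"
    unfolding M_def by (intro measurable_restrict_space1) simp
  have [measurable]: "cis \<in> borel_measurable borel"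
    by (intro borel_measurable_continuous_onI continuous_intros)
  have rot: "(\<integral>\<^sup>+z. ennreal ((norm (g (cis \<theta> * z)))\<^sup>2 * w z) \<partial>lborel) = L" for \<theta>
    using nn_integral_lborel_rotate[of "\<lambda>z. ennreal ((norm (g z))\<^sup>2 * w z)" \<theta>]
    by (simp add: L_def w_def norm_mult)
  have par: "(\<integral>\<^sup>+\<theta>. ennreal ((norm (g (cis \<theta> * z)))\<^sup>2 * w z) \<partial>M)
      = ennreal (2 * pi) * (\<Sum>n. ennreal ((norm (c n))\<^sup>2) * ennreal (norm z ^ (2 * n) * w z))" for z
  proof -
    have sz: "summable (\<lambda>n. norm (c n * z ^ n))" using s[of "norm z"] by (simp add: norm_mult norm_power)
    have g: "g (cis \<theta> * z) = (\<Sum>n. c n * z ^ n * cis (real n * \<theta>))" for \<theta>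
    proof -
      have "(cis \<theta> * z) ^ n = cis (real n * \<theta>) * z ^ n" for n
        by (simp only: power_mult_distrib Complex.DeMoivre)
      then show ?thesis unfolding g_def by (simp add: mult_ac)
    qed
    have s2: "summable (\<lambda>n. (norm (c n * z ^ n))\<^sup>2)"
    proof (rule summable_comparison_test_ev[OF _ sz])
      have "eventually (\<lambda>n. norm (c n * z ^ n) < 1) sequentially"
        using summable_LIMSEQ_zero[OF sz] by (rule order_tendstoD) simp
      then show "eventually (\<lambda>n. norm ((norm (c n * z ^ n))\<^sup>2) \<le> norm (c n * z ^ n)) sequentially"
        by eventually_elim (simp add: power2_eq_square mult_left_le)
    qed
    have w: "w z \<ge> 0" by (simp add: w_def)
    have "(\<integral>\<^sup>+\<theta>. ennreal ((norm (g (cis \<theta> * z)))\<^sup>2 * w z) \<partial>M) = (\<integral>\<^sup>+\<theta>. ennreal ((norm (g (cis \<theta> * z)))\<^sup>2) * ennreal (w z) \<partial>M)"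
      using w by (simp add: ennreal_mult)
    also have "\<dots> = (\<integral>\<^sup>+\<theta>. ennreal ((norm (g (cis \<theta> * z)))\<^sup>2) \<partial>M) * ennreal (w z)"
      by (rule nn_integral_multc) measurable
    also have "\<dots> = ennreal (2 * pi * (\<Sum>n. (norm (c n * z ^ n))\<^sup>2)) * ennreal (w z)"
      unfolding g M_def by (simp only: circle_parseval[OF sz])
    also have "\<dots> = ennreal (2 * pi) * (ennreal (\<Sum>n. (norm (c n * z ^ n))\<^sup>2) * ennreal (w z))"
      by (subst ennreal_mult) (auto intro!: suminf_nonneg s2 simp: mult.assoc)
    also have "ennreal (\<Sum>n. (norm (c n * z ^ n))\<^sup>2) = (\<Sum>n. ennreal ((norm (c n * z ^ n))\<^sup>2))"
      by (rule suminf_ennreal2[symmetric]) (auto intro: s2)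
    also have "(\<Sum>n. ennreal ((norm (c n * z ^ n))\<^sup>2)) * ennreal (w z) = (\<Sum>n. ennreal ((norm (c n))\<^sup>2) * ennreal (norm z ^ (2 * n) * w z))"
      using w by (subst ennreal_suminf_multc[symmetric])
        (auto intro!: suminf_cong simp: ennreal_mult[symmetric] norm_mult norm_power power_mult_distrib power_mult[symmetric] mult_ac)
    finally show ?thesis .
  qed
  have "ennreal (2 * pi) * L = (\<integral>\<^sup>+\<theta>. L \<partial>M)" by (simp add: spM mult.commute)
  also have "\<dots> = (\<integral>\<^sup>+\<theta>. \<integral>\<^sup>+z. ennreal ((norm (g (cis \<theta> * z)))\<^sup>2 * w z) \<partial>lborel \<partial>M)"
    by (simp add: rot)
  also have "\<dots> = (\<integral>\<^sup>+z. \<integral>\<^sup>+\<theta>. ennreal ((norm (g (cis \<theta> * z)))\<^sup>2 * w z) \<partial>M \<partial>lborel)"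
    by (rule P.Fubini'[symmetric]) measurable
  also have "\<dots> = ennreal (2 * pi) * (\<Sum>n. ennreal ((norm (c n))\<^sup>2) * (\<integral>\<^sup>+z. ennreal (norm z ^ (2 * n) * w z) \<partial>lborel))"
    unfolding par by (simp add: nn_integral_cmult nn_integral_suminf)
  finally have "L = (\<Sum>n. ennreal ((norm (c n))\<^sup>2) * (\<integral>\<^sup>+z. ennreal (norm z ^ (2 * n) * w z) \<partial>lborel))"
    by (subst (asm) ennreal_mult_cancel_left) auto
  then show ?thesis by (simp add: L_def g_def w_def)
qed

text \<open>The moments are read off by computing the norm of \<open>exp (a z)\<close> directly and by the previous
  lemma, for all \<open>a\<close>.\<close>

lemma nn_integral_monomial_gaussian:
  assumes \<nu>: "\<nu> > 0"
  shows "(\<integral>\<^sup>+z. norm (z :: complex) ^ (2 * n) * exp (- \<nu> * (norm z)\<^sup>2) \<partial>lborel) = ennreal (pi / \<nu> * (fact n / \<nu> ^ n))"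
proof -
  define \<mu> where "\<mu> n = (\<integral>\<^sup>+z. ennreal (norm (z :: complex) ^ (2 * n) * exp (- \<nu> * (norm z)\<^sup>2)) \<partial>lborel)" for n
  have gen: "(\<Sum>n. ennreal (x ^ n / (fact n)\<^sup>2) * \<mu> n) = ennreal (pi / \<nu> * exp (x / \<nu>))" if "x \<ge> 0" for x :: real
  proof -
    define a where "a = complex_of_real (sqrt x)"
    have na: "norm a = sqrt x" using that by (simp add: a_def)
    have ex: "exp (a * z) = (\<Sum>n. (a ^ n / fact n) * z ^ n)" for z
      by (simp add: exp_def power_mult_distrib scaleR_conv_of_real field_simps)
    have nc: "norm (a ^ n / fact n) = sqrt x ^ n / fact n" for n
      by (simp add: norm_divide norm_power na)
    have "(\<Sum>n. ennreal ((norm (a ^ n / fact n))\<^sup>2) * \<mu> n) = ennreal (pi / \<nu> * exp ((norm a)\<^sup>2 / \<nu>))"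
      unfolding \<mu>_def nn_integral_exp_gaussian_complex[OF \<nu>, of a, symmetric] ex
    proof (rule nn_integral_power_series_gaussian[symmetric])
      show "summable (\<lambda>n. norm (a ^ n / fact n) * r ^ n)" for r
        using summable_exp[of "sqrt x * r"] by (simp add: nc power_mult_distrib field_simps)
    qed
    moreover have "(norm (a ^ n / fact n))\<^sup>2 = x ^ n / (fact n)\<^sup>2" for n
      using that unfolding nc by (simp add: power_divide power_mult[symmetric] mult.commute[of n 2]) (simp add: power_mult)
    ultimately show ?thesis using that by (simp add: na)
  qed
  \<comment> \<open>Up to a positive factor each moment is a term of the series \<open>gen\<close>
    at \<open>x = 1\<close>, whose sum is finite.\<close>
  have fin: "\<mu> n \<noteq> \<infinity>" for n
  proof
    assume "\<mu> n = \<infinity>"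
    then have "ennreal (1 ^ n / (fact n)\<^sup>2) * \<mu> n = \<infinity>" by (simp add: ennreal_mult_eq_top_iff)
    moreover have "ennreal (1 ^ n / (fact n)\<^sup>2) * \<mu> n \<le> (\<Sum>n. ennreal (1 ^ n / (fact n)\<^sup>2) * \<mu> n)"
      using sum_le_suminf[of "\<lambda>n. ennreal (1 ^ n / (fact n)\<^sup>2) * \<mu> n" "{n}"] by (simp add: summableI)
    ultimately show False using gen[of 1] by (simp add: top_unique)
  qed
  define m where "m n = enn2real (\<mu> n)" for n
  have m: "\<mu> n = ennreal (m n)" "m n \<ge> 0" for n using fin[of n] by (simp_all add: m_def ennreal_enn2real_if)
  have s1: "(\<lambda>n. (m n / (fact n)\<^sup>2) * of_real x ^ n) sums (pi / \<nu> * exp (x / \<nu>))" if "x \<ge> 0" for x :: real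
  proof -
    have "(\<Sum>n. ennreal (x ^ n / (fact n)\<^sup>2 * m n)) = ennreal (pi / \<nu> * exp (x / \<nu>))"
      unfolding gen[OF that, symmetric] using that m by (intro suminf_cong) (simp add: ennreal_mult del: times_divide_eq_left)
    then have "(\<lambda>n. x ^ n / (fact n)\<^sup>2 * m n) sums (pi / \<nu> * exp (x / \<nu>))"
      using that m(2) \<nu> by (subst sums_ennreal[symmetric]) (auto intro!: summableI simp: sums_iff)
    then show ?thesis by (simp add: mult_ac)
  qed
  have s2: "(\<lambda>n. (pi / \<nu> / (\<nu> ^ n * fact n)) * of_real x ^ n) sums (pi / \<nu> * exp (x / \<nu>))" for x :: real
    using sums_mult[OF exp_converges[of "x / \<nu>"], of "pi / \<nu>"] by (simp add: field_simps)
  have "(\<lambda>n. m n / (fact n)\<^sup>2) = (\<lambda>n. pi / \<nu> / (\<nu> ^ n * fact n))"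
    by (rule powser_unique[OF s1 s2])
  then have "m n / (fact n)\<^sup>2 = pi / \<nu> / (\<nu> ^ n * fact n)" by (rule fun_cong)
  then have "m n = pi / \<nu> * (fact n / \<nu> ^ n)"
    by (simp add: field_simps power2_eq_square)
  then show ?thesis using m(1)[of n] by (simp add: \<mu>_def)
qed

lemma integrable_power_series_gaussian_iff:
  fixes c :: "nat \<Rightarrow> complex"
  assumes \<nu>: "\<nu> > 0" and s: "\<And>r. summable (\<lambda>n. norm (c n) * r ^ n)"
  shows "integrable lborel (\<lambda>z. (norm (\<Sum>n. c n * z ^ n))\<^sup>2 * exp (- \<nu> * (norm z)\<^sup>2)) \<longleftrightarrow>
    summable (\<lambda>n. (norm (c n))\<^sup>2 * (fact n / \<nu> ^ n))" (is "integrable _ ?f \<longleftrightarrow> _")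
proof -
  have "integrable lborel ?f \<longleftrightarrow> (\<integral>\<^sup>+z. ennreal (?f z) \<partial>lborel) < \<infinity>"
    by (subst integrable_iff_bounded) simp
  also have "(\<integral>\<^sup>+z. ennreal (?f z) \<partial>lborel) = (\<Sum>n. ennreal (pi / \<nu> * ((norm (c n))\<^sup>2 * (fact n / \<nu> ^ n))))"
    unfolding nn_integral_power_series_gaussian[OF s] nn_integral_monomial_gaussian[OF \<nu>]
    using \<nu> by (simp add: ennreal_mult[symmetric] mult_ac)
  also have "\<dots> < \<infinity> \<longleftrightarrow> summable (\<lambda>n. pi / \<nu> * ((norm (c n))\<^sup>2 * (fact n / \<nu> ^ n)))"
  proof
    assume "(\<Sum>n. ennreal (pi / \<nu> * ((norm (c n))\<^sup>2 * (fact n / \<nu> ^ n)))) < \<infinity>"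
    then show "summable (\<lambda>n. pi / \<nu> * ((norm (c n))\<^sup>2 * (fact n / \<nu> ^ n)))"
      using \<nu> by (intro summable_suminf_not_top) auto
  next
    assume "summable (\<lambda>n. pi / \<nu> * ((norm (c n))\<^sup>2 * (fact n / \<nu> ^ n)))"
    then have "(\<Sum>n. ennreal (pi / \<nu> * ((norm (c n))\<^sup>2 * (fact n / \<nu> ^ n)))) \<noteq> \<top>"
      using \<nu> by (intro ennreal_suminf_neq_top) auto
    then show "(\<Sum>n. ennreal (pi / \<nu> * ((norm (c n))\<^sup>2 * (fact n / \<nu> ^ n)))) < \<infinity>"
      by (simp only: infinity_ennreal_def less_top)
  qed
  also have "\<dots> \<longleftrightarrow> summable (\<lambda>n. (norm (c n))\<^sup>2 * (fact n / \<nu> ^ n))"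
    using \<nu> by (subst summable_cmult_iff) auto
  finally show ?thesis .
qed

section \<open>Slice regular functions\<close>

lemma quat_sphere_iff: "I \<in> quat_sphere \<longleftrightarrow> qRe I = 0 \<and> norm I = 1"
proof
  assume "I \<in> quat_sphere"
  then have "I * I = -1" by (simp add: quat_sphere_def power2_eq_square)
  then have e: "qRe I * qRe I - qI I * qI I - qJ I * qJ I - qK I * qK I = -1"
    "qRe I * qI I = 0" "qRe I * qJ I = 0" "qRe I * qK I = 0"
    by (auto simp: quat_eq_iff)
  have "qRe I = 0"
  proof (rule ccontr)
    assume "qRe I \<noteq> 0"
    with e have "qRe I * qRe I = -1" by auto
    moreover have "qRe I * qRe I \<ge> 0" by simp
    ultimately show False by linarith
  qed
  with e show "qRe I = 0 \<and> norm I = 1"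
    by (simp add: norm_quat_def inner_quat_def)
next
  assume "qRe I = 0 \<and> norm I = 1"
  then have "qRe I = 0" "inner I I = 1" by (auto simp: norm_quat_def)
  then show "I \<in> quat_sphere"
    by (auto simp: quat_sphere_def power2_eq_square quat_eq_iff inner_quat_def)
qed

lemma quat_sphere_square: "I \<in> quat_sphere \<Longrightarrow> I * I = -1"
  by (simp add: quat_sphere_def power2_eq_square)

lemma slice_emb_scaleR: "slice_emb I z = Re z *\<^sub>R 1 + Im z *\<^sub>R I"
  by (simp add: slice_emb_def of_real_def)

lemma bounded_linear_slice_emb: "bounded_linear (slice_emb I)"
proof -
  have "linear (slice_emb I)"
    by (rule linearI) (simp_all add: slice_emb_scaleR algebra_simps)
  then show ?thesis by (simp add: linear_conv_bounded_linear)
qed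

lemma slice_emb_of_real [simp]: "slice_emb I (of_real x) = of_real x"
  by (simp add: slice_emb_def)

lemma slice_emb_1 [simp]: "slice_emb I 1 = 1"
  by (simp add: slice_emb_def)

lemma slice_emb_mult:
  assumes "I \<in> quat_sphere"
  shows "slice_emb I (a * b) = slice_emb I a * slice_emb I b"
  using quat_sphere_square[OF assms]
  by (simp add: slice_emb_scaleR algebra_simps)

lemma slice_emb_power:
  "I \<in> quat_sphere \<Longrightarrow> slice_emb I (z ^ n) = slice_emb I z ^ n"
  by (induction n) (simp_all add: slice_emb_mult)

lemma norm_slice_emb [simp]:
  assumes "I \<in> quat_sphere"
  shows "norm (slice_emb I z) = norm z"
proof -
  have I: "qRe I = 0" "inner I I = 1" "inner 1 I = 0"
    using assms by (auto simp: quat_sphere_iff norm_quat_def inner_quat_def)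
  have "inner (slice_emb I z) (slice_emb I z) = (Re z)\<^sup>2 + (Im z)\<^sup>2"
    using I by (simp add: slice_emb_scaleR inner_simps inner_commute power2_eq_square)
       (simp add: inner_quat_def)
  then show ?thesis by (simp add: norm_quat_def cmod_def)
qed

lemma inj_slice_emb: "I \<in> quat_sphere \<Longrightarrow> inj (slice_emb I)"
proof (rule injI)
  fix a b assume I: "I \<in> quat_sphere" and e: "slice_emb I a = slice_emb I b"
  have "slice_emb I (a - b) = 0"
    using e by (simp add: slice_emb_scaleR algebra_simps)
  then have "norm (a - b) = 0" using norm_slice_emb[OF I, of "a - b"] by simp
  then show "a = b" by simp
qed

lemma slice_emb_eq_iff: "I \<in> quat_sphere \<Longrightarrow> slice_emb I a = slice_emb I b \<longleftrightarrow> a = b"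
  using inj_slice_emb by (auto dest: injD)

lemma slice_emb_cnj: "I \<in> quat_sphere \<Longrightarrow> slice_emb I (cnj z) = quat_cnj (slice_emb I z)"
  by (simp add: slice_emb_scaleR quat_eq_iff quat_sphere_iff)

text \<open>The normalised imaginary part of \<open>q\<close> is the unit \<open>I\<close>. A real
  \<open>q\<close> lies in every slice and determines no unit; then \<open>i\<close> is
  taken.\<close>

lemma slice_emb_surj:
  assumes "i \<in> quat_sphere"
  obtains I z where "I \<in> quat_sphere" "q = slice_emb I z"
proof (cases "q = qRe q *\<^sub>R 1")
  case True
  then have "q = slice_emb i (of_real (qRe q))" by (metis slice_emb_of_real of_real_def)
  then show ?thesis using assms that by blast
next
  case False
  define p where "p = q - qRe q *\<^sub>R 1"
  have p: "p \<noteq> 0" "qRe p = 0" using False by (auto simp: p_def)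
  define I where "I = p /\<^sub>R norm p"
  have "I \<in> quat_sphere" using p by (auto simp: quat_sphere_iff I_def)
  moreover have "q = slice_emb I (Complex (qRe q) (norm p))"
    using p by (simp add: slice_emb_scaleR I_def p_def)
  ultimately show ?thesis using that by blast
qed

text \<open>A real linear functional \<open>\<langle>\<cdot>, v\<rangle>\<close> on the quaternions, complexified so as to turn left
  multiplication by \<open>I\<close> into multiplication by \<open>\<i>\<close>.\<close>

definition slice_proj :: "quat \<Rightarrow> quat \<Rightarrow> quat \<Rightarrow> complex" where
  "slice_proj I v q = Complex (inner q v) (- inner (I * q) v)"

lemma bounded_linear_slice_proj: "bounded_linear (slice_proj I v)"
proof -
  have "linear (slice_proj I v)"
    by (rule linearI) (simp_all add: slice_proj_def complex_eq_iff inner_simps algebra_simps)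
  then show ?thesis by (simp add: linear_conv_bounded_linear)
qed

lemma slice_proj_mult:
  assumes "I \<in> quat_sphere"
  shows "slice_proj I v (slice_emb I z * q) = z * slice_proj I v q"
proof -
  have "I * (I * q) = - q" using quat_sphere_square[OF assms] by (simp add: mult.assoc[symmetric])
  then show ?thesis
    by (simp add: slice_proj_def complex_eq_iff slice_emb_scaleR inner_simps algebra_simps)
qed

lemma slice_proj_one: "I \<in> quat_sphere \<Longrightarrow> slice_proj I 1 1 = 1"
  by (simp add: slice_proj_def complex_eq_iff inner_quat_def quat_sphere_iff)

text \<open>Multiplied by \<open>I\<close> on the left, the regularity equation says that the real
  derivative \<open>D\<close> satisfies D I = I D 1, hence D (h) = h D 1 for all h in
  \<open>\<complex>\<^sub>I\<close>. The functional turns this left multiplication into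
  multiplication of complex numbers.\<close>

lemma slice_regular_proj_holomorphic:
  assumes F: "slice_regular F" and I: "I \<in> quat_sphere"
  shows "(\<lambda>z. slice_proj I v (F (slice_emb I z))) holomorphic_on S"
proof -
  have "\<exists>D. ((\<lambda>z. slice_proj I v (F (slice_emb I z))) has_field_derivative D) (at z)" for z
  proof -
    obtain D where D: "(F has_derivative D) (at (slice_emb I z))"
      using F unfolding slice_regular_def differentiable_def by blast
    then interpret D: bounded_linear D by (rule has_derivative_bounded_linear)
    define x y where "x = Re z" and "y = Im z"
    have z: "slice_emb I z = of_real x + of_real y * I" by (simp add: slice_emb_def x_def y_def)
    have "((\<lambda>t. F (of_real t + of_real y * I)) has_vector_derivative D 1) (at x)"
    proof -
      have "((\<lambda>t. F (of_real t + of_real y * I)) has_derivative (\<lambda>t. D (of_real t))) (at x)"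
        by (rule has_derivative_compose[where g=F]) (use D z in \<open>auto intro!: derivative_eq_intros\<close>)
      then show ?thesis by (simp add: has_vector_derivative_def of_real_def D.scaleR)
    qed
    then have 1: "vector_derivative (\<lambda>t. F (of_real t + of_real y * I)) (at x) = D 1"
      by (rule vector_derivative_at)
    have "((\<lambda>t. F (of_real x + of_real t * I)) has_vector_derivative D I) (at y)"
    proof -
      have "((\<lambda>t. F (of_real x + of_real t * I)) has_derivative (\<lambda>t. D (of_real t * I))) (at y)"
        by (rule has_derivative_compose[where g=F]) (use D z in \<open>auto intro!: derivative_eq_intros\<close>)
      then show ?thesis by (simp add: has_vector_derivative_def of_real_def D.scaleR)
    qed
    then have 2: "vector_derivative (\<lambda>t. F (of_real x + of_real t * I)) (at y) = D I"
      by (rule vector_derivative_at)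
    have "D 1 + I * D I = 0"
      using F I unfolding slice_regular_def 1[symmetric] 2[symmetric] by blast
    then have "I * D 1 + I * (I * D I) = 0" by (metis distrib_left mult_zero_right)
    then have DI: "D I = I * D 1"
      using quat_sphere_square[OF I] by (simp add: mult.assoc[symmetric])
    have "((\<lambda>z. slice_proj I v (F (slice_emb I z))) has_derivative (\<lambda>h. slice_proj I v (D (slice_emb I h)))) (at z)"
      by (rule bounded_linear.has_derivative[OF bounded_linear_slice_proj])
         (rule has_derivative_compose[where g=F, OF bounded_linear_imp_has_derivative[OF bounded_linear_slice_emb] D])
    moreover have "slice_proj I v (D (slice_emb I h)) = slice_proj I v (D 1) * h" for h
    proof -
      have "D (slice_emb I h) = slice_emb I h * D 1"
        by (simp add: slice_emb_scaleR D.add D.scaleR DI algebra_simps)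
      then show ?thesis using slice_proj_mult[OF I] by (simp add: mult.commute)
    qed
    ultimately show ?thesis unfolding has_field_derivative_def by auto
  qed
  then show ?thesis
    by (meson field_differentiable_def field_differentiable_at_within holomorphic_on_def)
qed

text \<open>The coefficients stand on the right, because right multiplication by a constant commutes
  with the operator in the definition of left slice regularity.\<close>

definition slice_series :: "quat \<Rightarrow> (nat \<Rightarrow> complex) \<Rightarrow> quat \<Rightarrow> quat" where
  "slice_series i c q = (\<Sum>n. q ^ n * slice_emb i (c n))"

definition entire_coeffs :: "(nat \<Rightarrow> complex) \<Rightarrow> bool" where
  "entire_coeffs c \<longleftrightarrow> (\<forall>r. summable (\<lambda>n. norm (c n) * r ^ n))"

lemma holomorphic_UNIV_power_series:
  assumes "f holomorphic_on UNIV"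
  obtains c where "entire_coeffs c" "\<And>z. (\<lambda>n. c n * z ^ n) sums f z"
proof
  let ?c = "\<lambda>n. (deriv ^^ n) f 0 / fact n"
  show s: "(\<lambda>n. ?c n * z ^ n) sums f z" for z
    using holomorphic_power_series[of f 0 "norm z + 1" z] assms
    by (auto intro: holomorphic_on_subset)
  show "entire_coeffs ?c" unfolding entire_coeffs_def
  proof
    fix r :: real
    have "summable (\<lambda>n. norm (?c n * of_real r ^ n))"
      using sums_summable[OF s[of "of_real (\<bar>r\<bar> + 1)"]]
      by (rule powser_insidea) simp
    moreover have "norm (?c n * of_real r ^ n) = norm (norm (?c n) * r ^ n)" for n
      by (simp add: norm_mult norm_power norm_divide abs_mult power_abs)
    ultimately have "summable (\<lambda>n. norm (norm (?c n) * r ^ n))" by (simp only:)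
    then show "summable (\<lambda>n. norm (?c n) * r ^ n)" by (rule summable_norm_cancel)
  qed
qed

lemma summable_slice_series:
  assumes "entire_coeffs c" "i \<in> quat_sphere"
  shows "summable (\<lambda>n. norm (q ^ n * slice_emb i (c n)))"
proof -
  have "norm (q ^ n * slice_emb i (c n)) = norm (c n) * norm q ^ n" for n
    using assms(2) by (simp add: norm_mult norm_power)
  then show ?thesis using assms(1) by (simp add: entire_coeffs_def)
qed

lemma slice_series_slice:
  assumes c: "entire_coeffs c" and i: "i \<in> quat_sphere"
  shows "slice_series i c (slice_emb i z) = slice_emb i (\<Sum>n. c n * z ^ n)"
proof -
  have "summable (\<lambda>n. c n * z ^ n)"
    by (rule summable_norm_cancel) (use c in \<open>simp add: norm_mult norm_power entire_coeffs_def\<close>)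
  from bounded_linear.suminf[OF bounded_linear_slice_emb this, of i]
  show ?thesis
    by (simp add: slice_series_def slice_emb_mult[OF i, symmetric] slice_emb_power[OF i, symmetric] mult.commute)
qed

text \<open>This permits comparison of coefficients on slices other than \<open>i\<close>, where the
  coefficients do not commute with the variable.\<close>

lemma slice_proj_slice_series:
  assumes c: "entire_coeffs c" and i: "i \<in> quat_sphere" and I: "I \<in> quat_sphere"
  shows "(\<lambda>n. slice_proj I v (slice_emb i (c n)) * z ^ n) sums slice_proj I v (slice_series i c (slice_emb I z))"
proof -
  have "(\<lambda>n. slice_emb I z ^ n * slice_emb i (c n)) sums slice_series i c (slice_emb I z)"
    unfolding slice_series_def by (rule summable_sums[OF summable_norm_cancel[OF summable_slice_series[OF c i]]])
  from bounded_linear.sums[OF bounded_linear_slice_proj this, of I v]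
  show ?thesis by (simp add: slice_emb_power[OF I, symmetric] slice_proj_mult[OF I] mult.commute)
qed

text \<open>An identity principle. The coefficients are those of the entire function on the slice
  \<open>i\<close>, so \<open>F\<close> and the series agree on the real axis. On any slice
  \<open>I\<close> each functional makes both of them complex power series; these agree on the reals
  and therefore everywhere. Letting \<open>v\<close> vary recovers the quaternion.\<close>

lemma slice_regular_eq_slice_series:
  assumes F: "slice_regular F" and i: "i \<in> quat_sphere" and pres: "F ` quat_slice i \<subseteq> quat_slice i"
  obtains c where "entire_coeffs c" "F = slice_series i c"
proof -
  \<comment> \<open>\<open>slice_proj i 1\<close> is a left inverse of \<open>slice_emb i\<close>,
    so \<open>g\<close> is the restriction of \<open>F\<close> to the slice, read as a complex
    function.\<close>
  define g where "g z = slice_proj i 1 (F (slice_emb i z))" for z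
  have g: "F (slice_emb i z) = slice_emb i (g z)" for z
  proof -
    obtain w where w: "F (slice_emb i z) = slice_emb i w"
      using pres unfolding quat_slice_def by blast
    then have "g z = w"
      using slice_proj_mult[OF i, of 1 w 1] slice_proj_one[OF i] by (simp add: g_def)
    then show ?thesis using w by simp
  qed
  have "g holomorphic_on UNIV" unfolding g_def by (rule slice_regular_proj_holomorphic[OF F i])
  then obtain c where c: "entire_coeffs c" "\<And>z. (\<lambda>n. c n * z ^ n) sums g z"
    by (rule holomorphic_UNIV_power_series) blast
  have real: "F (of_real x) = slice_series i c (of_real x)" for x
    using g[of "of_real x"] slice_series_slice[OF c(1) i, of "of_real x"] c(2)[of "of_real x"]
    by (simp add: sums_iff)
  have "F q = slice_series i c q" for q
  proof -
    obtain I z where I: "I \<in> quat_sphere" and q: "q = slice_emb I z" using slice_emb_surj[OF i] by blast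
    have "slice_proj I v (F q) = slice_proj I v (slice_series i c q)" for v
    proof -
      obtain d where d: "\<And>z. (\<lambda>n. d n * z ^ n) sums slice_proj I v (F (slice_emb I z))"
        using holomorphic_UNIV_power_series[OF slice_regular_proj_holomorphic[OF F I]] by metis
      have "d = (\<lambda>n. slice_proj I v (slice_emb i (c n)))"
      proof (rule powser_unique)
        fix x :: real
        show "(\<lambda>n. d n * of_real x ^ n) sums slice_proj I v (F (of_real x))"
          using d[of "of_real x"] by simp
        show "(\<lambda>n. slice_proj I v (slice_emb i (c n)) * of_real x ^ n) sums slice_proj I v (F (of_real x))"
          using slice_proj_slice_series[OF c(1) i I, of v "of_real x"] by (simp add: real)
      qed
      then show ?thesis
        using d[of z] slice_proj_slice_series[OF c(1) i I, of v z] by (auto simp: q intro: sums_unique2)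
    qed
    then have "inner (F q) v = inner (slice_series i c q) v" for v
      by (simp add: slice_proj_def)
    then show ?thesis by (metis inner_commute vector_eq_ldot)
  qed
  then show ?thesis using that c(1) by blast
qed

text \<open>Since \<open>h\<close> need not commute with \<open>q\<close>, the derivative of q^n in
  direction \<open>h\<close> is the sum of q^k h q^(n-1-k) over k < n. The recursion is the product
  rule for \<open>q * q ^ n\<close>.\<close>

primrec qpow_deriv :: "nat \<Rightarrow> quat \<Rightarrow> quat \<Rightarrow> quat" where
  "qpow_deriv 0 q h = 0"
| "qpow_deriv (Suc n) q h = h * q ^ n + q * qpow_deriv n q h"

lemma has_derivative_quat_power: "((\<lambda>q. q ^ n) has_derivative qpow_deriv n q) (at q within S)"
proof (induction n)
  case (Suc n)
  show ?case
    by (rule has_derivative_eq_rhs[OF has_derivative_mult[OF has_derivative_ident Suc, folded power_Suc]])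
       (auto simp: fun_eq_iff add.commute)
qed (simp add: fun_eq_iff)

text \<open>Every summand q^k h q^(n-1-k) lets \<open>h\<close> move to the front. For
  \<open>h = I\<close> and \<open>q\<close> in \<open>\<complex>\<^sub>I\<close> this is the
  Cauchy-Riemann equation of a single power.\<close>

lemma qpow_deriv_commute:
  assumes "h * q = q * h"
  shows "qpow_deriv n q h = h * qpow_deriv n q 1"
proof (induction n)
  case (Suc n)
  have "q * (h * x) = h * (q * x)" for x by (metis mult.assoc assms)
  then show ?case by (simp add: Suc distrib_left)
qed simp

text \<open>There are \<open>n\<close> summands, each of norm at most r^(n-1) |h|. With
  \<open>r \<ge> 1\<close> the exponent may be raised to \<open>n\<close>, which avoids a truncated
  subtraction.\<close>

lemma norm_qpow_deriv:
  assumes "norm q \<le> r" "r \<ge> 1"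
  shows "norm (qpow_deriv n q h) \<le> n * r ^ n * norm h"
proof (induction n)
  case (Suc n)
  have "norm (qpow_deriv (Suc n) q h) \<le> norm h * norm q ^ n + norm q * norm (qpow_deriv n q h)"
    by (simp add: norm_mult norm_power order_trans[OF norm_triangle_ineq])
  also have "\<dots> \<le> norm h * r ^ Suc n + r * (n * r ^ n * norm h)"
  proof (intro add_mono mult_left_mono mult_mono Suc.IH)
    show "norm q ^ n \<le> r ^ Suc n"
      using assms by (meson le_SucI order_trans power_increasing power_mono norm_ge_zero order_refl)
  qed (use assms in auto)
  also have "\<dots> = Suc n * r ^ Suc n * norm h" by (simp add: algebra_simps)
  finally show ?case .
qed simp

lemma slice_regular_slice_series:
  assumes c: "entire_coeffs c" and i: "i \<in> quat_sphere"
  shows "slice_regular (slice_series i c)"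
proof -
  define a where "a n = slice_emb i (c n)" for n
  define D where "D q h = (\<Sum>n. qpow_deriv n q h * a n)" for q h
  \<comment> \<open>The factor \<open>n\<close> is absorbed by 2^n, that is, by convergence at
    radius \<open>2 * r\<close>.\<close>
  have bd: "summable (\<lambda>n. n * r ^ n * norm (a n))" if "r \<ge> 1" for r :: real
  proof (rule summable_comparison_test')
    show "summable (\<lambda>n. norm (c n) * (2 * r) ^ n)" using c unfolding entire_coeffs_def by blast
    fix n
    have "real n \<le> 2 ^ n" by (metis of_nat_less_two_power less_imp_le)
    then have "real n * (r ^ n * norm (c n)) \<le> 2 ^ n * (r ^ n * norm (c n))"
      using that by (intro mult_right_mono) auto
    then show "norm (n * r ^ n * norm (a n)) \<le> norm (c n) * (2 * r) ^ n"
      using that i by (simp add: a_def power_mult_distrib mult_ac abs_mult)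
  qed
  have le: "norm (qpow_deriv n q h * a n) \<le> (n * r ^ n * norm (a n)) * norm h" if "norm q \<le> r" "r \<ge> 1" for n q h and r :: real
    using mult_right_mono[OF norm_qpow_deriv[OF that, of n h], of "norm (a n)"] by (simp add: norm_mult mult_ac)
  have sm: "summable (\<lambda>n. norm (qpow_deriv n q h * a n))" for q h
  proof (rule summable_comparison_test')
    show "summable (\<lambda>n. (n * (norm q + 1) ^ n * norm (a n)) * norm h)"
      by (rule summable_mult2[OF bd]) simp
    show "norm (norm (qpow_deriv n q h * a n)) \<le> (n * (norm q + 1) ^ n * norm (a n)) * norm h" for n
      using le[of q "norm q + 1" n h] by simp
  qed
  have der: "(slice_series i c has_derivative D q) (at q)" for q
  proof -
    define r where "r = norm q + 1"
    have r: "r \<ge> 1" by (simp add: r_def)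
    \<comment> \<open>Differentiation term by term needs derivatives that converge uniformly in
      \<open>x\<close>. This holds on a bounded ball, and one containing \<open>q\<close> suffices
      because differentiability is local.\<close>
    have "\<exists>g. \<forall>x\<in>ball 0 r. (\<lambda>n. x ^ n * a n) sums g x \<and> (g has_derivative D x) (at x within ball 0 r)"
    proof (rule has_derivative_series[where x=0])
      show "((\<lambda>x. x ^ n * a n) has_derivative (\<lambda>h. qpow_deriv n x h * a n)) (at x within ball 0 r)" for n x
        by (rule has_derivative_mult_left[OF has_derivative_quat_power])
      show "(\<lambda>n. 0 ^ n * a n) sums a 0" using sums_single[of 0 a] by (rule sums_cong[THEN iffD1, rotated]) simp
    next
      \<comment> \<open>The index \<open>N\<close> comes from the tails of the scalar majorant
        \<open>bd\<close>, so it depends neither on \<open>x\<close> nor on the direction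
        \<open>h\<close>.\<close>
      fix e :: real assume "e > 0"
      then obtain N where N: "\<And>n. n \<ge> N \<Longrightarrow> norm (\<Sum>k. real (k + n) * r ^ (k + n) * norm (a (k + n))) < e"
        using suminf_exist_split[OF _ bd[OF r], of e] by blast
      show "\<forall>\<^sub>F n in sequentially. \<forall>x\<in>ball 0 r. \<forall>h. norm ((\<Sum>k<n. qpow_deriv k x h * a k) - D x h) \<le> e * norm h"
        unfolding eventually_sequentially
      proof (intro exI[of _ N] allI impI ballI)
        fix n and x h :: quat assume n: "N \<le> n" and x: "x \<in> ball 0 r"
        have nx: "norm x \<le> r" using x by simp
        have "D x h = (\<Sum>k. qpow_deriv (k + n) x h * a (k + n)) + (\<Sum>k<n. qpow_deriv k x h * a k)"
          unfolding D_def by (rule suminf_split_initial_segment[OF summable_norm_cancel[OF sm]])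
        then have "norm ((\<Sum>k<n. qpow_deriv k x h * a k) - D x h) = norm (\<Sum>k. qpow_deriv (k + n) x h * a (k + n))"
          by (simp add: norm_minus_commute)
        also have "\<dots> \<le> (\<Sum>k. norm (qpow_deriv (k + n) x h * a (k + n)))"
          using sm[of x h] by (intro summable_norm) (subst summable_iff_shift)
        also have "\<dots> \<le> (\<Sum>k. (real (k + n) * r ^ (k + n) * norm (a (k + n))) * norm h)"
        proof (rule suminf_le)
          show "norm (qpow_deriv (k + n) x h * a (k + n)) \<le> (real (k + n) * r ^ (k + n) * norm (a (k + n))) * norm h" for k
            by (rule le[OF nx r])
          show "summable (\<lambda>k. norm (qpow_deriv (k + n) x h * a (k + n)))"
            using sm[of x h] by (subst summable_iff_shift)
          show "summable (\<lambda>k. (real (k + n) * r ^ (k + n) * norm (a (k + n))) * norm h)"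
            using summable_ignore_initial_segment[OF bd[OF r], of n] by (rule summable_mult2)
        qed
        also have "\<dots> = (\<Sum>k. real (k + n) * r ^ (k + n) * norm (a (k + n))) * norm h"
          using summable_ignore_initial_segment[OF bd[OF r], of n] by (rule suminf_mult2[symmetric])
        also have "\<dots> \<le> e * norm h"
          using N[OF n] by (intro mult_right_mono) auto
        finally show "norm ((\<Sum>k<n. qpow_deriv k x h * a k) - D x h) \<le> e * norm h" .
      qed
    qed (use r in auto)
    then obtain g where g: "\<And>x. x \<in> ball 0 r \<Longrightarrow> (\<lambda>n. x ^ n * a n) sums g x"
      "\<And>x. x \<in> ball 0 r \<Longrightarrow> (g has_derivative D x) (at x within ball 0 r)" by blast
    have q: "q \<in> ball 0 r" by (simp add: r_def)
    have "(g has_derivative D q) (at q)"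
      using g(2)[OF q] by (simp only: at_within_open[OF q open_ball])
    moreover have "g x = slice_series i c x" if "x \<in> ball 0 r" for x
      using g(1)[OF that] by (simp add: slice_series_def a_def sums_iff)
    ultimately show ?thesis
      by (rule has_derivative_transform_within_open[OF _ open_ball q])
  qed
  show ?thesis unfolding slice_regular_def
  proof (intro conjI allI ballI)
    show "slice_series i c differentiable at q" for q
      unfolding differentiable_def using der by blast
    fix I x y assume I: "I \<in> quat_sphere"
    define q where "q = of_real x + of_real y * I"
    interpret D: bounded_linear "D q" using der by (rule has_derivative_bounded_linear)
    have "((\<lambda>t. slice_series i c (of_real t + of_real y * I)) has_vector_derivative D q 1) (at x)"
    proof -
      have "((\<lambda>t. slice_series i c (of_real t + of_real y * I)) has_derivative (\<lambda>t. D q (of_real t))) (at x)"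
        by (rule has_derivative_compose[where g="slice_series i c"]) (use der[of q] q_def in \<open>auto intro!: derivative_eq_intros\<close>)
      then show ?thesis by (simp add: has_vector_derivative_def of_real_def D.scaleR)
    qed
    then have 1: "vector_derivative (\<lambda>t. slice_series i c (of_real t + of_real y * I)) (at x) = D q 1"
      by (rule vector_derivative_at)
    have "((\<lambda>t. slice_series i c (of_real x + of_real t * I)) has_vector_derivative D q I) (at y)"
    proof -
      have "((\<lambda>t. slice_series i c (of_real x + of_real t * I)) has_derivative (\<lambda>t. D q (of_real t * I))) (at y)"
        by (rule has_derivative_compose[where g="slice_series i c"]) (use der[of q] q_def in \<open>auto intro!: derivative_eq_intros\<close>)
      then show ?thesis by (simp add: has_vector_derivative_def of_real_def D.scaleR)
    qed
    then have 2: "vector_derivative (\<lambda>t. slice_series i c (of_real x + of_real t * I)) (at y) = D q I"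
      by (rule vector_derivative_at)
    have "I * q = q * I" by (simp add: q_def distrib_left distrib_right of_real_def)
    then have "D q I = (\<Sum>n. I * (qpow_deriv n q 1 * a n))"
      unfolding D_def by (simp only: qpow_deriv_commute[of I q] mult.assoc)
    also have "\<dots> = I * D q 1"
      unfolding D_def by (rule suminf_mult[OF summable_norm_cancel[OF sm]])
    finally have "I * D q I = - D q 1"
      using quat_sphere_square[OF I] by (simp add: mult.assoc[symmetric])
    then show "vector_derivative (\<lambda>t. slice_series i c (of_real t + of_real y * I)) (at x) +
        I * vector_derivative (\<lambda>t. slice_series i c (of_real x + of_real t * I)) (at y) = 0"
      by (simp add: 1 2)
  qed
qed

section \<open>Coefficients of functions in the slice Fock space\<close>

definition fock_coeffs :: "real \<Rightarrow> (nat \<Rightarrow> complex) \<Rightarrow> bool" where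
  "fock_coeffs \<nu> c \<longleftrightarrow> summable (\<lambda>n. (norm (c n))\<^sup>2 * (fact n / \<nu> ^ n))"

text \<open>Write |c n| r^n as (|c n| s) (r^n / s) with s^2 = n! / \<nu>^n and bound the product by
  the sum of the squares. The first squares are summable by hypothesis, the second are the
  exponential series at r^2 \<nu>.\<close>

lemma fock_coeffs_entire:
  assumes \<nu>: "\<nu> > 0" and c: "fock_coeffs \<nu> c"
  shows "entire_coeffs c"
  unfolding entire_coeffs_def
proof
  fix r :: real
  show "summable (\<lambda>n. norm (c n) * r ^ n)"
  proof (rule summable_comparison_test')
    have "summable (\<lambda>n. (r\<^sup>2 * \<nu>) ^ n / fact n)"
      using summable_exp[of "r\<^sup>2 * \<nu>"] by (simp add: field_simps)
    then show "summable (\<lambda>n. (norm (c n))\<^sup>2 * (fact n / \<nu> ^ n) + (r\<^sup>2 * \<nu>) ^ n / fact n)"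
      using c unfolding fock_coeffs_def by (intro summable_add)
    fix n
    define s where "s = sqrt (fact n / \<nu> ^ n)"
    have s: "s > 0" "s\<^sup>2 = fact n / \<nu> ^ n" using \<nu> by (simp_all add: s_def)
    have "\<bar>norm (c n) * r ^ n\<bar> = \<bar>(norm (c n) * s) * (r ^ n / s)\<bar>" using s by simp
    also have "\<dots> \<le> (norm (c n) * s)\<^sup>2 + (r ^ n / s)\<^sup>2"
    proof -
      have "\<bar>x * y\<bar> \<le> x\<^sup>2 + y\<^sup>2" for x y :: real
      proof -
        have "0 \<le> \<bar>x\<bar> * \<bar>y\<bar>" by simp
        moreover have "2 * (\<bar>x\<bar> * \<bar>y\<bar>) \<le> x\<^sup>2 + y\<^sup>2"
          using sum_squares_bound[of "\<bar>x\<bar>" "\<bar>y\<bar>"] by (simp only: power2_abs mult.assoc)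
        ultimately have "\<bar>x\<bar> * \<bar>y\<bar> \<le> x\<^sup>2 + y\<^sup>2" by linarith
        then show ?thesis by (simp only: abs_mult)
      qed
      then show ?thesis .
    qed
    also have "\<dots> = (norm (c n))\<^sup>2 * (fact n / \<nu> ^ n) + (r\<^sup>2 * \<nu>) ^ n / fact n"
      unfolding power_mult_distrib power_divide s
      by (simp add: power_mult[symmetric] mult.commute)
    finally show "norm (norm (c n) * r ^ n) \<le> (norm (c n))\<^sup>2 * (fact n / \<nu> ^ n) + (r\<^sup>2 * \<nu>) ^ n / fact n"
      by simp
  qed
qed

lemma integrable_fock_iff:
  assumes "\<nu> > 0" "entire_coeffs c"
  shows "integrable lborel (\<lambda>z. (norm (\<Sum>n. c n * z ^ n))\<^sup>2 * exp (- \<nu> * (norm z)\<^sup>2)) \<longleftrightarrow> fock_coeffs \<nu> c"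
  unfolding fock_coeffs_def
  by (rule integrable_power_series_gaussian_iff) (use assms in \<open>auto simp: entire_coeffs_def\<close>)

text \<open>On the foreign slice \<open>I\<close> each functional yields a complex entire function
  bounded by a multiple of the given one, so its coefficients satisfy the Fock condition. Their real
  parts are the components \<open>inner (slice_emb i (c n)) v\<close>, and summing the squares over
  an orthonormal basis gives |c n|^2.\<close>

lemma fock_coeffs_of_slice:
  assumes \<nu>: "\<nu> > 0" and c: "entire_coeffs c" and i: "i \<in> quat_sphere" and I: "I \<in> quat_sphere"
    and int: "integrable lborel (\<lambda>z. (norm (slice_series i c (slice_emb I z)))\<^sup>2 * exp (- \<nu> * (norm (slice_emb I z))\<^sup>2))"
  shows "fock_coeffs \<nu> c"
proof -
  have proj: "summable (\<lambda>n. (inner (slice_emb i (c n)) v)\<^sup>2 * (fact n / \<nu> ^ n))" for v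
  proof -
    define d where "d n = slice_proj I v (slice_emb i (c n))" for n
    obtain K where K: "\<And>q. norm (slice_proj I v q) \<le> norm q * K" "K \<ge> 0"
      using bounded_linear.nonneg_bounded[OF bounded_linear_slice_proj] by blast
    have d: "entire_coeffs d" unfolding entire_coeffs_def
    proof
      fix r :: real
      have "summable (\<lambda>n. norm (c n) * \<bar>r\<bar> ^ n * K)"
        using c unfolding entire_coeffs_def by (intro summable_mult2) blast
      then show "summable (\<lambda>n. norm (d n) * r ^ n)"
      proof (rule summable_comparison_test')
        fix n
        show "norm (norm (d n) * r ^ n) \<le> norm (c n) * \<bar>r\<bar> ^ n * K"
          using mult_right_mono[OF K(1)[of "slice_emb i (c n)"], of "\<bar>r\<bar> ^ n"] i
          by (simp add: d_def abs_mult power_abs mult_ac)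
      qed
    qed
    have sum: "(\<Sum>n. d n * z ^ n) = slice_proj I v (slice_series i c (slice_emb I z))" for z
      using slice_proj_slice_series[OF c i I, of v z] by (simp add: d_def sums_iff)
    have "integrable lborel (\<lambda>z. K\<^sup>2 * ((norm (slice_series i c (slice_emb I z)))\<^sup>2 * exp (- \<nu> * (norm (slice_emb I z))\<^sup>2)))"
      using int by simp
    then have "integrable lborel (\<lambda>z. (norm (\<Sum>n. d n * z ^ n))\<^sup>2 * exp (- \<nu> * (norm z)\<^sup>2))"
    proof (rule Bochner_Integration.integrable_bound)
      show "(\<lambda>z. (norm (\<Sum>n. d n * z ^ n))\<^sup>2 * exp (- \<nu> * (norm z)\<^sup>2)) \<in> borel_measurable lborel"
        by measurable
      show "AE z in lborel. norm ((norm (\<Sum>n. d n * z ^ n))\<^sup>2 * exp (- \<nu> * (norm z)\<^sup>2)) \<le>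
        norm (K\<^sup>2 * ((norm (slice_series i c (slice_emb I z)))\<^sup>2 * exp (- \<nu> * (norm (slice_emb I z))\<^sup>2)))"
      proof (rule AE_I2)
        fix z
        have "(norm (\<Sum>n. d n * z ^ n))\<^sup>2 \<le> (norm (slice_series i c (slice_emb I z)) * K)\<^sup>2"
          unfolding sum by (intro power_mono K) simp
        then show "norm ((norm (\<Sum>n. d n * z ^ n))\<^sup>2 * exp (- \<nu> * (norm z)\<^sup>2)) \<le>
          norm (K\<^sup>2 * ((norm (slice_series i c (slice_emb I z)))\<^sup>2 * exp (- \<nu> * (norm (slice_emb I z))\<^sup>2)))"
          using I by (simp add: power_mult_distrib abs_mult mult_ac)
      qed
    qed
    then have s: "summable (\<lambda>n. (norm (d n))\<^sup>2 * (fact n / \<nu> ^ n))"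
      using integrable_fock_iff[OF \<nu> d] by (simp only: fock_coeffs_def)
    show ?thesis
    proof (rule summable_comparison_test'[OF s])
      fix n
      have "(inner (slice_emb i (c n)) v)\<^sup>2 \<le> (norm (d n))\<^sup>2"
        by (simp add: d_def slice_proj_def cmod_power2)
      then show "norm ((inner (slice_emb i (c n)) v)\<^sup>2 * (fact n / \<nu> ^ n)) \<le> (norm (d n))\<^sup>2 * (fact n / \<nu> ^ n)"
        using \<nu> by (simp add: mult_right_mono divide_right_mono)
    qed
  qed
  have "(norm (c n))\<^sup>2 * (fact n / \<nu> ^ n) = (\<Sum>v\<in>Basis. (inner (slice_emb i (c n)) v)\<^sup>2 * (fact n / \<nu> ^ n))" for n
  proof -
    have "(norm (c n))\<^sup>2 = (norm (slice_emb i (c n)))\<^sup>2" using i by simp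
    also have "\<dots> = (\<Sum>v\<in>Basis. (inner (slice_emb i (c n)) v)\<^sup>2)"
      unfolding power2_norm_eq_inner by (subst euclidean_inner) (simp add: power2_eq_square)
    finally show ?thesis by (simp only: sum_distrib_right)
  qed
  then show ?thesis unfolding fock_coeffs_def by (simp only:) (intro summable_sum proj)
qed

lemma Fock_slice_pres_iff:
  assumes \<nu>: "\<nu> > 0" and i: "i \<in> quat_sphere"
  shows "F \<in> Fock_slice_pres i \<nu> \<longleftrightarrow> (\<exists>c. fock_coeffs \<nu> c \<and> F = slice_series i c)"
proof
  assume "F \<in> Fock_slice_pres i \<nu>"
  then obtain I where F: "slice_regular F" "F ` quat_slice i \<subseteq> quat_slice i" and I: "I \<in> quat_sphere"
    and int: "integrable lborel (\<lambda>z. (norm (F (slice_emb I z)))\<^sup>2 * exp (- \<nu> * (norm (slice_emb I z))\<^sup>2))"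
    unfolding Fock_slice_pres_def Fock_slice_def by blast
  obtain c where c: "entire_coeffs c" "F = slice_series i c"
    using slice_regular_eq_slice_series[OF F(1) i F(2)] by blast
  show "\<exists>c. fock_coeffs \<nu> c \<and> F = slice_series i c"
    using fock_coeffs_of_slice[OF \<nu> c(1) i I] int c(2) by blast
next
  assume "\<exists>c. fock_coeffs \<nu> c \<and> F = slice_series i c"
  then obtain c where c: "fock_coeffs \<nu> c" and F: "F = slice_series i c" by blast
  have e: "entire_coeffs c" by (rule fock_coeffs_entire[OF \<nu> c])
  have s: "F (slice_emb i z) = slice_emb i (\<Sum>n. c n * z ^ n)" for z
    unfolding F by (rule slice_series_slice[OF e i])
  \<comment> \<open>The slice \<open>i\<close> itself is the witness: on it the series is an
    ordinary complex one.\<close>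
  have "integrable lborel (\<lambda>z. (norm (F (slice_emb i z)))\<^sup>2 * exp (- \<nu> * (norm (slice_emb i z))\<^sup>2))"
    unfolding s norm_slice_emb[OF i] using integrable_fock_iff[OF \<nu> e] c by blast
  then have "F \<in> Fock_slice \<nu>"
    unfolding Fock_slice_def using i slice_regular_slice_series[OF e i] F by blast
  then show "F \<in> Fock_slice_pres i \<nu>"
    unfolding Fock_slice_pres_def quat_slice_def using s by auto
qed

section \<open>Hermite polynomials\<close>

lemma integral_derivative_eq_0:
  fixes F :: "real \<Rightarrow> 'a::euclidean_space"
  assumes F: "\<And>x. (F has_vector_derivative f x) (at x)" and f: "\<And>x. isCont f x"
    and int: "integrable lborel f" and lim: "(F \<longlongrightarrow> 0) at_top" "(F \<longlongrightarrow> 0) at_bot"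
  shows "(LINT x|lborel. f x) = 0"
proof -
  have "(LBINT x=-\<infinity>..\<infinity>. f x) = 0 - 0"
    by (rule interval_integral_FTC_integrable[OF _ F f])
       (use int lim in \<open>auto simp: set_integrable_def ereal_tendsto_simps\<close>)
  then show ?thesis
    by (simp add: interval_lebesgue_integral_def set_lebesgue_integral_def)
qed

text \<open>As |x| is at most exp |x|, each further degree raises the rate \<open>K\<close> by one.
  Any exponential rate will do, because the Gaussian weight dominates it.\<close>

lemma poly_exp_bound:
  fixes p :: "real poly"
  obtains C K where "C \<ge> 0" "K \<ge> 0" "\<And>x. \<bar>poly p x\<bar> \<le> C * exp (K * \<bar>x\<bar>)"
proof (induction p arbitrary: thesis)
  case 0
  show ?case by (rule 0[of 0 0]) auto
next
  case (pCons a p)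
  obtain C K where CK: "C \<ge> 0" "K \<ge> 0" "\<And>x. \<bar>poly p x\<bar> \<le> C * exp (K * \<bar>x\<bar>)"
    using pCons.IH by blast
  show ?case
  proof (rule pCons.prems[of "\<bar>a\<bar> + C" "K + 1"])
    fix x :: real
    have "\<bar>x\<bar> \<le> exp \<bar>x\<bar>" using exp_ge_add_one_self[of "\<bar>x\<bar>"] by linarith
    then have "\<bar>x\<bar> * \<bar>poly p x\<bar> \<le> exp \<bar>x\<bar> * (C * exp (K * \<bar>x\<bar>))"
      using CK by (intro mult_mono) auto
    also have "\<dots> = C * exp ((K + 1) * \<bar>x\<bar>)" by (simp add: exp_add[symmetric] algebra_simps)
    finally have 1: "\<bar>x\<bar> * \<bar>poly p x\<bar> \<le> C * exp ((K + 1) * \<bar>x\<bar>)" .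
    have "1 \<le> exp ((K + 1) * \<bar>x\<bar>)" using CK by simp
    then have 2: "\<bar>a\<bar> \<le> \<bar>a\<bar> * exp ((K + 1) * \<bar>x\<bar>)" by (simp add: mult_left_le_one_le mult_le_cancel_left1)
    have "\<bar>poly (pCons a p) x\<bar> \<le> \<bar>a\<bar> + \<bar>x\<bar> * \<bar>poly p x\<bar>"
      by (simp add: abs_mult[symmetric] abs_triangle_ineq)
    with 1 2 show "\<bar>poly (pCons a p) x\<bar> \<le> (\<bar>a\<bar> + C) * exp ((K + 1) * \<bar>x\<bar>)"
      by (simp add: algebra_simps)
  qed (use CK in auto)
qed

context
  fixes \<nu> :: real
  assumes \<nu>: "\<nu> > 0"
begin

abbreviation gauss_exp :: "complex \<Rightarrow> real \<Rightarrow> complex" where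
  "gauss_exp a x \<equiv> exp (a * of_real x - of_real \<nu> * (of_real x)\<^sup>2)"

lemma norm_gauss_exp: "norm (gauss_exp a x) = exp (Re a * x - \<nu> * x\<^sup>2)"
  by (simp add: power2_eq_square)

lemma poly_gauss_bound:
  obtains C K where "C \<ge> 0" "K \<ge> 0" "\<And>x. norm (of_real (poly p x) * gauss_exp a x) \<le> C * exp (K * \<bar>x\<bar> - \<nu> * x\<^sup>2)"
proof -
  obtain C K where CK: "C \<ge> 0" "K \<ge> 0" "\<And>x. \<bar>poly p x\<bar> \<le> C * exp (K * \<bar>x\<bar>)"
    using poly_exp_bound by blast
  show ?thesis
  proof (rule that[of C "K + \<bar>Re a\<bar>"])
    fix x
    have "norm (of_real (poly p x) * gauss_exp a x) = \<bar>poly p x\<bar> * exp (Re a * x - \<nu> * x\<^sup>2)"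
      by (simp only: norm_mult norm_of_real norm_gauss_exp)
    also have "\<dots> \<le> (C * exp (K * \<bar>x\<bar>)) * exp (\<bar>Re a\<bar> * \<bar>x\<bar> - \<nu> * x\<^sup>2)"
      using CK abs_ge_self[of "Re a * x"] by (intro mult_mono) (auto simp: abs_mult)
    also have "\<dots> = C * exp ((K + \<bar>Re a\<bar>) * \<bar>x\<bar> - \<nu> * x\<^sup>2)"
      by (simp add: exp_add[symmetric] mult.assoc algebra_simps)
    finally show "norm (of_real (poly p x) * gauss_exp a x) \<le> C * exp ((K + \<bar>Re a\<bar>) * \<bar>x\<bar> - \<nu> * x\<^sup>2)" .
  qed (use CK in auto)
qed

lemma integrable_poly_gauss: "integrable lborel (\<lambda>x. of_real (poly p x) * gauss_exp a x)"
proof -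
  obtain C K where CK: "C \<ge> 0" "K \<ge> 0" "\<And>x. norm (of_real (poly p x) * gauss_exp a x) \<le> C * exp (K * \<bar>x\<bar> - \<nu> * x\<^sup>2)"
    using poly_gauss_bound by blast
  \<comment> \<open>\<open>exp (K * \<bar>x\<bar>)\<close> is at most the sum of the exponentials
    with rates \<open>K\<close> and \<open>- K\<close>, which turns the bound into a sum of shifted
    Gaussians.\<close>
  have "integrable lborel (\<lambda>x. C * (exp (K * x - \<nu> * x\<^sup>2) + exp (- K * x - \<nu> * x\<^sup>2)))"
    using has_bochner_integral_gaussian[OF \<nu>, of K] has_bochner_integral_gaussian[OF \<nu>, of "- K"]
    by (intro integrable_mult_right Bochner_Integration.integrable_add) (simp_all only: has_bochner_integral_iff)
  then show ?thesis
  proof (rule Bochner_Integration.integrable_bound)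
    show "AE x in lborel. norm (of_real (poly p x) * gauss_exp a x) \<le> norm (C * (exp (K * x - \<nu> * x\<^sup>2) + exp (- K * x - \<nu> * x\<^sup>2)))"
    proof (rule AE_I2)
      fix x
      have "C * exp (K * \<bar>x\<bar> - \<nu> * x\<^sup>2) \<le> C * (exp (K * x - \<nu> * x\<^sup>2) + exp (- K * x - \<nu> * x\<^sup>2))"
        using CK(1) by (intro mult_left_mono) (auto simp: abs_if)
      from order_trans[OF CK(3)[of x] this]
      show "norm (of_real (poly p x) * gauss_exp a x) \<le> norm (C * (exp (K * x - \<nu> * x\<^sup>2) + exp (- K * x - \<nu> * x\<^sup>2)))"
        unfolding real_norm_def by (rule order_trans[OF _ abs_ge_self])
    qed
    have "(\<lambda>x. of_real (poly p x) * gauss_exp a x) \<in> borel_measurable borel"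
      by (intro borel_measurable_continuous_onI continuous_intros)
    then show "(\<lambda>x. of_real (poly p x) * gauss_exp a x) \<in> borel_measurable lborel" by simp
  qed
qed

lemma poly_gauss_tendsto_0:
  "((\<lambda>x. of_real (poly p x) * gauss_exp a x) \<longlongrightarrow> 0) at_top"
  "((\<lambda>x. of_real (poly p x) * gauss_exp a x) \<longlongrightarrow> 0) at_bot"
proof -
  obtain C K where CK: "C \<ge> 0" "K \<ge> 0" "\<And>x. norm (of_real (poly p x) * gauss_exp a x) \<le> C * exp (K * \<bar>x\<bar> - \<nu> * x\<^sup>2)"
    using poly_gauss_bound by blast
  have lim: "((\<lambda>x. C * exp (K * \<bar>x\<bar> - \<nu> * x\<^sup>2)) \<longlongrightarrow> 0) at_top" "((\<lambda>x. C * exp (K * \<bar>x\<bar> - \<nu> * x\<^sup>2)) \<longlongrightarrow> 0) at_bot"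
    using \<nu> by real_asymp+
  have le: "\<forall>\<^sub>F x in G. norm (of_real (poly p x) * gauss_exp a x) \<le> C * exp (K * \<bar>x\<bar> - \<nu> * x\<^sup>2)" for G
    using CK(3) by (simp only: eventually_True)
  show "((\<lambda>x. of_real (poly p x) * gauss_exp a x) \<longlongrightarrow> 0) at_top"
    "((\<lambda>x. of_real (poly p x) * gauss_exp a x) \<longlongrightarrow> 0) at_bot"
    by (rule Lim_null_comparison[OF le lim(1)] Lim_null_comparison[OF le lim(2)])+
qed

definition poly_gauss_int :: "complex \<Rightarrow> real poly \<Rightarrow> complex" where
  "poly_gauss_int a p = (LINT x|lborel. of_real (poly p x) * gauss_exp a x)"

text \<open>The formal adjoint of differentiation with respect to the weight \<open>exp (- \<nu> x\<^sup>2)\<close>.\<close>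

definition adj_deriv :: "real poly \<Rightarrow> real poly" where
  "adj_deriv p = [:0, 2 * \<nu>:] * p - pderiv p"

text \<open>Integration by parts: the difference of the integrands is the derivative of p (x) exp (a
  x - \<nu> x^2), which vanishes at both ends.\<close>

lemma poly_gauss_int_adj_deriv: "poly_gauss_int a (adj_deriv p) = a * poly_gauss_int a p"
proof -
  define f where "f x = a * (of_real (poly p x) * gauss_exp a x) - of_real (poly (adj_deriv p) x) * gauss_exp a x" for x
  have "(LINT x|lborel. f x) = 0"
  proof (rule integral_derivative_eq_0)
    fix x
    show "((\<lambda>x. of_real (poly p x) * gauss_exp a x) has_vector_derivative f x) (at x)"
    proof -
      have "((\<lambda>z. exp (a * z - of_real \<nu> * z\<^sup>2)) has_field_derivative (a - 2 * of_real \<nu> * of_real x) * gauss_exp a x) (at (of_real x))"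
        by (auto intro!: derivative_eq_intros)
      then have 1: "(gauss_exp a has_vector_derivative (a - 2 * of_real \<nu> * of_real x) * gauss_exp a x) (at x)"
        by (rule has_vector_derivative_real_field)
      have 2: "((\<lambda>x. complex_of_real (poly p x)) has_vector_derivative of_real (poly (pderiv p) x)) (at x)"
        using poly_DERIV[of p x] by (intro has_vector_derivative_of_real) (simp add: has_real_derivative_iff_has_vector_derivative)
      show ?thesis
        by (rule has_vector_derivative_eq_rhs[OF has_vector_derivative_mult[OF 2 1]])
           (simp add: f_def adj_deriv_def algebra_simps)
    qed
    show "isCont f x" unfolding f_def
      by (intro continuous_intros)
  next
    show "integrable lborel f" unfolding f_def
      by (intro Bochner_Integration.integrable_diff integrable_mult_right integrable_poly_gauss)
  qed (rule poly_gauss_tendsto_0)+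
  then show ?thesis
    unfolding f_def poly_gauss_int_def
    by (subst (asm) Bochner_Integration.integral_diff) (auto intro!: integrable_mult_right integrable_poly_gauss)
qed

text \<open>Only the real part of \<open>a\<close> is removed by completing the square. The
  imaginary part stays as an oscillating factor, and the integral becomes the characteristic
  function of the standard normal distribution; no contour has to be shifted.\<close>

lemma poly_gauss_int_1: "poly_gauss_int a 1 = of_real (sqrt (pi / \<nu>)) * exp (a\<^sup>2 / of_real (4 * \<nu>))"
proof -
  define r s where "r = Re a" and "s = Im a"
  have a: "a = Complex r s" by (simp add: r_def s_def)
  define m \<sigma> where "m = r / (2 * \<nu>)" and "\<sigma> = 1 / sqrt (2 * \<nu>)"
  have \<sigma>: "\<sigma> > 0" "\<sigma>\<^sup>2 = 1 / (2 * \<nu>)" using \<nu> by (auto simp: \<sigma>_def power_divide)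
  define c where "c = exp (of_real (r\<^sup>2 / (4 * \<nu>)) + \<i> * of_real (s * m)) * of_real (sqrt (2 * pi))"
  have eq: "gauss_exp a (m + \<sigma> * y) = c * (std_normal_density y *\<^sub>R iexp ((s * \<sigma>) * y))" for y
  proof -
    have 1: "r * (m + \<sigma> * y) - \<nu> * (m + \<sigma> * y)\<^sup>2 = r\<^sup>2 / (4 * \<nu>) - y\<^sup>2 / 2"
    proof -
      have "\<nu> * (m + \<sigma> * y)\<^sup>2 = \<nu> * m\<^sup>2 + 2 * \<nu> * m * \<sigma> * y + \<nu> * \<sigma>\<^sup>2 * y\<^sup>2" by (simp add: power2_eq_square algebra_simps)
      then show ?thesis using \<nu> unfolding \<sigma>(2) m_def by (simp add: field_simps power2_eq_square)
    qed
    have 2: "a * of_real (m + \<sigma> * y) - of_real \<nu> * (of_real (m + \<sigma> * y))\<^sup>2 =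
      of_real (r * (m + \<sigma> * y) - \<nu> * (m + \<sigma> * y)\<^sup>2) + \<i> * of_real (s * (m + \<sigma> * y))"
      by (simp add: a Complex_eq algebra_simps)
    have "gauss_exp a (m + \<sigma> * y) = exp ((of_real (r\<^sup>2 / (4 * \<nu>)) + \<i> * of_real (s * m)) + (of_real (- y\<^sup>2 / 2) + \<i> * of_real ((s * \<sigma>) * y)))"
      unfolding 2 1 by (simp add: algebra_simps)
    also have "\<dots> = exp (of_real (r\<^sup>2 / (4 * \<nu>)) + \<i> * of_real (s * m)) * (of_real (exp (- y\<^sup>2 / 2)) * iexp ((s * \<sigma>) * y))"
      by (simp only: exp_add exp_of_real)
    also have "\<dots> = c * (std_normal_density y *\<^sub>R iexp ((s * \<sigma>) * y))"
      by (simp add: c_def std_normal_density_def scaleR_conv_of_real)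
    finally show ?thesis .
  qed
  have "poly_gauss_int a 1 = (LINT x|lborel. gauss_exp a x)" by (simp add: poly_gauss_int_def)
  also have "\<dots> = \<sigma> *\<^sub>R (LINT y|lborel. gauss_exp a (m + \<sigma> * y))"
    using \<sigma> by (subst lborel_integral_real_affine[of \<sigma> _ m]) auto
  also have "\<dots> = \<sigma> *\<^sub>R (c * (LINT y|lborel. std_normal_density y *\<^sub>R iexp ((s * \<sigma>) * y)))"
    unfolding eq by (simp only: integral_mult_right_zero)
  also have "(LINT y|lborel. std_normal_density y *\<^sub>R iexp ((s * \<sigma>) * y)) = char std_normal_distribution (s * \<sigma>)"
    unfolding char_def by (subst integral_density) (auto simp: mult_ac)
  also have "\<dots> = of_real (exp (- (s * \<sigma>)\<^sup>2 / 2))"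
    by (simp add: char_std_normal_distribution)
  also have "\<sigma> *\<^sub>R (c * of_real (exp (- (s * \<sigma>)\<^sup>2 / 2))) =
     of_real (\<sigma> * sqrt (2 * pi)) * exp ((of_real (r\<^sup>2 / (4 * \<nu>)) + \<i> * of_real (s * m)) + of_real (- (s * \<sigma>)\<^sup>2 / 2))"
    by (simp only: c_def exp_add exp_of_real scaleR_conv_of_real of_real_mult mult_ac)
  also have "\<sigma> * sqrt (2 * pi) = sqrt (pi / \<nu>)"
    using \<nu> by (simp add: \<sigma>_def real_sqrt_divide real_sqrt_mult)
  also have "(of_real (r\<^sup>2 / (4 * \<nu>)) + \<i> * of_real (s * m)) + of_real (- (s * \<sigma>)\<^sup>2 / 2) = a\<^sup>2 / complex_of_real (4 * \<nu>)"
    unfolding power_mult_distrib \<sigma>(2) m_def a using \<nu>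
    by (auto simp: complex_eq_iff Re_divide_of_real Im_divide_of_real power2_eq_square field_simps simp del: of_real_mult)
  finally show ?thesis .
qed

text \<open>In terms of the classical (physicists') polynomials H_n these are \<nu>^(n/2) H_n (sqrt
  \<nu> x).\<close>

primrec hermite :: "nat \<Rightarrow> real poly" where
  "hermite 0 = 1"
| "hermite (Suc n) = adj_deriv (hermite n)"

lemma poly_gauss_int_hermite: "poly_gauss_int a (hermite n) = a ^ n * poly_gauss_int a 1"
  by (induction n) (simp_all add: poly_gauss_int_adj_deriv)

text \<open>Differentiation and \<open>adj_deriv\<close> are annihilation and creation operators:
  their commutator is multiplication by \<open>2 * \<nu>\<close>, and each step of the induction
  adds this amount once.\<close>

lemma pderiv_hermite: "pderiv (hermite (Suc n)) = smult (2 * \<nu> * Suc n) (hermite n)"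
proof (induction n)
  case 0
  show ?case by (simp add: adj_deriv_def pderiv_pCons pderiv_mult)
next
  case (Suc n)
  have "pderiv (adj_deriv p) = smult (2 * \<nu>) p + adj_deriv (pderiv p)" for p
    by (simp add: adj_deriv_def pderiv_diff pderiv_mult pderiv_pCons pderiv_smult algebra_simps)
  moreover have "adj_deriv (smult k p) = smult k (adj_deriv p)" for k p
    by (simp add: adj_deriv_def pderiv_smult smult_diff_right)
  ultimately have "pderiv (hermite (Suc (Suc n))) = smult (2 * \<nu>) (hermite (Suc n)) + smult (2 * \<nu> * Suc n) (hermite (Suc n))"
    using Suc by simp
  then show ?case by (simp only: smult_add_left[symmetric]) (simp add: algebra_simps del: hermite.simps)
qed

section \<open>Orthogonality of the Hermite polynomials\<close>

definition poly_weight_int :: "real poly \<Rightarrow> real" where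
  "poly_weight_int p = (LINT x|lborel. poly p x * exp (- \<nu> * x\<^sup>2))"

lemma gauss_exp_0: "of_real (poly p x) * gauss_exp 0 x = complex_of_real (poly p x * exp (- \<nu> * x\<^sup>2))"
  by (simp add: exp_of_real[symmetric])

lemma integrable_poly_weight: "integrable lborel (\<lambda>x. poly p x * exp (- \<nu> * x\<^sup>2))"
  using integrable_poly_gauss[of p 0] unfolding gauss_exp_0 complex_of_real_integrable_eq .

lemma poly_weight_int_eq: "poly_gauss_int 0 p = of_real (poly_weight_int p)"
  unfolding poly_gauss_int_def poly_weight_int_def gauss_exp_0 by (rule integral_complex_of_real)

lemma poly_weight_int_add: "poly_weight_int (p + q) = poly_weight_int p + poly_weight_int q"
  unfolding poly_weight_int_def
  by (simp only: poly_add distrib_right Bochner_Integration.integral_add[OF integrable_poly_weight integrable_poly_weight])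

lemma poly_weight_int_smult: "poly_weight_int (smult c p) = c * poly_weight_int p"
  unfolding poly_weight_int_def by (simp add: mult.assoc)

lemma poly_weight_int_0 [simp]: "poly_weight_int 0 = 0"
  by (simp add: poly_weight_int_def)

lemma poly_weight_int_sum: "poly_weight_int (\<Sum>k\<in>A. p k) = (\<Sum>k\<in>A. poly_weight_int (p k))"
  by (induction A rule: infinite_finite_induct) (simp_all add: poly_weight_int_add)

text \<open>The two integrands differ by \<open>adj_deriv (p * q)\<close>, whose weighted integral
  is 0 by \<open>poly_gauss_int_adj_deriv\<close> at \<open>a = 0\<close>.\<close>

lemma poly_weight_int_adjoint: "poly_weight_int (adj_deriv p * q) = poly_weight_int (p * pderiv q)"
proof -
  have "poly_gauss_int 0 (adj_deriv (p * q)) = 0" by (simp add: poly_gauss_int_adj_deriv)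
  then have "poly_weight_int (adj_deriv (p * q)) = 0" by (simp add: poly_weight_int_eq)
  moreover have "adj_deriv p * q = adj_deriv (p * q) + p * pderiv q"
    by (simp add: adj_deriv_def pderiv_mult algebra_simps)
  ultimately show ?thesis by (simp add: poly_weight_int_add)
qed

text \<open>Moving one \<open>adj_deriv\<close> to the other factor lowers both indices by one at
  the price of the factor \<open>2 * \<nu> * n\<close>.\<close>

lemma hermite_orthogonal:
  "poly_weight_int (hermite m * hermite n) = (if m = n then fact n * (2 * \<nu>) ^ n * sqrt (pi / \<nu>) else 0)"
proof (induction m arbitrary: n)
  case 0
  show ?case
  proof (cases n)
    case 0
    have "complex_of_real (poly_weight_int 1) = of_real (sqrt (pi / \<nu>))"
      using poly_gauss_int_1[of 0] by (simp add: poly_weight_int_eq)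
    then show ?thesis using 0 by (simp only: of_real_eq_iff) simp
  next
    case (Suc k)
    then show ?thesis using poly_weight_int_adjoint[of "hermite k" 1] by (simp add: mult.commute)
  qed
next
  case (Suc m)
  show ?case
  proof (cases n)
    case 0
    then show ?thesis using poly_weight_int_adjoint[of "hermite m" 1] by simp
  next
    case (Suc k)
    have "poly_weight_int (hermite (Suc m) * hermite n) = poly_weight_int (hermite m * pderiv (hermite n))"
      by (simp add: poly_weight_int_adjoint)
    also have "\<dots> = 2 * \<nu> * Suc k * poly_weight_int (hermite m * hermite k)"
      unfolding Suc pderiv_hermite by (simp add: poly_weight_int_smult)
    finally show ?thesis using Suc.IH[of k] Suc by simp
  qed
qed

end

section \<open>Surjectivity of the Segal--Bargmann transform\<close>

definition sb_kernel :: "real \<Rightarrow> complex \<Rightarrow> real \<Rightarrow> complex" where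
  "sb_kernel \<nu> z x = exp (- of_real \<nu> * (of_real x - z / of_real (sqrt 2))\<^sup>2)"

lemma B1_sb_kernel: "B1 \<nu> f z = of_real ((\<nu> / pi) powr (3/4)) * (LINT x|lborel. f x * sb_kernel \<nu> z x)"
  by (simp add: B1_def sb_kernel_def)

lemma sb_kernel_measurable [measurable]: "sb_kernel \<nu> z \<in> borel_measurable borel"
  unfolding sb_kernel_def by (intro borel_measurable_continuous_onI continuous_intros) simp

text \<open>A substitute for the Cauchy-Schwarz inequality, obtained from the square of t w |f| -
  |k|. The free \<open>t\<close> balances the two terms: below it is 2^k against the kernel, and it
  is adapted to the point in the pointwise estimate of the blocks.\<close>

lemma weighted_young:
  fixes f k w t :: real
  assumes "w > 0" "t > 0"
  shows "\<bar>f\<bar> * \<bar>k\<bar> \<le> (t * (f\<^sup>2 * w) + k\<^sup>2 / w / t) / 2"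
proof -
  have "0 \<le> (t * w * \<bar>f\<bar> - \<bar>k\<bar>)\<^sup>2" by simp
  also have "\<dots> = t\<^sup>2 * w\<^sup>2 * f\<^sup>2 + k\<^sup>2 - 2 * (t * w * (\<bar>f\<bar> * \<bar>k\<bar>))"
    by (simp add: power2_diff power_mult_distrib)
  finally have "2 * (t * w * (\<bar>f\<bar> * \<bar>k\<bar>)) \<le> t\<^sup>2 * w\<^sup>2 * f\<^sup>2 + k\<^sup>2" by linarith
  also have "\<dots> = t * w * (t * (f\<^sup>2 * w) + k\<^sup>2 / w / t)"
    using assms by (simp add: field_simps power2_eq_square)
  finally have "t * w * (2 * (\<bar>f\<bar> * \<bar>k\<bar>)) \<le> t * w * (t * (f\<^sup>2 * w) + k\<^sup>2 / w / t)"
    by (simp only: mult.left_commute)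
  then show ?thesis using assms by (simp add: mult_le_cancel_left_pos)
qed

context
  fixes \<nu> :: real
  assumes \<nu>: "\<nu> > 0"
begin

lemma sb_kernel_eq:
  "sb_kernel \<nu> z x = exp (of_real (sqrt 2 * \<nu>) * z * of_real x - of_real \<nu> * (of_real x)\<^sup>2) * exp (- of_real \<nu> * z\<^sup>2 / 2)"
proof -
  have s: "complex_of_real (sqrt 2) * complex_of_real (sqrt 2) = 2"
    by (metis of_real_mult of_real_numeral real_sqrt_mult_self abs_numeral)
  have eq: "(of_real x - z / of_real (sqrt 2))\<^sup>2 = (of_real x)\<^sup>2 - of_real (sqrt 2) * z * of_real x + z\<^sup>2 / 2"
  proof -
    have 1: "z / of_real (sqrt 2) = of_real (sqrt 2) * z / 2"
      using s by (simp add: field_simps)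
    have 2: "(of_real (sqrt 2) * z / 2)\<^sup>2 = z\<^sup>2 / 2"
      using s by (simp add: power2_eq_square field_simps)
    show ?thesis unfolding 1 power2_diff 2 by (simp add: mult_ac)
  qed
  show ?thesis
    unfolding sb_kernel_def eq by (simp add: exp_add[symmetric] algebra_simps)
qed

text \<open>Integration against the kernel is taken without the weight w, so the kernel acts on the
  weighted space through k / w. This is the squared weighted norm of k / w.\<close>

definition sb_kernel_norm :: "complex \<Rightarrow> real" where
  "sb_kernel_norm z = (LINT x|lborel. (norm (sb_kernel \<nu> z x))\<^sup>2 / exp (- \<nu> * x\<^sup>2))"

lemma integrable_sb_kernel_norm: "integrable lborel (\<lambda>x. (norm (sb_kernel \<nu> z x))\<^sup>2 / exp (- \<nu> * x\<^sup>2))"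
proof -
  have "(norm (sb_kernel \<nu> z x))\<^sup>2 / exp (- \<nu> * x\<^sup>2) = (norm (exp (- of_real \<nu> * z\<^sup>2 / 2)))\<^sup>2 * exp ((2 * (sqrt 2 * \<nu> * Re z)) * x - \<nu> * x\<^sup>2)" for x
  proof -
    have 1: "norm (exp (of_real (sqrt 2 * \<nu>) * z * of_real x - of_real \<nu> * (of_real x)\<^sup>2)) = exp ((sqrt 2 * \<nu> * Re z) * x - \<nu> * x\<^sup>2)"
      by (simp add: power2_eq_square)
    have 2: "(exp ((sqrt 2 * \<nu> * Re z) * x - \<nu> * x\<^sup>2))\<^sup>2 / exp (- \<nu> * x\<^sup>2) = exp ((2 * (sqrt 2 * \<nu> * Re z)) * x - \<nu> * x\<^sup>2)"
      by (simp add: exp_double[symmetric] exp_diff[symmetric] algebra_simps)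
    show ?thesis
      unfolding sb_kernel_eq norm_mult power_mult_distrib 1 2[symmetric] by (simp only: times_divide_eq_right mult.commute)
  qed
  then show ?thesis
    using has_bochner_integral_gaussian[OF \<nu>, of "2 * (sqrt 2 * \<nu> * Re z)"]
    by (simp only:) (intro integrable_mult_right, simp only: has_bochner_integral_iff)
qed

lemma L2_sb_kernel:
  fixes f :: "real \<Rightarrow> real"
  assumes f [measurable]: "f \<in> borel_measurable borel" and int: "integrable lborel (\<lambda>x. (f x)\<^sup>2 * exp (- \<nu> * x\<^sup>2))"
  shows "integrable lborel (\<lambda>x. \<bar>f x\<bar> * norm (sb_kernel \<nu> z x))"
    and "t > 0 \<Longrightarrow> (LINT x|lborel. \<bar>f x\<bar> * norm (sb_kernel \<nu> z x)) \<le>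
      (t * (LINT x|lborel. (f x)\<^sup>2 * exp (- \<nu> * x\<^sup>2)) + sb_kernel_norm z / t) / 2"
proof -
  let ?r = "\<lambda>t x. (t * ((f x)\<^sup>2 * exp (- \<nu> * x\<^sup>2)) + (norm (sb_kernel \<nu> z x))\<^sup>2 / exp (- \<nu> * x\<^sup>2) / t) / 2"
  have le: "\<bar>f x\<bar> * norm (sb_kernel \<nu> z x) \<le> ?r t x" if "t > 0" for t x
    using weighted_young[of "exp (- \<nu> * x\<^sup>2)" t "f x" "norm (sb_kernel \<nu> z x)"] that by simp
  have i: "integrable lborel (?r t)" for t
    by (intro integrable_divide Bochner_Integration.integrable_add integrable_mult_right int integrable_sb_kernel_norm)
  show 1: "integrable lborel (\<lambda>x. \<bar>f x\<bar> * norm (sb_kernel \<nu> z x))"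
  proof (rule Bochner_Integration.integrable_bound[OF i[of 1]])
    show "AE x in lborel. norm (\<bar>f x\<bar> * norm (sb_kernel \<nu> z x)) \<le> norm (?r 1 x)"
    proof (rule AE_I2)
      fix x
      have "norm (\<bar>f x\<bar> * norm (sb_kernel \<nu> z x)) = \<bar>f x\<bar> * norm (sb_kernel \<nu> z x)" by (simp add: abs_mult)
      then show "norm (\<bar>f x\<bar> * norm (sb_kernel \<nu> z x)) \<le> norm (?r 1 x)"
        using order_trans[OF le[of 1 x] abs_ge_self] by simp
    qed
  qed simp
  assume t: "t > 0"
  have "(LINT x|lborel. \<bar>f x\<bar> * norm (sb_kernel \<nu> z x)) \<le> (LINT x|lborel. ?r t x)"
    by (rule integral_mono[OF 1 i le[OF t]])
  also have "\<dots> = (t * (LINT x|lborel. (f x)\<^sup>2 * exp (- \<nu> * x\<^sup>2)) + sb_kernel_norm z / t) / 2"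
    unfolding sb_kernel_norm_def integral_divide_zero
    by (subst Bochner_Integration.integral_add)
       (simp_all only: integral_divide_zero integral_mult_right_zero integrable_divide integrable_mult_right int integrable_sb_kernel_norm)
  finally show "(LINT x|lborel. \<bar>f x\<bar> * norm (sb_kernel \<nu> z x)) \<le>
      (t * (LINT x|lborel. (f x)\<^sup>2 * exp (- \<nu> * x\<^sup>2)) + sb_kernel_norm z / t) / 2" .
qed

text \<open>The prefactor of \<open>B1\<close>, times the total mass
  \<open>sqrt (pi / \<nu>)\<close> of the weight, times the nth power of the factor in
  \<open>a = sqrt 2 * \<nu> * z\<close>.\<close>

definition hermite_scale :: "nat \<Rightarrow> real" where
  "hermite_scale n = (\<nu> / pi) powr (3/4) * sqrt (pi / \<nu>) * (sqrt 2 * \<nu>) ^ n"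

lemma hermite_scale_pos: "hermite_scale n > 0"
  using \<nu> by (simp add: hermite_scale_def)

lemma integrable_poly_sb_kernel: "integrable lborel (\<lambda>x. of_real (poly p x) * sb_kernel \<nu> z x)"
proof -
  have "integrable lborel (\<lambda>x. (of_real (poly p x) * exp ((of_real (sqrt 2 * \<nu>) * z) * of_real x - of_real \<nu> * (of_real x)\<^sup>2)) * exp (- of_real \<nu> * z\<^sup>2 / 2))"
    by (intro integrable_mult_left integrable_poly_gauss[OF \<nu>])
  then show ?thesis by (simp only: sb_kernel_eq mult.assoc)
qed

text \<open>By \<open>sb_kernel_eq\<close> the kernel is exp (a x - \<nu> x^2) with
  \<open>a = sqrt 2 * \<nu> * z\<close>, times exp (- \<nu> z^2 / 2). The Hermite polynomial
  produces a^n, and the Gaussian value exp (a^2 / (4 \<nu>)) cancels the last factor.\<close>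

lemma B1_hermite: "B1 \<nu> (\<lambda>x. of_real (poly (hermite \<nu> n) x)) z = of_real (hermite_scale n) * z ^ n"
proof -
  let ?a = "of_real (sqrt 2 * \<nu>) * z"
  have "(LINT x|lborel. of_real (poly (hermite \<nu> n) x) * sb_kernel \<nu> z x) =
    poly_gauss_int \<nu> ?a (hermite \<nu> n) * exp (- of_real \<nu> * z\<^sup>2 / 2)"
    unfolding poly_gauss_int_def[OF \<nu>] sb_kernel_eq mult.assoc[symmetric] by (rule integral_mult_left_zero)
  also have "\<dots> = ?a ^ n * of_real (sqrt (pi / \<nu>)) * (exp (?a\<^sup>2 / of_real (4 * \<nu>)) * exp (- of_real \<nu> * z\<^sup>2 / 2))"
    unfolding poly_gauss_int_hermite[OF \<nu>] poly_gauss_int_1[OF \<nu>] by (simp only: mult_ac)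
  also have "exp (?a\<^sup>2 / of_real (4 * \<nu>)) * exp (- of_real \<nu> * z\<^sup>2 / 2) = 1"
  proof -
    have "(complex_of_real (sqrt 2))\<^sup>2 = 2"
      by (metis of_real_numeral of_real_power real_sqrt_pow2 zero_le_numeral)
    then have "?a\<^sup>2 / of_real (4 * \<nu>) + - of_real \<nu> * z\<^sup>2 / 2 = 0"
      using \<nu> by (simp add: power_mult_distrib power2_eq_square[of "complex_of_real \<nu>"])
    then show ?thesis by (simp only: exp_add[symmetric] exp_zero)
  qed
  finally show ?thesis
    unfolding B1_sb_kernel hermite_scale_def
    by (simp add: power_mult_distrib mult_ac)
qed

text \<open>The Hermite series is summed in blocks whose norms decay geometrically, so that it converges
  almost everywhere and may be integrated term by term against the kernel.\<close>

lemma B1_surj_real: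
  fixes a :: "nat \<Rightarrow> real"
  assumes fock: "fock_coeffs \<nu> (\<lambda>n. of_real (a n))"
  obtains f :: "real \<Rightarrow> real" where "f \<in> L2_fun \<nu>"
    "\<And>z. B1 \<nu> (\<lambda>x. of_real (f x)) z = (\<Sum>n. of_real (a n) * z ^ n)"
proof -
  define w where "w x = exp (- \<nu> * x\<^sup>2)" for x
  have w: "w x > 0" for x by (simp add: w_def)
  have [measurable]: "w \<in> borel_measurable borel" unfolding w_def by measurable
  define b where "b n = a n / hermite_scale n" for n
  \<comment> \<open>\<open>t n\<close> is the squared weighted norm of the term \<open>b n\<close>
    times the nth Hermite polynomial. Its ratio to the nth term of the Fock condition is independent
    of \<open>n\<close>, since (sqrt 2 \<nu>)^(2n) = (2 \<nu>)^n \<nu>^n.\<close>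
  define t where "t n = (b n)\<^sup>2 * (fact n * (2 * \<nu>) ^ n * sqrt (pi / \<nu>))" for n
  have t0: "t n \<ge> 0" for n using \<nu> by (simp add: t_def)
  have st: "summable t"
  proof -
    define C where "C = (\<nu> / pi) powr (3/4) * sqrt (pi / \<nu>)"
    have C: "C > 0" using \<nu> by (simp add: C_def)
    have "t n = (a n)\<^sup>2 * (fact n / \<nu> ^ n) * (sqrt (pi / \<nu>) / C\<^sup>2)" for n
    proof -
      have 1: "(sqrt 2 * \<nu>) * (sqrt 2 * \<nu>) = (2 * \<nu>) * \<nu>"
      proof -
        have "(sqrt 2 * \<nu>) * (sqrt 2 * \<nu>) = (sqrt 2 * sqrt 2) * (\<nu> * \<nu>)" by (simp only: mult_ac)
        then show ?thesis by simp
      qed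
      have "(hermite_scale n)\<^sup>2 = C\<^sup>2 * ((sqrt 2 * \<nu>) ^ n * (sqrt 2 * \<nu>) ^ n)"
        unfolding hermite_scale_def C_def[symmetric] power2_eq_square by (simp only: mult_ac)
      then have "(hermite_scale n)\<^sup>2 = C\<^sup>2 * ((2 * \<nu>) ^ n * \<nu> ^ n)"
        by (simp only: power_mult_distrib[symmetric] 1)
      then show ?thesis using \<nu> C by (simp add: t_def b_def power_divide field_simps)
    qed
    then have "t = (\<lambda>n. (a n)\<^sup>2 * (fact n / \<nu> ^ n) * (sqrt (pi / \<nu>) / C\<^sup>2))" by (rule ext)
    then show ?thesis using fock unfolding fock_coeffs_def by (simp only: norm_of_real power2_abs summable_mult2)
  qed
  define tail where "tail n = (\<Sum>k. t (k + n))" for n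
  have tail: "suminf t = tail n + (\<Sum>k<n. t k)" for n
    unfolding tail_def by (rule suminf_split_initial_segment[OF st])
  have anti: "tail n \<le> tail m" if "m \<le> n" for m n
  proof -
    have "(\<Sum>k<m. t k) \<le> (\<Sum>k<n. t k)" using that t0 by (intro sum_mono2) auto
    then show ?thesis using tail[of m] tail[of n] by linarith
  qed
  have tail0: "tail n \<ge> 0" for n
    unfolding tail_def using t0 st by (intro suminf_nonneg) auto
  \<comment> \<open>The summand 1 keeps \<open>M\<close> positive even if all \<open>t n\<close>
    vanish. As \<open>tail 0 \<le> M\<close>, the first block starts at index 0.\<close>
  define M where "M = tail 0 + 1"
  have M: "M > 0" using tail0[of 0] by (simp add: M_def)
  have ex: "\<exists>n. tail n \<le> M / 4 ^ k" for k :: nat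
  proof -
    have "M / 4 ^ k > 0" using M by simp
    from suminf_exist_split[OF this st] show ?thesis
      unfolding tail_def by (metis real_norm_def abs_le_D1 less_imp_le order_refl)
  qed
  define L where "L k = (LEAST n. tail n \<le> M / 4 ^ k)" for k :: nat
  have L: "tail (L k) \<le> M / 4 ^ k" for k unfolding L_def by (rule LeastI_ex[OF ex])
  have Lmono: "L k \<le> L (Suc k)" for k
  proof -
    have "M / 4 ^ Suc k \<le> M / 4 ^ k" using M by (simp add: field_simps)
    then have "tail (L (Suc k)) \<le> M / 4 ^ k" using L[of "Suc k"] by linarith
    then show ?thesis unfolding L_def[of k] by (rule Least_le)
  qed
  \<comment> \<open>\<open>L\<close> is only weakly increasing; adding \<open>k\<close> makes the
    block boundaries strictly increasing and does not spoil the bound on the tails.\<close>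
  define N where "N k = k + L k" for k
  have "N k < N (Suc k)" for k using Lmono[of k] by (simp add: N_def)
  then have N: "strict_mono N" by (simp add: strict_mono_Suc_iff)
  have "L 0 \<le> 0" unfolding L_def by (rule Least_le) (simp add: M_def)
  then have N0: "N 0 = 0" by (simp add: N_def)
  have tN: "tail (N k) \<le> M / 4 ^ k" for k
    using anti[of "L k" "N k"] L[of k] by (simp add: N_def)
  define p where "p k = (\<Sum>n\<in>{N k..<N (Suc k)}. smult (b n) (hermite \<nu> n))" for k
  define g where "g k x = poly (p k) x" for k x
  have [measurable]: "g k \<in> borel_measurable borel" for k
    unfolding g_def by (intro borel_measurable_continuous_onI continuous_intros)
  have gint: "integrable lborel (\<lambda>x. (g k x)\<^sup>2 * w x)" for k
    using integrable_poly_weight[OF \<nu>, of "p k * p k"] by (simp add: g_def w_def power2_eq_square)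
  have gnorm: "(LINT x|lborel. (g k x)\<^sup>2 * w x) \<le> M / 4 ^ k" for k
  proof -
    let ?B = "{N k..<N (Suc k)}"
    have "(LINT x|lborel. (g k x)\<^sup>2 * w x) = poly_weight_int \<nu> (p k * p k)"
      by (simp add: poly_weight_int_def[OF \<nu>] g_def w_def power2_eq_square)
    also have "\<dots> = (\<Sum>i\<in>?B. \<Sum>j\<in>?B. b i * (b j * poly_weight_int \<nu> (hermite \<nu> i * hermite \<nu> j)))"
      unfolding p_def sum_product poly_weight_int_sum[OF \<nu>] by (simp add: poly_weight_int_smult[OF \<nu>] mult_ac)
    also have "\<dots> = (\<Sum>i\<in>?B. t i)"
      by (intro sum.cong refl) (simp add: hermite_orthogonal[OF \<nu>] t_def if_distrib[of "\<lambda>x. _ * x"] sum.delta power2_eq_square mult_ac cong: if_cong)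
    also have "\<dots> = tail (N k) - tail (N (Suc k))"
    proof -
      have "N k \<le> N (Suc k)" using N by (simp add: strict_mono_less_eq)
      then have "(\<Sum>i<N k. t i) + (\<Sum>i\<in>?B. t i) = (\<Sum>i<N (Suc k). t i)"
        unfolding lessThan_atLeast0 by (intro sum.atLeastLessThan_concat) auto
      then show ?thesis using tail[of "N k"] tail[of "N (Suc k)"] by linarith
    qed
    also have "\<dots> \<le> M / 4 ^ k" using tail0[of "N (Suc k)"] tN[of k] by linarith
    finally show ?thesis .
  qed
  have geo: "summable (\<lambda>k. (1/2) ^ k :: real)" "(\<Sum>k. (1/2) ^ k :: real) = 2"
    by (simp_all add: suminf_geometric summable_geometric)
  have p24: "2 ^ k * (M / 4 ^ k) = M * (1/2) ^ k" for k :: nat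
  proof -
    have "(4::real) ^ k = 2 ^ k * 2 ^ k" by (simp add: power_mult_distrib[symmetric])
    then show ?thesis by (simp add: power_one_over)
  qed
  \<comment> \<open>The block norms decay like 4^-k, so with the factor 2^k they are still summable.
    The factor is spent on convergence: the sum of |g k x| is controlled by that of 2^k (g k x)^2
    against the geometric series 2^-k.\<close>
  let ?G = "\<lambda>k x. 2 ^ k * ((g k x)\<^sup>2 * w x)"
  have G0: "?G k x \<ge> 0" for k x using w[of x] by simp
  have Gi: "integrable lborel (?G k)" for k using gint by simp
  have Gl: "(LINT x|lborel. ?G k x) \<le> M * (1/2) ^ k" for k
    using mult_left_mono[OF gnorm[of k], of "2 ^ k"] p24[of k] by simp
  have Gn: "0 \<le> (LINT x|lborel. ?G k x)" for k
    by (rule Bochner_Integration.integral_nonneg[OF G0])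
  have sG: "summable (\<lambda>k. LINT x|lborel. ?G k x)"
  proof (rule summable_comparison_test'[OF summable_mult[OF geo(1), of M]])
    show "norm (LINT x|lborel. ?G k x) \<le> M * (1/2) ^ k" for k
      using Gl[of k] by (simp only: real_norm_def abs_of_nonneg[OF Gn])
  qed
  have AE_G: "AE x in lborel. summable (\<lambda>k. ?G k x)"
  proof -
    have "(\<integral>\<^sup>+x. (\<Sum>k. ennreal (?G k x)) \<partial>lborel) = (\<Sum>k. \<integral>\<^sup>+x. ennreal (?G k x) \<partial>lborel)"
      by (rule nn_integral_suminf) measurable
    also have "\<dots> = (\<Sum>k. ennreal (LINT x|lborel. ?G k x))"
      by (intro suminf_cong nn_integral_eq_integral Gi AE_I2 G0)
    also have "\<dots> \<noteq> \<infinity>"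
      unfolding infinity_ennreal_def by (rule ennreal_suminf_neq_top[OF sG Gn])
    finally have "AE x in lborel. (\<Sum>k. ennreal (?G k x)) \<noteq> \<infinity>"
      by (intro nn_integral_PInf_AE) measurable
    then show ?thesis
      by eventually_elim (rule summable_suminf_not_top[OF G0], simp)
  qed
  have Gint: "integrable lborel (\<lambda>x. \<Sum>k. ?G k x)"
  proof (rule integrable_suminf[OF Gi])
    show "AE x in lborel. summable (\<lambda>k. norm (?G k x))"
      using AE_G by eventually_elim (simp only: real_norm_def abs_of_nonneg[OF G0])
    show "summable (\<lambda>k. LINT x|lborel. norm (?G k x))"
      using sG by (simp only: real_norm_def abs_of_nonneg[OF G0])
  qed
  have key: "summable (\<lambda>k. \<bar>g k x\<bar>)" "(\<Sum>k. g k x)\<^sup>2 * w x \<le> 2 * (\<Sum>k. ?G k x) + 2 * w x"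
    if sx: "summable (\<lambda>k. ?G k x)" for x
  proof -
    define G where "G = (\<Sum>k. ?G k x) / w x"
    have G: "G \<ge> 0" unfolding G_def using w[of x] by (intro divide_nonneg_pos suminf_nonneg sx G0)
    have le: "\<bar>g k x\<bar> \<le> (l * (?G k x / w x) + (1/2) ^ k / l) / 2" if "l > 0" for k l
      using weighted_young[of "2 ^ k" l "g k x" 1] that w[of x] by (simp add: power_one_over mult_ac)
    have sl: "summable (\<lambda>k. (l * (?G k x / w x) + (1/2) ^ k / l) / 2)" for l
      by (intro summable_divide summable_add summable_mult sx geo)
    show sg: "summable (\<lambda>k. \<bar>g k x\<bar>)"
      by (rule summable_comparison_test'[OF sl[of 1]]) (use le[of 1] in simp)
    \<comment> \<open>The bound (l G + 2 / l) / 2 is to be made small by the choice of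
      \<open>l\<close>, where 2 is the sum of the geometric series. The optimum is sqrt (2 / G);
      using G + 1 for G avoids division by 0 and accounts for the extra \<open>2 * w x\<close> in
      the estimate.\<close>
    define s where "s = sqrt (2 * (G + 1))"
    have s: "s > 0" "s\<^sup>2 = 2 * (G + 1)" using G by (simp_all add: s_def)
    define l where "l = s / (G + 1)"
    have l: "l > 0" "l * (G + 1) = s" "2 / l = s" using s G by (auto simp: l_def field_simps power2_eq_square)
    have "\<bar>\<Sum>k. g k x\<bar> \<le> (\<Sum>k. \<bar>g k x\<bar>)"
      by (rule summable_rabs[OF sg])
    also have "\<dots> \<le> (\<Sum>k. (l * (?G k x / w x) + (1/2) ^ k / l) / 2)"
      by (rule suminf_le[OF le[OF l(1)] sg sl])
    also have "\<dots> = (l * G + 2 / l) / 2"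
    proof -
      have "(\<lambda>k. (l * (?G k x / w x) + (1/2) ^ k / l) / 2) sums ((l * G + 2 / l) / 2)"
        unfolding G_def using geo
        by (intro sums_divide sums_add sums_mult summable_sums sx) (simp add: sums_iff)
      then show ?thesis by (rule sums_unique[symmetric])
    qed
    also have "\<dots> \<le> s"
    proof -
      have "l * G + l = s" using l(2) by (simp only: distrib_left mult_1_right)
      then have "l * G \<le> s" using l(1) by simp
      then show ?thesis unfolding l(3) by simp
    qed
    finally have "\<bar>\<Sum>k. g k x\<bar>\<^sup>2 \<le> s\<^sup>2" by (intro power_mono) auto
    then have "(\<Sum>k. g k x)\<^sup>2 * w x \<le> (2 * (G + 1)) * w x"
      using w[of x] s(2) by (intro mult_right_mono) auto
    also have "\<dots> = 2 * (\<Sum>k. ?G k x) + 2 * w x"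
      using w[of x] unfolding G_def by (simp add: field_simps)
    finally show "(\<Sum>k. g k x)\<^sup>2 * w x \<le> 2 * (\<Sum>k. ?G k x) + 2 * w x" .
  qed
  define f where "f x = (\<Sum>k. g k x)" for x
  have fm [measurable]: "f \<in> borel_measurable borel" unfolding f_def by measurable
  have wint: "integrable lborel w"
    using has_bochner_integral_gaussian[OF \<nu>, of 0] by (simp add: has_bochner_integral_iff w_def[abs_def])
  have fint: "integrable lborel (\<lambda>x. (f x)\<^sup>2 * w x)"
  proof (rule Bochner_Integration.integrable_bound)
    show "integrable lborel (\<lambda>x. 2 * (\<Sum>k. ?G k x) + 2 * w x)"
      by (intro Bochner_Integration.integrable_add integrable_mult_right Gint wint)
    show "AE x in lborel. norm ((f x)\<^sup>2 * w x) \<le> norm (2 * (\<Sum>k. ?G k x) + 2 * w x)"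
      using AE_G
    proof eventually_elim
      case (elim x)
      have "norm ((f x)\<^sup>2 * w x) = (f x)\<^sup>2 * w x" using w[of x] by simp
      also have "\<dots> \<le> 2 * (\<Sum>k. ?G k x) + 2 * w x" unfolding f_def by (rule key(2)[OF elim])
      finally show ?case unfolding real_norm_def by (rule order_trans[OF _ abs_ge_self])
    qed
  qed measurable
  have fL2: "f \<in> L2_fun \<nu>" unfolding L2_fun_def using fint fm by (simp add: w_def)
  have "B1 \<nu> (\<lambda>x. of_real (f x)) z = (\<Sum>n. of_real (a n) * z ^ n)" for z
  proof -
    let ?k = "sb_kernel \<nu> z"
    have gk: "integrable lborel (\<lambda>x. of_real (g k x) * ?k x)" for k
      unfolding g_def by (rule integrable_poly_sb_kernel)
    have "(LINT x|lborel. of_real (f x) * ?k x) = (LINT x|lborel. (\<Sum>k. of_real (g k x) * ?k x))"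
    proof (rule integral_cong_AE)
      show "AE x in lborel. of_real (f x) * ?k x = (\<Sum>k. of_real (g k x) * ?k x)"
        using AE_G
      proof eventually_elim
        case (elim x)
        have s: "summable (\<lambda>k. g k x)" using key(1)[OF elim] by (rule summable_rabs_cancel)
        have "(\<lambda>k. complex_of_real (g k x) * ?k x) sums (of_real (f x) * ?k x)"
          unfolding f_def by (intro sums_mult2 sums_of_real summable_sums s)
        then show ?case by (rule sums_unique)
      qed
    qed measurable
    also have "\<dots> = (\<Sum>k. LINT x|lborel. of_real (g k x) * ?k x)"
    proof (rule integral_suminf[OF gk])
      have n: "norm (of_real (g k x) * ?k x) = \<bar>g k x\<bar> * norm (?k x)" for k x
        by (simp add: norm_mult)
      show "AE x in lborel. summable (\<lambda>k. norm (of_real (g k x) * ?k x))"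
        using AE_G unfolding n by eventually_elim (intro summable_mult2 key(1))
      show "summable (\<lambda>k. LINT x|lborel. norm (of_real (g k x) * ?k x))"
        unfolding n
      proof (rule summable_comparison_test'[OF summable_mult2[OF geo(1), of "(M + sb_kernel_norm z) / 2"]])
        fix k
        \<comment> \<open>With \<open>t = 2 ^ k\<close> both terms decay like 2^-k: the block norm
          is at most M / 4^k, and the kernel norm is divided by 2^k.\<close>
        have "(LINT x|lborel. \<bar>g k x\<bar> * norm (?k x)) \<le> (2 ^ k * (LINT x|lborel. (g k x)\<^sup>2 * w x) + sb_kernel_norm z / 2 ^ k) / 2"
          unfolding w_def using gint[of k] by (intro L2_sb_kernel(2)) (auto simp: w_def)
        also have "\<dots> \<le> (M * (1/2) ^ k + sb_kernel_norm z / 2 ^ k) / 2"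
          using mult_left_mono[OF gnorm[of k], of "2 ^ k"] p24[of k] by simp
        also have "\<dots> = (1/2) ^ k * ((M + sb_kernel_norm z) / 2)"
          by (simp add: power_one_over field_simps)
        finally show "norm (LINT x|lborel. \<bar>g k x\<bar> * norm (?k x)) \<le> (1/2) ^ k * ((M + sb_kernel_norm z) / 2)"
          by (subst real_norm_def, subst abs_of_nonneg) (auto intro!: Bochner_Integration.integral_nonneg)
      qed
    qed
    finally have B: "B1 \<nu> (\<lambda>x. of_real (f x)) z = of_real ((\<nu> / pi) powr (3/4)) * (\<Sum>k. LINT x|lborel. of_real (g k x) * ?k x)"
      by (simp only: B1_sb_kernel)
    have blk: "of_real ((\<nu> / pi) powr (3/4)) * (LINT x|lborel. of_real (g k x) * ?k x) = (\<Sum>n\<in>{N k..<N (Suc k)}. of_real (a n) * z ^ n)" for k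
    proof -
      have "(LINT x|lborel. of_real (g k x) * ?k x) = (LINT x|lborel. (\<Sum>n\<in>{N k..<N (Suc k)}. of_real (b n) * (of_real (poly (hermite \<nu> n) x) * ?k x)))"
        by (simp add: g_def p_def poly_sum sum_distrib_right mult.assoc)
      also have "\<dots> = (\<Sum>n\<in>{N k..<N (Suc k)}. of_real (b n) * (LINT x|lborel. of_real (poly (hermite \<nu> n) x) * ?k x))"
        by (subst Bochner_Integration.integral_sum) (simp_all add: integrable_poly_sb_kernel)
      finally have "of_real ((\<nu> / pi) powr (3/4)) * (LINT x|lborel. of_real (g k x) * ?k x) =
        (\<Sum>n\<in>{N k..<N (Suc k)}. of_real (b n) * B1 \<nu> (\<lambda>x. of_real (poly (hermite \<nu> n) x)) z)"
        by (simp add: B1_sb_kernel sum_distrib_left mult_ac)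
      also have "\<dots> = (\<Sum>n\<in>{N k..<N (Suc k)}. of_real (a n) * z ^ n)"
      proof (rule sum.cong[OF refl])
        fix n
        have "b n * hermite_scale n = a n" using hermite_scale_pos[of n] by (simp add: b_def)
        then have "complex_of_real (b n) * of_real (hermite_scale n) = of_real (a n)" by (simp only: of_real_mult[symmetric])
        then show "of_real (b n) * B1 \<nu> (\<lambda>x. of_real (poly (hermite \<nu> n) x)) z = of_real (a n) * z ^ n"
          unfolding B1_hermite by (simp only: mult.assoc[symmetric])
      qed
      finally show ?thesis .
    qed
    have "summable (\<lambda>n. norm (complex_of_real (a n)) * norm z ^ n)"
      using fock_coeffs_entire[OF \<nu> fock] unfolding entire_coeffs_def by blast
    then have "summable (\<lambda>n. complex_of_real (a n) * z ^ n)"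
      by (intro summable_norm_cancel[where f="\<lambda>n. complex_of_real (a n) * z ^ n"]) (simp only: norm_mult norm_power)
    then have "(\<lambda>K. \<Sum>n<K. complex_of_real (a n) * z ^ n) \<longlonglongrightarrow> (\<Sum>n. of_real (a n) * z ^ n)"
      by (rule summable_LIMSEQ)
    \<comment> \<open>The block sums are partial sums of the power series along the subsequence
      \<open>N\<close>, which has the same limit.\<close>
    from LIMSEQ_subseq_LIMSEQ[OF this N]
    have "(\<lambda>K. \<Sum>n<N K. complex_of_real (a n) * z ^ n) \<longlonglongrightarrow> (\<Sum>n. of_real (a n) * z ^ n)"
      by (simp only: o_def)
    moreover have "(\<Sum>n<N K. complex_of_real (a n) * z ^ n) = (\<Sum>k<K. \<Sum>n\<in>{N k..<N (Suc k)}. of_real (a n) * z ^ n)" for K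
    proof (induction K)
      case 0
      show ?case by (simp add: N0)
    next
      case (Suc K)
      have "N K \<le> N (Suc K)" using N by (simp add: strict_mono_less_eq)
      then have "(\<Sum>n<N (Suc K). complex_of_real (a n) * z ^ n) = (\<Sum>n<N K. of_real (a n) * z ^ n) + (\<Sum>n\<in>{N K..<N (Suc K)}. of_real (a n) * z ^ n)"
        unfolding lessThan_atLeast0 by (intro sum.atLeastLessThan_concat[symmetric]) auto
      then show ?case using Suc.IH by simp
    qed
    ultimately have "(\<lambda>k. of_real ((\<nu> / pi) powr (3/4)) * (LINT x|lborel. of_real (g k x) * ?k x)) sums (\<Sum>n. of_real (a n) * z ^ n)"
      unfolding sums_def blk by (simp only:)
    moreover have "complex_of_real ((\<nu> / pi) powr (3/4)) \<noteq> 0" using \<nu> by simp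
    ultimately have "summable (\<lambda>k. LINT x|lborel. of_real (g k x) * ?k x)"
      using summable_cmult_iff sums_summable by blast
    then show ?thesis
      unfolding B using \<open>_ sums _\<close> by (simp add: suminf_mult[symmetric] sums_iff)
  qed
  then show ?thesis using that fL2 by blast
qed

end

section \<open>Injectivity and the quaternionic transform\<close>

lemma L2_fun_bounded_linear:
  fixes f :: "real \<Rightarrow> 'a::euclidean_space" and T :: "'a \<Rightarrow> 'b::euclidean_space"
  assumes f: "f \<in> L2_fun \<nu>" and T: "bounded_linear T"
  shows "(\<lambda>x. T (f x)) \<in> L2_fun \<nu>"
proof -
  have fm [measurable]: "f \<in> borel_measurable borel" and fi: "integrable lborel (\<lambda>x. (norm (f x))\<^sup>2 * exp (- \<nu> * x\<^sup>2))"
    using f by (auto simp: L2_fun_def)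
  have [measurable]: "T \<in> borel_measurable borel"
    by (intro borel_measurable_continuous_onI linear_continuous_on T)
  obtain K where K: "\<And>x. norm (T x) \<le> norm x * K" using bounded_linear.nonneg_bounded[OF T] by blast
  have "integrable lborel (\<lambda>x. (norm (T (f x)))\<^sup>2 * exp (- \<nu> * x\<^sup>2))"
  proof (rule Bochner_Integration.integrable_bound[OF integrable_mult_right[OF fi, of "K\<^sup>2"]])
    show "AE x in lborel. norm ((norm (T (f x)))\<^sup>2 * exp (- \<nu> * x\<^sup>2)) \<le> norm (K\<^sup>2 * ((norm (f x))\<^sup>2 * exp (- \<nu> * x\<^sup>2)))"
    proof (rule AE_I2)
      fix x
      have "(norm (T (f x)))\<^sup>2 \<le> (norm (f x) * K)\<^sup>2" by (intro power_mono K) simp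
      then have "(norm (T (f x)))\<^sup>2 * exp (- \<nu> * x\<^sup>2) \<le> (norm (f x) * K)\<^sup>2 * exp (- \<nu> * x\<^sup>2)"
        by (intro mult_right_mono) auto
      then show "norm ((norm (T (f x)))\<^sup>2 * exp (- \<nu> * x\<^sup>2)) \<le> norm (K\<^sup>2 * ((norm (f x))\<^sup>2 * exp (- \<nu> * x\<^sup>2)))"
        by (simp add: power_mult_distrib abs_mult mult_ac)
    qed
  qed measurable
  then show ?thesis by (simp add: L2_fun_def)
qed

lemma L2_fun_add:
  fixes f g :: "real \<Rightarrow> 'a::euclidean_space"
  assumes f: "f \<in> L2_fun \<nu>" and g: "g \<in> L2_fun \<nu>"
  shows "(\<lambda>x. f x + g x) \<in> L2_fun \<nu>"
proof -
  have [measurable]: "f \<in> borel_measurable borel" "g \<in> borel_measurable borel"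
    and fi: "integrable lborel (\<lambda>x. (norm (f x))\<^sup>2 * exp (- \<nu> * x\<^sup>2))"
    and gi: "integrable lborel (\<lambda>x. (norm (g x))\<^sup>2 * exp (- \<nu> * x\<^sup>2))"
    using f g by (auto simp: L2_fun_def)
  have "integrable lborel (\<lambda>x. (norm (f x + g x))\<^sup>2 * exp (- \<nu> * x\<^sup>2))"
  proof (rule Bochner_Integration.integrable_bound[OF integrable_mult_right[OF Bochner_Integration.integrable_add[OF fi gi], of 2]])
    show "AE x in lborel. norm ((norm (f x + g x))\<^sup>2 * exp (- \<nu> * x\<^sup>2)) \<le>
      norm (2 * ((norm (f x))\<^sup>2 * exp (- \<nu> * x\<^sup>2) + (norm (g x))\<^sup>2 * exp (- \<nu> * x\<^sup>2)))"
    proof (rule AE_I2)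
      fix x
      have "(norm (f x + g x))\<^sup>2 \<le> (norm (f x) + norm (g x))\<^sup>2"
        by (intro power_mono norm_triangle_ineq) simp
      also have "\<dots> \<le> 2 * ((norm (f x))\<^sup>2 + (norm (g x))\<^sup>2)"
        using sum_squares_bound[of "norm (f x)" "norm (g x)"] by (simp add: power2_sum)
      finally have "(norm (f x + g x))\<^sup>2 * exp (- \<nu> * x\<^sup>2) \<le> 2 * ((norm (f x))\<^sup>2 + (norm (g x))\<^sup>2) * exp (- \<nu> * x\<^sup>2)"
        by (rule mult_right_mono) simp
      then show "norm ((norm (f x + g x))\<^sup>2 * exp (- \<nu> * x\<^sup>2)) \<le>
        norm (2 * ((norm (f x))\<^sup>2 * exp (- \<nu> * x\<^sup>2) + (norm (g x))\<^sup>2 * exp (- \<nu> * x\<^sup>2)))"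
        by (simp add: distrib_right mult.assoc)
    qed
  qed measurable
  then show ?thesis by (simp add: L2_fun_def)
qed

text \<open>The positive and negative parts of \<open>h\<close> have equal Fourier transforms. At
  frequency 0 this says that they have equal mass, so both can be normalised to probability
  densities, to which Levy's uniqueness theorem applies. Mass 0 cannot be normalised and is treated
  separately.\<close>

lemma integrable_eq_0_if_fourier_eq_0:
  fixes h :: "real \<Rightarrow> real"
  assumes h: "integrable lborel h" and zero: "\<And>s. (LINT x|lborel. of_real (h x) * iexp (s * x)) = 0"
  shows "AE x in lborel. h x = 0"
proof -
  have [measurable]: "h \<in> borel_measurable borel" using h by auto
  define p m where "p x = max 0 (h x)" and "m x = max 0 (- h x)" for x
  have [measurable]: "p \<in> borel_measurable borel" "m \<in> borel_measurable borel"
    unfolding p_def m_def by measurable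
  have pm: "h x = p x - m x" "p x \<ge> 0" "m x \<ge> 0" for x by (auto simp: p_def m_def)
  have pi: "integrable lborel p" and mi: "integrable lborel m"
    using h unfolding p_def m_def by (auto intro!: integrable_max)
  have ci: "integrable lborel (\<lambda>x. of_real (f x) * iexp (s * x))" if "integrable lborel f" for f :: "real \<Rightarrow> real" and s
  proof (rule Bochner_Integration.integrable_bound[OF that])
    have [measurable]: "f \<in> borel_measurable borel" using that by auto
    show "(\<lambda>x. of_real (f x) * iexp (s * x)) \<in> borel_measurable lborel" by measurable
  qed (simp add: norm_mult)
  have eq: "(LINT x|lborel. of_real (p x) * iexp (s * x)) = (LINT x|lborel. of_real (m x) * iexp (s * x))" for s
  proof -
    have "(LINT x|lborel. of_real (h x) * iexp (s * x)) =
        (LINT x|lborel. of_real (p x) * iexp (s * x)) - (LINT x|lborel. of_real (m x) * iexp (s * x))"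
      unfolding pm(1) of_real_diff left_diff_distrib
      by (rule Bochner_Integration.integral_diff[OF ci[OF pi] ci[OF mi]])
    then show ?thesis using zero[of s] by simp
  qed
  define M where "M = (LINT x|lborel. p x)"
  have M: "M = (LINT x|lborel. m x)"
    using eq[of 0] by (simp add: M_def integral_complex_of_real)
  have "M \<ge> 0" unfolding M_def by (simp add: pm Bochner_Integration.integral_nonneg)
  then consider "M = 0" | "M > 0" by linarith
  then show ?thesis
  proof cases
    case 1
    have "AE x in lborel. p x = 0" "AE x in lborel. m x = 0"
      using 1 M integral_nonneg_eq_0_iff_AE[OF pi] integral_nonneg_eq_0_iff_AE[OF mi] pm(2,3) by (auto simp: M_def)
    then show ?thesis by eventually_elim (simp add: pm(1))
  next
    case 2
    have dist: "real_distribution (density lborel (\<lambda>x. ennreal (f x / M)))"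
      and chr: "char (density lborel (\<lambda>x. ennreal (f x / M))) s = (LINT x|lborel. of_real (f x) * iexp (s * x)) / of_real M"
      if f: "integrable lborel f" "\<And>x. f x \<ge> 0" "(LINT x|lborel. f x) = M" for f s
    proof -
      have [measurable]: "f \<in> borel_measurable borel" using f by auto
      have "(\<integral>\<^sup>+x. ennreal (f x / M) \<partial>lborel) = ennreal (LINT x|lborel. f x / M)"
        using f 2 by (intro nn_integral_eq_integral) auto
      also have "\<dots> = 1" using f 2 by simp
      finally have "emeasure (density lborel (\<lambda>x. ennreal (f x / M))) UNIV = 1"
        by (simp add: emeasure_density)
      then interpret prob_space "density lborel (\<lambda>x. ennreal (f x / M))"
        by (intro prob_spaceI) simp
      show "real_distribution (density lborel (\<lambda>x. ennreal (f x / M)))"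
        by unfold_locales auto
      have "char (density lborel (\<lambda>x. ennreal (f x / M))) s = (LINT x|lborel. (f x / M) *\<^sub>R iexp (s * x))"
        unfolding char_def using f 2 by (subst integral_density) auto
      also have "\<dots> = (LINT x|lborel. of_real (f x) * iexp (s * x) / of_real M)"
        by (simp add: scaleR_conv_of_real)
      finally show "char (density lborel (\<lambda>x. ennreal (f x / M))) s = (LINT x|lborel. of_real (f x) * iexp (s * x)) / of_real M"
        by (simp only: integral_divide_zero)
    qed
    have "density lborel (\<lambda>x. ennreal (p x / M)) = density lborel (\<lambda>x. ennreal (m x / M))"
    proof (rule Levy_uniqueness)
      show "char (density lborel (\<lambda>x. ennreal (p x / M))) = char (density lborel (\<lambda>x. ennreal (m x / M)))"
        using chr[OF pi] chr[OF mi] eq by (auto simp: pm M M_def[symmetric])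
    qed (use dist[OF pi] dist[OF mi] in \<open>auto simp: pm M M_def[symmetric]\<close>)
    then have "AE x in lborel. ennreal (p x / M) = ennreal (m x / M)"
      by (subst (asm) sigma_finite_measure.density_unique_iff[OF sigma_finite_lborel]) auto
    then show ?thesis
    proof eventually_elim
      case (elim x)
      then have "p x / M = m x / M" using pm 2 by simp
      then show ?case using 2 pm(1) by simp
    qed
  qed
qed

lemma sb_kernel_cnj: "sb_kernel \<nu> (cnj z) x = cnj (sb_kernel \<nu> z x)"
  by (simp add: sb_kernel_def exp_cnj)

context
  fixes \<nu> :: real
  assumes \<nu>: "\<nu> > 0"
begin

lemma integrable_L2_sb_kernel:
  fixes f :: "real \<Rightarrow> real"
  assumes "f \<in> L2_fun \<nu>"
  shows "integrable lborel (\<lambda>x. of_real (f x) * sb_kernel \<nu> z x)"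
proof -
  have [measurable]: "f \<in> borel_measurable borel" using assms by (auto simp: L2_fun_def)
  have "integrable lborel (\<lambda>x. \<bar>f x\<bar> * norm (sb_kernel \<nu> z x))"
    using assms by (intro L2_sb_kernel[OF \<nu>]) (auto simp: L2_fun_def)
  then show ?thesis
    by (rule Bochner_Integration.integrable_bound) (measurable, simp add: norm_mult)
qed

lemma B1_real_cnj:
  "f \<in> L2_fun \<nu> \<Longrightarrow> B1 \<nu> (\<lambda>x. of_real (f x)) (cnj z) = cnj (B1 \<nu> (\<lambda>x. of_real (f x)) z)"
  unfolding B1_sb_kernel sb_kernel_cnj
  using integral_bounded_linear[OF bounded_linear_cnj integrable_L2_sb_kernel[of f z]] by simp

text \<open>At an imaginary point the kernel is the kernel at 0 times a character, up to a nonzero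
  constant. The Fourier transform is applied to the difference times the weight: that product is
  integrable, whereas a function in the weighted space need not be.\<close>

lemma B1_real_inj:
  fixes f g :: "real \<Rightarrow> real"
  assumes f: "f \<in> L2_fun \<nu>" and g: "g \<in> L2_fun \<nu>"
    and eq: "\<And>z. B1 \<nu> (\<lambda>x. of_real (f x)) z = B1 \<nu> (\<lambda>x. of_real (g x)) z"
  shows "AE x in lborel. f x = g x"
proof -
  define d where "d x = f x - g x" for x
  have d: "d \<in> L2_fun \<nu>"
    using L2_fun_add[OF f L2_fun_bounded_linear[OF g bounded_linear_minus[OF bounded_linear_ident]]] by (simp add: d_def[abs_def])
  have zero: "(LINT x|lborel. of_real (d x) * sb_kernel \<nu> z x) = 0" for z
  proof -
    have "complex_of_real ((\<nu> / pi) powr (3/4)) \<noteq> 0" using \<nu> by simp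
    then have "(LINT x|lborel. of_real (f x) * sb_kernel \<nu> z x) = (LINT x|lborel. of_real (g x) * sb_kernel \<nu> z x)"
      using eq[of z] unfolding B1_sb_kernel by simp
    then show ?thesis
      unfolding d_def of_real_diff left_diff_distrib
      by (subst Bochner_Integration.integral_diff) (auto intro: integrable_L2_sb_kernel f g)
  qed
  define h where "h x = d x * exp (- \<nu> * x\<^sup>2)" for x
  have h: "complex_of_real (h x) = of_real (d x) * sb_kernel \<nu> 0 x" for x
    by (simp add: h_def sb_kernel_eq[OF \<nu>] exp_of_real[symmetric])
  have "AE x in lborel. h x = 0"
  proof (rule integrable_eq_0_if_fourier_eq_0)
    show "integrable lborel h"
      using integrable_L2_sb_kernel[OF d, of 0] unfolding h[symmetric] complex_of_real_integrable_eq .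
    fix s
    define z where "z = \<i> * of_real s / of_real (sqrt 2 * \<nu>)"
    have "of_real (sqrt 2 * \<nu>) * z = \<i> * of_real s" using \<nu> by (simp add: z_def)
    then have k: "sb_kernel \<nu> z x = (sb_kernel \<nu> 0 x * iexp (s * x)) * exp (- of_real \<nu> * z\<^sup>2 / 2)" for x
      unfolding sb_kernel_eq[OF \<nu>] by (simp add: exp_add[symmetric] algebra_simps)
    have "(LINT x|lborel. of_real (h x) * iexp (s * x)) * exp (- of_real \<nu> * z\<^sup>2 / 2) = (LINT x|lborel. of_real (d x) * sb_kernel \<nu> z x)"
      unfolding h k mult.assoc[symmetric] by (rule integral_mult_left_zero[symmetric])
    then show "(LINT x|lborel. of_real (h x) * iexp (s * x)) = 0" by (simp add: zero)
  qed
  then show ?thesis by eventually_elim (simp add: h_def d_def)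
qed

lemma fock_coeffs_bound:
  assumes c: "fock_coeffs \<nu> c" and le: "\<And>n. norm (d n) \<le> norm (c n)"
  shows "fock_coeffs \<nu> d"
  unfolding fock_coeffs_def
proof (rule summable_comparison_test'[OF c[unfolded fock_coeffs_def]])
  fix n
  have "(norm (d n))\<^sup>2 \<le> (norm (c n))\<^sup>2" by (intro power_mono le) simp
  then show "norm ((norm (d n))\<^sup>2 * (fact n / \<nu> ^ n)) \<le> (norm (c n))\<^sup>2 * (fact n / \<nu> ^ n)"
    using \<nu> by (simp add: mult_right_mono divide_right_mono)
qed

section \<open>The quaternionic transform in real components\<close>

lemma exp_slice_emb:
  assumes I: "I \<in> quat_sphere"
  shows "exp (slice_emb I z) = slice_emb I (exp z)"
proof -
  interpret e: bounded_linear "slice_emb I" by (rule bounded_linear_slice_emb)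
  have "slice_emb I (\<Sum>n. z ^ n /\<^sub>R fact n) = (\<Sum>n. slice_emb I (z ^ n /\<^sub>R fact n))"
    by (rule e.suminf) (rule summable_exp_generic)
  then show ?thesis by (simp add: exp_def e.scaleR slice_emb_power[OF I])
qed

lemma quat_sb_kernel:
  assumes I: "I \<in> quat_sphere"
  shows "exp (- of_real \<nu> * (of_real x - slice_emb I z / of_real (sqrt 2))\<^sup>2) = slice_emb I (sb_kernel \<nu> z x)"
proof -
  interpret e: bounded_linear "slice_emb I" by (rule bounded_linear_slice_emb)
  have "slice_emb I z / of_real (sqrt 2) = slice_emb I (z / of_real (sqrt 2))"
  proof -
    have "z / of_real (sqrt 2) = inverse (sqrt 2) *\<^sub>R z"
      by (simp add: scaleR_conv_of_real field_simps)
    moreover have "q / of_real r = inverse r *\<^sub>R q" for q :: quat and r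
      by (simp only: divide_quat_def of_real_inverse[symmetric]) (simp add: of_real_def)
    ultimately show ?thesis by (simp only: e.scaleR)
  qed
  then have "- of_real \<nu> * (of_real x - slice_emb I z / of_real (sqrt 2))\<^sup>2 =
      slice_emb I (- of_real \<nu> * (of_real x - z / of_real (sqrt 2))\<^sup>2)"
    by (simp add: e.diff e.neg slice_emb_mult[OF I] slice_emb_power[OF I])
  then show ?thesis by (simp only: exp_slice_emb[OF I] sb_kernel_def)
qed

text \<open>For an argument in \<open>\<complex>\<^sub>I\<close> the kernel has values in
  \<open>\<complex>\<^sub>I\<close>, and the real factors commute with everything, so each
  \<open>v\<close> can be pulled out on the right. Injectivity uses it with
  \<open>V = Basis\<close>, surjectivity with \<open>V = {1, i}\<close>.\<close>

lemma B_H_sum: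
  fixes f :: "quat \<Rightarrow> real \<Rightarrow> real"
  assumes I: "I \<in> quat_sphere" and f: "\<And>v. v \<in> V \<Longrightarrow> f v \<in> L2_fun \<nu>"
  shows "B_H \<nu> (\<lambda>x. \<Sum>v\<in>V. f v x *\<^sub>R v) (slice_emb I z) =
    (\<Sum>v\<in>V. slice_emb I (B1 \<nu> (\<lambda>x. of_real (f v x)) z) * v)"
proof -
  interpret e: bounded_linear "slice_emb I" by (rule bounded_linear_slice_emb)
  have bl: "bounded_linear (\<lambda>w. slice_emb I w * v)" for v
    by (rule bounded_linear_compose[OF bounded_linear_mult_left bounded_linear_slice_emb])
  have "slice_emb I (sb_kernel \<nu> z x) * (\<Sum>v\<in>V. f v x *\<^sub>R v) = (\<Sum>v\<in>V. slice_emb I (of_real (f v x) * sb_kernel \<nu> z x) * v)" for x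
    by (simp add: sum_distrib_left e.scaleR flip: scaleR_conv_of_real)
  then have "B_H \<nu> (\<lambda>x. \<Sum>v\<in>V. f v x *\<^sub>R v) (slice_emb I z) = of_real ((\<nu> / pi) powr (3/4)) *
      (LINT x|lborel. (\<Sum>v\<in>V. slice_emb I (of_real (f v x) * sb_kernel \<nu> z x) * v))"
    unfolding B_H_def quat_sb_kernel[OF I] by simp
  also have "(LINT x|lborel. (\<Sum>v\<in>V. slice_emb I (of_real (f v x) * sb_kernel \<nu> z x) * v)) =
     (\<Sum>v\<in>V. LINT x|lborel. slice_emb I (of_real (f v x) * sb_kernel \<nu> z x) * v)"
    by (rule Bochner_Integration.integral_sum) (rule integrable_bounded_linear[OF bl integrable_L2_sb_kernel[OF f]])
  also have "\<dots> = (\<Sum>v\<in>V. slice_emb I (LINT x|lborel. of_real (f v x) * sb_kernel \<nu> z x) * v)"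
    by (intro sum.cong refl integral_bounded_linear[OF bl integrable_L2_sb_kernel[OF f]])
  finally show ?thesis
    by (simp add: B1_sb_kernel sum_distrib_left slice_emb_mult[OF I] mult.assoc)
qed

text \<open>At a single point, equality of the transforms is one quaternionic equation for four
  complex unknowns \<open>D v\<close>. The conjugate point supplies a second equation with
  \<open>cnj (D v)\<close>. Their sum isolates the real parts; then \<open>I\<close> can be
  cancelled from what remains, which isolates the imaginary parts.\<close>

lemma B_H_inj:
  fixes f g :: "real \<Rightarrow> quat"
  assumes I: "I \<in> quat_sphere" and f: "f \<in> L2_fun \<nu>" and g: "g \<in> L2_fun \<nu>" and eq: "B_H \<nu> f = B_H \<nu> g"
  shows "AE x in lborel. f x = g x"
proof -
  define \<beta> where "\<beta> h v z = B1 \<nu> (\<lambda>x. of_real (inner (h x) v)) z" for h :: "real \<Rightarrow> quat" and v z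
  have comp: "(\<lambda>x. inner (h x) v) \<in> L2_fun \<nu>" if "h \<in> L2_fun \<nu>" for h :: "real \<Rightarrow> quat" and v
    by (rule L2_fun_bounded_linear[OF that bounded_linear_inner_left])
  have rep: "B_H \<nu> h (slice_emb I z) = (\<Sum>v\<in>Basis. slice_emb I (\<beta> h v z) * v)" if "h \<in> L2_fun \<nu>" for h z
    using B_H_sum[OF I, of Basis "\<lambda>v x. inner (h x) v" z] comp[OF that] by (simp add: \<beta>_def euclidean_representation)
  have \<beta>cnj: "\<beta> h v (cnj z) = cnj (\<beta> h v z)" if "h \<in> L2_fun \<nu>" for h v z
    unfolding \<beta>_def by (rule B1_real_cnj[OF comp[OF that]])
  interpret e: bounded_linear "slice_emb I" by (rule bounded_linear_slice_emb)
  have "\<beta> f v z = \<beta> g v z" if v: "v \<in> Basis" for v z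
  proof -
    define D where "D v = \<beta> f v z - \<beta> g v z" for v
    have 1: "(\<Sum>v\<in>Basis. slice_emb I (D v) * v) = 0"
      using rep[OF f, of z] rep[OF g, of z] eq by (simp add: D_def e.diff left_diff_distrib sum_subtractf)
    have 2: "(\<Sum>v\<in>Basis. slice_emb I (cnj (D v)) * v) = 0"
      using rep[OF f, of "cnj z"] rep[OF g, of "cnj z"] eq
      by (simp add: D_def e.diff left_diff_distrib sum_subtractf \<beta>cnj f g)
    have "(\<Sum>v\<in>Basis. slice_emb I (D v) * v) + (\<Sum>v\<in>Basis. slice_emb I (cnj (D v)) * v) = (\<Sum>v\<in>Basis. (2 * Re (D v)) *\<^sub>R v)"
      by (simp add: sum.distrib[symmetric] slice_emb_scaleR algebra_simps flip: scaleR_add_left)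
    then have "(\<Sum>v\<in>Basis. (2 * Re (D v)) *\<^sub>R v) = 0" by (simp only: 1 2 add_0)
    then have re: "Re (D v) = 0" if "v \<in> Basis" for v
      using inner_sum_left_Basis[OF that, of "\<lambda>v. 2 * Re (D v)"] by simp
    have "(\<Sum>v\<in>Basis. slice_emb I (D v) * v) = I * (\<Sum>v\<in>Basis. Im (D v) *\<^sub>R v)"
      unfolding sum_distrib_left by (intro sum.cong refl) (simp add: slice_emb_scaleR re)
    moreover have "I \<noteq> 0" using I by (auto simp: quat_sphere_iff)
    ultimately have "(\<Sum>v\<in>Basis. Im (D v) *\<^sub>R v) = 0" using 1 by simp
    then have "Im (D v) = 0" using inner_sum_left_Basis[OF v, of "\<lambda>v. Im (D v)"] by simp
    then have "D v = 0" using re[OF v] by (simp add: complex_eq_iff)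
    then show ?thesis by (simp add: D_def)
  qed
  then have "AE x in lborel. inner (f x) v = inner (g x) v" if "v \<in> Basis" for v
    using that unfolding \<beta>_def by (intro B1_real_inj comp f g)
  then have "AE x in lborel. \<forall>v\<in>Basis. inner (f x) v = inner (g x) v"
    by (intro AE_finite_allI) auto
  then show ?thesis by eventually_elim (auto intro: euclidean_eqI)
qed

text \<open>The real and imaginary parts of \<open>c\<close> are realised by real functions
  \<open>f\<close> and \<open>g\<close>. The same pair determines both transforms, the complex one
  through f + \<i> g and the quaternionic one through f + g i, which is what relates
  \<open>G\<close> to \<open>B_H\<close>.\<close>

lemma B1_B_H_surj:
  assumes i: "i \<in> quat_sphere" and c: "fock_coeffs \<nu> c"
  obtains \<phi> :: "real \<Rightarrow> complex" where "\<phi> \<in> L2_fun \<nu>" "(\<lambda>x. slice_emb i (\<phi> x)) \<in> L2_fun \<nu>"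
    "\<And>z. B1 \<nu> \<phi> z = (\<Sum>n. c n * z ^ n)" "B_H \<nu> (\<lambda>x. slice_emb i (\<phi> x)) = slice_series i c"
proof -
  have cR: "fock_coeffs \<nu> (\<lambda>n. of_real (Re (c n)))" and cI: "fock_coeffs \<nu> (\<lambda>n. of_real (Im (c n)))"
    by (rule fock_coeffs_bound[OF c]; simp add: abs_Re_le_cmod abs_Im_le_cmod)+
  obtain f where f: "f \<in> L2_fun \<nu>" "\<And>z. B1 \<nu> (\<lambda>x. of_real (f x)) z = (\<Sum>n. of_real (Re (c n)) * z ^ n)"
    using B1_surj_real[OF \<nu> cR] by blast
  obtain g where g: "g \<in> L2_fun \<nu>" "\<And>z. B1 \<nu> (\<lambda>x. of_real (g x)) z = (\<Sum>n. of_real (Im (c n)) * z ^ n)"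
    using B1_surj_real[OF \<nu> cI] by blast
  have sums: "(\<lambda>n. d n * z ^ n) sums (\<Sum>n. d n * z ^ n)" if "fock_coeffs \<nu> d" for d z
  proof -
    have "summable (\<lambda>n. norm (d n) * norm z ^ n)"
      using fock_coeffs_entire[OF \<nu> that] unfolding entire_coeffs_def by blast
    then have "summable (\<lambda>n. norm (d n * z ^ n))" by (simp only: norm_mult norm_power)
    then show ?thesis by (rule summable_sums[OF summable_norm_cancel])
  qed
  define \<phi> where "\<phi> x = complex_of_real (f x) + \<i> * of_real (g x)" for x
  have phiL: "\<phi> \<in> L2_fun \<nu>"
    unfolding \<phi>_def[abs_def]
    by (intro L2_fun_add L2_fun_bounded_linear[OF f(1) bounded_linear_of_real]
        L2_fun_bounded_linear[OF g(1) bounded_linear_compose[OF bounded_linear_mult_right bounded_linear_of_real]])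
  have eL: "(\<lambda>x. slice_emb i (\<phi> x)) \<in> L2_fun \<nu>"
    by (rule L2_fun_bounded_linear[OF phiL bounded_linear_slice_emb])
  have B1: "B1 \<nu> \<phi> z = (\<Sum>n. c n * z ^ n)" for z
  proof -
    have "(LINT x|lborel. \<phi> x * sb_kernel \<nu> z x) = (LINT x|lborel. of_real (f x) * sb_kernel \<nu> z x) + \<i> * (LINT x|lborel. of_real (g x) * sb_kernel \<nu> z x)"
      unfolding \<phi>_def distrib_right mult.assoc
      by (subst Bochner_Integration.integral_add)
         (auto intro!: integrable_mult_right integrable_L2_sb_kernel f g)
    then have "B1 \<nu> \<phi> z = B1 \<nu> (\<lambda>x. of_real (f x)) z + \<i> * B1 \<nu> (\<lambda>x. of_real (g x)) z"
      by (simp add: B1_sb_kernel algebra_simps)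
    moreover have "(\<lambda>n. of_real (Re (c n)) * z ^ n + \<i> * (of_real (Im (c n)) * z ^ n)) sums ((\<Sum>n. of_real (Re (c n)) * z ^ n) + \<i> * (\<Sum>n. of_real (Im (c n)) * z ^ n))"
      by (intro sums_add sums_mult sums cR cI)
    moreover have "of_real (Re (c n)) * z ^ n + \<i> * (of_real (Im (c n)) * z ^ n) = c n * z ^ n" for n
      by (subst (3) complex_eq[of "c n"]) (simp add: algebra_simps)
    ultimately show ?thesis by (simp add: f g sums_iff)
  qed
  have "B_H \<nu> (\<lambda>x. slice_emb i (\<phi> x)) q = slice_series i c q" for q
  proof -
    obtain I z where I: "I \<in> quat_sphere" and q: "q = slice_emb I z" using slice_emb_surj[OF i] by blast
    interpret e: bounded_linear "slice_emb I" by (rule bounded_linear_slice_emb)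
    \<comment> \<open>The units 1 and \<open>i\<close> must be distinct for the sum over
      \<open>{1, i}\<close> to have two terms.\<close>
    have i1: "i \<noteq> 1" using i by (auto simp: quat_sphere_iff)
    define F where "F v = (if v = 1 then f else g)" for v :: quat
    have "B_H \<nu> (\<lambda>x. slice_emb i (\<phi> x)) q = B_H \<nu> (\<lambda>x. \<Sum>v\<in>{1, i}. F v x *\<^sub>R v) q"
      using i1 by (simp add: F_def slice_emb_scaleR \<phi>_def)
    also have "\<dots> = (\<Sum>v\<in>{1, i}. slice_emb I (B1 \<nu> (\<lambda>x. of_real (F v x)) z) * v)"
      unfolding q by (rule B_H_sum[OF I]) (simp add: F_def f g)
    also have "\<dots> = slice_emb I (\<Sum>n. of_real (Re (c n)) * z ^ n) + slice_emb I (\<Sum>n. of_real (Im (c n)) * z ^ n) * i"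
      using i1 by (simp add: F_def f g)
    finally have L: "B_H \<nu> (\<lambda>x. slice_emb i (\<phi> x)) q = slice_emb I (\<Sum>n. of_real (Re (c n)) * z ^ n) + slice_emb I (\<Sum>n. of_real (Im (c n)) * z ^ n) * i" .
    have "(\<lambda>n. slice_emb I (of_real (Re (c n)) * z ^ n) + slice_emb I (of_real (Im (c n)) * z ^ n) * i) sums
      (slice_emb I (\<Sum>n. of_real (Re (c n)) * z ^ n) + slice_emb I (\<Sum>n. of_real (Im (c n)) * z ^ n) * i)"
      by (intro sums_add sums_mult2 e.sums sums cR cI)
    moreover have "slice_emb I (of_real (Re (c n)) * z ^ n) + slice_emb I (of_real (Im (c n)) * z ^ n) * i = q ^ n * slice_emb i (c n)" for n
      unfolding q slice_emb_power[OF I, symmetric]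
      by (simp add: e.scaleR slice_emb_scaleR[of i] distrib_left flip: scaleR_conv_of_real)
    ultimately show ?thesis unfolding slice_series_def L by (simp add: sums_iff)
  qed
  then show ?thesis using that phiL eL B1 by blast
qed

end

section \<open>The image of the slice Fock space\<close>

lemma equiv_L2_rel: "equiv (L2_fun \<nu>) (L2_rel \<nu> :: ((real \<Rightarrow> 'a::real_normed_vector) \<times> _) set)"
proof (rule equivI)
  show "L2_rel \<nu> \<subseteq> L2_fun \<nu> \<times> (L2_fun \<nu> :: (real \<Rightarrow> 'a) set)" by (auto simp: L2_rel_def)
  show "refl_on (L2_fun \<nu>) (L2_rel \<nu> :: ((real \<Rightarrow> 'a) \<times> _) set)" by (auto simp: refl_on_def L2_rel_def)
  show "sym (L2_rel \<nu> :: ((real \<Rightarrow> 'a) \<times> _) set)" by (auto simp: sym_def L2_rel_def eq_commute)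
  show "trans (L2_rel \<nu> :: ((real \<Rightarrow> 'a) \<times> _) set)"
  proof (rule transI)
    fix f g h :: "real \<Rightarrow> 'a"
    assume "(f, g) \<in> L2_rel \<nu>" "(g, h) \<in> L2_rel \<nu>"
    then have "f \<in> L2_fun \<nu>" "h \<in> L2_fun \<nu>" "AE x in lborel. f x = g x" "AE x in lborel. g x = h x"
      by (auto simp: L2_rel_def)
    moreover from this(3,4) have "AE x in lborel. f x = h x" by eventually_elim simp
    ultimately show "(f, h) \<in> L2_rel \<nu>" by (simp add: L2_rel_def)
  qed
qed

lemma on_class_L2:
  assumes f: "f \<in> L2_fun \<nu>" and T: "\<And>g. (f, g) \<in> L2_rel \<nu> \<Longrightarrow> T g = T f"
  shows "on_class T (L2_rel \<nu> `` {f}) = T f"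
proof -
  have "(f, f) \<in> L2_rel \<nu>" using f by (simp add: L2_rel_def)
  then have "T ` (L2_rel \<nu> `` {f}) = {T f}" using T by blast
  then show ?thesis by (simp add: on_class_def)
qed

lemma L2_class_eq_iff:
  "f \<in> L2_fun \<nu> \<Longrightarrow> g \<in> L2_fun \<nu> \<Longrightarrow> L2_rel \<nu> `` {f} = L2_rel \<nu> `` {g} \<longleftrightarrow> (AE x in lborel. f x = g x)"
  using eq_equiv_class_iff[OF equiv_L2_rel, of f \<nu> g] by (auto simp: L2_rel_def)

lemma L2_class: "f \<in> L2_fun \<nu> \<Longrightarrow> L2_rel \<nu> `` {f} \<in> L2 \<nu>"
  unfolding L2_def by (rule quotientI)

lemma L2_cases:
  assumes "d \<in> L2 \<nu>"
  obtains f where "f \<in> L2_fun \<nu>" "d = L2_rel \<nu> `` {f}"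
  using assms unfolding L2_def by (rule quotientE) blast

section \<open>Evaluation of \<open>J\<close> on power series\<close>

lemma B1_cong_AE:
  assumes fg: "(f, g) \<in> L2_rel \<nu>"
  shows "B1 \<nu> g = B1 \<nu> f"
proof
  fix z
  have [measurable]: "f \<in> borel_measurable borel" "g \<in> borel_measurable borel"
    and ae: "AE x in lborel. f x = g x"
    using fg by (auto simp: L2_rel_def L2_fun_def)
  have "(LINT x|lborel. g x * sb_kernel \<nu> z x) = (LINT x|lborel. f x * sb_kernel \<nu> z x)"
    by (rule integral_cong_AE) (measurable, use ae in eventually_elim, simp)
  then show "B1 \<nu> g z = B1 \<nu> f z" by (simp only: B1_sb_kernel)
qed

lemma B_H_cong_AE:
  assumes \<nu>: "\<nu> > 0" and i: "i \<in> quat_sphere" and fg: "(f, g) \<in> L2_rel \<nu>"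
  shows "B_H \<nu> g = B_H \<nu> f"
proof
  fix q
  obtain I z where I: "I \<in> quat_sphere" and q: "q = slice_emb I z" using slice_emb_surj[OF i] by blast
  have [measurable]: "f \<in> borel_measurable borel" "g \<in> borel_measurable borel"
    and ae: "AE x in lborel. f x = g x"
    using fg by (auto simp: L2_rel_def L2_fun_def)
  have [measurable]: "slice_emb I \<in> borel_measurable borel"
    by (intro borel_measurable_continuous_onI linear_continuous_on bounded_linear_slice_emb)
  have "(LINT x|lborel. slice_emb I (sb_kernel \<nu> z x) * g x) = (LINT x|lborel. slice_emb I (sb_kernel \<nu> z x) * f x)"
    by (rule integral_cong_AE) (measurable, use ae in eventually_elim, simp)
  then show "B_H \<nu> g q = B_H \<nu> f q"
    unfolding B_H_def q quat_sb_kernel[OF \<nu> I] by simp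
qed

lemma inj_on_B_H:
  assumes \<nu>: "\<nu> > 0" and i: "i \<in> quat_sphere"
  shows "inj_on (on_class (B_H \<nu>)) (L2 \<nu>)"
proof (rule inj_onI)
  fix c d assume c: "c \<in> L2 \<nu>" and d: "d \<in> L2 \<nu>" and eq: "on_class (B_H \<nu>) c = on_class (B_H \<nu>) d"
  obtain f where f: "f \<in> L2_fun \<nu>" "c = L2_rel \<nu> `` {f}" using c by (rule L2_cases)
  obtain g where g: "g \<in> L2_fun \<nu>" "d = L2_rel \<nu> `` {g}" using d by (rule L2_cases)
  have "B_H \<nu> f = B_H \<nu> g"
    using eq on_class_L2[OF f(1), of "B_H \<nu>"] on_class_L2[OF g(1), of "B_H \<nu>"] B_H_cong_AE[OF \<nu> i]
    unfolding f(2) g(2) by metis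
  then show "c = d"
    using B_H_inj[OF \<nu> i f(1) g(1)] L2_class_eq_iff[OF f(1) g(1)] f(2) g(2) by simp
qed

lemma L2_incl_class:
  assumes i: "i \<in> quat_sphere" and f: "f \<in> L2_fun \<nu>"
  shows "L2_incl i \<nu> (L2_rel \<nu> `` {f}) = L2_rel \<nu> `` {\<lambda>x. slice_emb i (f x)}"
proof -
  have e: "(\<lambda>x. slice_emb i (g x)) \<in> L2_fun \<nu>" if "g \<in> L2_fun \<nu>" for g
    by (rule L2_fun_bounded_linear[OF that bounded_linear_slice_emb])
  have "on_class (\<lambda>f. L2_rel \<nu> `` {slice_emb i \<circ> f}) (L2_rel \<nu> `` {f}) = L2_rel \<nu> `` {slice_emb i \<circ> f}"
  proof (rule on_class_L2[OF f])
    fix g assume "(f, g) \<in> L2_rel \<nu>"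
    then have "g \<in> L2_fun \<nu>" "AE x in lborel. f x = g x" by (auto simp: L2_rel_def)
    moreover from this(2) have "AE x in lborel. slice_emb i (g x) = slice_emb i (f x)"
      by eventually_elim simp
    ultimately show "L2_rel \<nu> `` {slice_emb i \<circ> g} = L2_rel \<nu> `` {slice_emb i \<circ> f}"
      using L2_class_eq_iff[OF e[of g] e[OF f]] by (simp add: o_def)
  qed
  then show ?thesis by (simp add: L2_incl_def o_def)
qed

lemma inj_on_L2_incl:
  assumes i: "i \<in> quat_sphere"
  shows "inj_on (L2_incl i \<nu>) (L2 \<nu>)"
proof (rule inj_onI)
  fix c d assume c: "c \<in> L2 \<nu>" and d: "d \<in> L2 \<nu>" and eq: "L2_incl i \<nu> c = L2_incl i \<nu> d"
  obtain f where f: "f \<in> L2_fun \<nu>" "c = L2_rel \<nu> `` {f}" using c by (rule L2_cases)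
  obtain g where g: "g \<in> L2_fun \<nu>" "d = L2_rel \<nu> `` {g}" using d by (rule L2_cases)
  have "AE x in lborel. slice_emb i (f x) = slice_emb i (g x)"
    using eq L2_class_eq_iff[OF L2_fun_bounded_linear[OF f(1) bounded_linear_slice_emb] L2_fun_bounded_linear[OF g(1) bounded_linear_slice_emb], of i i]
    by (simp add: f(2) g(2) L2_incl_class[OF i f(1)] L2_incl_class[OF i g(1)])
  then show "c = d"
    using L2_class_eq_iff[OF f(1) g(1)] f(2) g(2) by (simp add: slice_emb_eq_iff[OF i])
qed

text \<open>Each inverse is evaluated by exhibiting a preimage and using injectivity. Both preimages
  come from the one function of \<open>B1_B_H_surj\<close>.\<close>

lemma J_slice_series:
  assumes \<nu>: "\<nu> > 0" and i: "i \<in> quat_sphere" and c: "fock_coeffs \<nu> c"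
  shows "J i \<nu> (slice_series i c) = (\<lambda>(z, w). of_real (sqrt (\<nu> / pi)) * (\<Sum>n. c n * ((z + \<i> * w) / of_real (sqrt 2)) ^ n))"
proof -
  obtain \<phi> where \<phi>: "\<phi> \<in> L2_fun \<nu>" "(\<lambda>x. slice_emb i (\<phi> x)) \<in> L2_fun \<nu>"
    "\<And>z. B1 \<nu> \<phi> z = (\<Sum>n. c n * z ^ n)" "B_H \<nu> (\<lambda>x. slice_emb i (\<phi> x)) = slice_series i c"
    using B1_B_H_surj[OF \<nu> i c] by blast
  have "slice_series i c \<in> Fock_slice_pres i \<nu>"
    using Fock_slice_pres_iff[OF \<nu> i] c by blast
  moreover have "on_class (B_H \<nu>) (L2_rel \<nu> `` {\<lambda>x. slice_emb i (\<phi> x)}) = slice_series i c"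
    using on_class_L2[OF \<phi>(2), of "B_H \<nu>"] B_H_cong_AE[OF \<nu> i] \<phi>(4) by metis
  then have "inv_into (L2 \<nu>) (on_class (B_H \<nu>)) (slice_series i c) = L2_rel \<nu> `` {\<lambda>x. slice_emb i (\<phi> x)}"
    by (rule inv_into_f_eq[OF inj_on_B_H[OF \<nu> i] L2_class[OF \<phi>(2)]])
  moreover have "inv_into (L2 \<nu>) (L2_incl i \<nu>) (L2_rel \<nu> `` {\<lambda>x. slice_emb i (\<phi> x)}) = L2_rel \<nu> `` {\<phi>}"
    by (rule inv_into_f_eq[OF inj_on_L2_incl[OF i] L2_class[OF \<phi>(1)] L2_incl_class[OF i \<phi>(1)]])
  moreover have "on_class (G \<nu>) (L2_rel \<nu> `` {\<phi>}) = G \<nu> \<phi>"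
    by (rule on_class_L2[OF \<phi>(1)]) (simp add: G_def B1_cong_AE)
  ultimately show ?thesis
    by (simp add: J_def G_def \<phi>(3))
qed

section \<open>Functions of z + iw in the Fock space on \<open>\<complex>\<^sup>2\<close>\<close>

lemma entire_power_series_holomorphic:
  assumes "entire_coeffs c"
  shows "(\<lambda>z. \<Sum>n. c n * z ^ n) holomorphic_on UNIV"
proof -
  have s: "(\<lambda>n. c n * z ^ n) sums (\<Sum>n. c n * z ^ n)" for z
  proof -
    have "summable (\<lambda>n. norm (c n * z ^ n))"
      using assms by (simp add: entire_coeffs_def norm_mult norm_power)
    then show ?thesis by (rule summable_sums[OF summable_norm_cancel])
  qed
  have hol: "(\<lambda>z. \<Sum>n. c n * z ^ n) holomorphic_on ball 0 r" for r
    by (rule power_series_holomorphic[where a=c]) (simp add: s)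
  have "(\<lambda>z. \<Sum>n. c n * z ^ n) field_differentiable at z" for z
    by (rule holomorphic_on_imp_differentiable_at[OF hol[of "norm z + 1"] open_ball]) simp
  then show ?thesis
    unfolding holomorphic_on_def by (blast intro: field_differentiable_at_within)
qed

text \<open>A unitary change of coordinates whose first component is the variable of \<open>J F\<close>.\<close>

definition rot2 :: "complex \<times> complex \<Rightarrow> complex \<times> complex" where
  "rot2 = (\<lambda>(z, w). ((z + \<i> * w) / of_real (sqrt 2), (\<i> * z + w) / of_real (sqrt 2)))"

lemma norm_rot2: "norm (rot2 p) = norm p"
proof -
  obtain z w where p: "p = (z, w)" by (cases p)
  have "(norm (z + \<i> * w))\<^sup>2 + (norm (\<i> * z + w))\<^sup>2 = 2 * ((norm z)\<^sup>2 + (norm w)\<^sup>2)"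
    unfolding cmod_power2 by (simp add: power2_eq_square algebra_simps)
  then have "(norm (rot2 p))\<^sup>2 = (norm p)\<^sup>2"
    by (simp add: rot2_def p norm_Pair norm_divide power_divide add_divide_distrib[symmetric])
  then show ?thesis by (simp add: power2_eq_iff_nonneg)
qed

lemma orthogonal_rot2: "orthogonal_transformation rot2"
  unfolding orthogonal_transformation
proof
  show "linear rot2"
    by (rule linearI) (auto simp: rot2_def add_divide_distrib algebra_simps scaleR_conv_of_real)
qed (simp add: norm_rot2)

lemma integrable_rot2_iff:
  fixes f :: "complex \<times> complex \<Rightarrow> real"
  assumes "f \<in> borel_measurable borel"
  shows "integrable lborel (\<lambda>p. f (rot2 p)) \<longleftrightarrow> integrable lborel f"
proof -
  have "linear rot2" using orthogonal_rot2 by (rule orthogonal_transformation_linear)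
  then have "rot2 \<in> borel_measurable borel"
    by (intro borel_measurable_continuous_onI linear_continuous_on) (simp add: linear_conv_bounded_linear)
  then have "integrable (distr lborel borel rot2) f \<longleftrightarrow> integrable lborel (\<lambda>p. f (rot2 p))"
    using assms by (intro integrable_distr_eq) auto
  then show ?thesis by (simp only: distr_lborel_orthogonal[OF orthogonal_rot2])
qed

text \<open>\<open>rot2\<close> preserves both Lebesgue measure and the norm. In the new coordinates
  the integrand is a product of a function of the first variable and a Gaussian in the second, and
  the Gaussian is positive and integrable.\<close>

lemma integrable_fock2_iff:
  fixes g :: "complex \<Rightarrow> complex"
  assumes \<nu>: "\<nu> > 0" and g: "g \<in> borel_measurable borel"
  shows "integrable lborel (\<lambda>p. (norm (g (fst (rot2 p))))\<^sup>2 * exp (- \<nu> * (norm p)\<^sup>2)) \<longleftrightarrow>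
    integrable lborel (\<lambda>u. (norm (g u))\<^sup>2 * exp (- \<nu> * (norm u)\<^sup>2))"
proof -
  note g [measurable]
  define a b where "a u = (norm (g u))\<^sup>2 * exp (- \<nu> * (norm u)\<^sup>2)" and "b v = exp (- \<nu> * (norm v)\<^sup>2)" for u v :: complex
  have [measurable]: "a \<in> borel_measurable borel" "b \<in> borel_measurable borel"
    unfolding a_def b_def by measurable
  define f where "f = (\<lambda>p. a (fst p) * b (snd p))"
  have fm: "f \<in> borel_measurable (lborel \<Otimes>\<^sub>M lborel)" unfolding f_def by measurable
  then have fm': "f \<in> borel_measurable borel" by (simp add: lborel_prod)
  have "(\<lambda>p. (norm (g (fst (rot2 p))))\<^sup>2 * exp (- \<nu> * (norm p)\<^sup>2)) = (\<lambda>p. f (rot2 p))"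
  proof
    fix p
    have "(norm p)\<^sup>2 = (norm (rot2 p))\<^sup>2" by (simp add: norm_rot2)
    also have "\<dots> = (norm (fst (rot2 p)))\<^sup>2 + (norm (snd (rot2 p)))\<^sup>2"
      by (metis norm_Pair prod.collapse real_sqrt_pow2 sum_power2_ge_zero)
    finally show "(norm (g (fst (rot2 p))))\<^sup>2 * exp (- \<nu> * (norm p)\<^sup>2) = f (rot2 p)"
      by (simp add: f_def a_def b_def distrib_left mult.assoc exp_add[symmetric] del: mult_minus_left)
  qed
  then have "integrable lborel (\<lambda>p. (norm (g (fst (rot2 p))))\<^sup>2 * exp (- \<nu> * (norm p)\<^sup>2)) \<longleftrightarrow> integrable lborel f"
    using integrable_rot2_iff[OF fm'] by simp
  also have "\<dots> \<longleftrightarrow> integrable (lborel \<Otimes>\<^sub>M lborel) f" by (simp only: lborel_prod)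
  also have "\<dots> \<longleftrightarrow> integrable lborel a"
  proof
    assume "integrable (lborel \<Otimes>\<^sub>M lborel) f"
    then have "integrable (lborel \<Otimes>\<^sub>M lborel) (case_prod (\<lambda>u v. f (u, v)))" by (simp add: case_prod_unfold)
    then have ae: "AE v in (lborel :: complex measure). integrable lborel (\<lambda>u. f (u, v))" by (rule lborel_pair.AE_integrable_snd)
    \<comment> \<open>Fubini gives integrability for almost every \<open>v\<close>. The whole plane
      is not a null set, so some such \<open>v\<close> exists, and the positive constant
      \<open>b v\<close> can be divided out.\<close>
    obtain v where "integrable lborel (\<lambda>u. f (u, v))"
    proof -
      from ae obtain N where N: "{v \<in> space (lborel :: complex measure). \<not> integrable lborel (\<lambda>u. f (u, v))} \<subseteq> N"
        "emeasure lborel N = 0" "N \<in> sets lborel"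
        by (rule AE_E)
      have "N \<noteq> UNIV" using N(2) by auto
      then obtain v where "v \<notin> N" by blast
      then have "integrable lborel (\<lambda>u. f (u, v))" using N(1) by auto
      then show ?thesis by (rule that)
    qed
    then have "integrable lborel (\<lambda>u. a u * b v)" by (simp only: f_def fst_conv snd_conv)
    then show "integrable lborel a" by (simp add: b_def)
  next
    assume a: "integrable lborel a"
    have b: "integrable lborel b"
    proof (rule integrableI_nonneg)
      show "(\<integral>\<^sup>+v. ennreal (b v) \<partial>lborel) < \<infinity>"
        using nn_integral_exp_gaussian_complex[OF \<nu>, of 0] by (simp add: b_def)
    qed (auto simp: b_def)
    show "integrable (lborel \<Otimes>\<^sub>M lborel) f"
    proof (rule lborel_pair.Fubini_integrable[OF fm])
      show "integrable lborel (\<lambda>u. LINT v|lborel. norm (f (u, v)))"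
        using a by (simp add: f_def abs_mult)
      show "AE u in lborel. integrable lborel (\<lambda>v. f (u, v))"
        using b by (simp add: f_def)
    qed
  qed
  finally show ?thesis unfolding a_def .
qed

text \<open>The chain rule along a holomorphic curve. It is applied to the coordinate lines, for the
  partial derivatives, and to lines in the direction (1, \<i>).\<close>

lemma has_field_derivative_compose2:
  fixes F :: "complex \<times> complex \<Rightarrow> complex"
  assumes F: "(F has_derivative (\<lambda>(h, k). a * h + b * k)) (at (p t, q t))"
    and p: "(p has_field_derivative p') (at t)" and q: "(q has_field_derivative q') (at t)"
  shows "((\<lambda>t. F (p t, q t)) has_field_derivative a * p' + b * q') (at t)"
proof -
  have "((\<lambda>t. (p t, q t)) has_derivative (\<lambda>h. (p' * h, q' * h))) (at t)"
    using p q unfolding has_field_derivative_def by (rule has_derivative_Pair)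
  from has_derivative_compose[OF this F] show ?thesis
    unfolding has_field_derivative_def by (rule has_derivative_eq_rhs) (auto simp: fun_eq_iff algebra_simps)
qed

lemma A2_iff:
  assumes \<nu>: "\<nu> > 0"
  shows "F \<in> A2 \<nu> \<longleftrightarrow> (\<exists>c. fock_coeffs \<nu> c \<and>
    F = (\<lambda>(z, w). of_real (sqrt (\<nu> / pi)) * (\<Sum>n. c n * ((z + \<i> * w) / of_real (sqrt 2)) ^ n)))"
proof
  define s where "s = complex_of_real (sqrt (\<nu> / pi))"
  have s: "s \<noteq> 0" using \<nu> by (simp add: s_def)
  assume "F \<in> A2 \<nu>"
  then have hol: "holomorphic2 F" and int: "integrable lborel (\<lambda>p. (norm (F p))\<^sup>2 * exp (- \<nu> * (norm p)\<^sup>2))"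
    and cr: "\<And>z w. deriv (\<lambda>\<zeta>. F (\<zeta>, w)) z + \<i> * deriv (\<lambda>\<omega>. F (z, \<omega>)) w = 0"
    by (auto simp: A2_def Fock2_def)
  have der: "\<exists>a b. (F has_derivative (\<lambda>(h, k). a * h + b * k)) (at (z, w)) \<and> a + \<i> * b = 0" for z w
  proof -
    obtain a b where F: "(F has_derivative (\<lambda>(h, k). a * h + b * k)) (at (z, w))"
      using hol unfolding holomorphic2_def by blast
    have "((\<lambda>\<zeta>. F (\<zeta>, w)) has_field_derivative a) (at z)"
      using has_field_derivative_compose2[where p="\<lambda>\<zeta>. \<zeta>" and q="\<lambda>\<zeta>. w", OF F DERIV_ident DERIV_const] by simp
    then have 1: "deriv (\<lambda>\<zeta>. F (\<zeta>, w)) z = a" by (rule DERIV_imp_deriv)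
    have "((\<lambda>\<omega>. F (z, \<omega>)) has_field_derivative b) (at w)"
      using has_field_derivative_compose2[where p="\<lambda>\<omega>. z" and q="\<lambda>\<omega>. \<omega>", OF F DERIV_const DERIV_ident] by simp
    then have 2: "deriv (\<lambda>\<omega>. F (z, \<omega>)) w = b" by (rule DERIV_imp_deriv)
    show ?thesis using F cr[of w z] unfolding 1 2 by blast
  qed
  have const: "F (z, w) = F (z + \<i> * w, 0)" for z w
  proof -
    have "((\<lambda>t. F (z + t, w + \<i> * t)) has_field_derivative 0) (at t)" for t
    proof -
      obtain a b where F: "(F has_derivative (\<lambda>(h, k). a * h + b * k)) (at (z + t, w + \<i> * t))" and ab: "a + \<i> * b = 0"
        using der by blast
      have "((\<lambda>t. F (z + t, w + \<i> * t)) has_field_derivative a * 1 + b * \<i>) (at t)"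
        by (rule has_field_derivative_compose2[where p="\<lambda>t. z + t" and q="\<lambda>t. w + \<i> * t", OF F]) (auto intro!: derivative_eq_intros)
      then show ?thesis using ab by (simp add: mult.commute)
    qed
    then have "\<exists>k. \<forall>t\<in>UNIV. F (z + t, w + \<i> * t) = k"
      by (intro has_field_derivative_zero_constant) auto
    then obtain k where k: "\<And>t. F (z + t, w + \<i> * t) = k" by blast
    \<comment> \<open>The parameter \<open>t = \<i> * w\<close> carries (z, w) along the line of
      constancy to (z + \<i> w, 0).\<close>
    have "\<i> * (\<i> * w) = - w" by (simp add: mult.assoc[symmetric])
    then show ?thesis using k[of 0] k[of "\<i> * w"] by simp
  qed
  \<comment> \<open>The scaling by \<open>sqrt 2\<close> and the division by \<open>s\<close> are
    chosen so that F (z, w) = s g ((z + \<i> w) / sqrt 2), the form taken by values of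
    \<open>J\<close>.\<close>
  define g where "g u = F (of_real (sqrt 2) * u, 0) / s" for u
  have "g holomorphic_on UNIV"
  proof -
    have "\<exists>D. (g has_field_derivative D) (at u)" for u
    proof -
      obtain a b where F: "(F has_derivative (\<lambda>(h, k). a * h + b * k)) (at (of_real (sqrt 2) * u, 0))"
        using der by blast
      have "((\<lambda>u. F (of_real (sqrt 2) * u, 0)) has_field_derivative a * of_real (sqrt 2) + b * 0) (at u)"
        by (rule has_field_derivative_compose2[where p="\<lambda>u. of_real (sqrt 2) * u" and q="\<lambda>u. 0", OF F]) (auto intro!: derivative_eq_intros)
      then show ?thesis unfolding g_def using DERIV_cdivide by blast
    qed
    then show ?thesis
      by (meson field_differentiable_def field_differentiable_at_within holomorphic_on_def)
  qed
  then obtain c where c: "entire_coeffs c" "\<And>z. (\<lambda>n. c n * z ^ n) sums g z"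
    by (rule holomorphic_UNIV_power_series) blast
  have geq: "g = (\<lambda>z. \<Sum>n. c n * z ^ n)" using c(2) by (auto simp: sums_iff)
  have Fg: "F (z, w) = s * g ((z + \<i> * w) / of_real (sqrt 2))" for z w
    unfolding g_def using const[of z w] s by simp
  have [measurable]: "g \<in> borel_measurable borel" unfolding geq by measurable
  have "integrable lborel (\<lambda>p. (norm (s * g (fst (rot2 p))))\<^sup>2 * exp (- \<nu> * (norm p)\<^sup>2))"
    using int by (simp add: rot2_def case_prod_unfold Fg[symmetric])
  then have "integrable lborel (\<lambda>u. (norm (s * g u))\<^sup>2 * exp (- \<nu> * (norm u)\<^sup>2))"
    by (subst (asm) integrable_fock2_iff[OF \<nu>]) auto
  then have "integrable lborel (\<lambda>u. inverse ((norm s)\<^sup>2) * ((norm (s * g u))\<^sup>2 * exp (- \<nu> * (norm u)\<^sup>2)))"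
    by (rule integrable_mult_right)
  then have "integrable lborel (\<lambda>u. (norm (g u))\<^sup>2 * exp (- \<nu> * (norm u)\<^sup>2))"
    using s by (simp add: norm_mult power_mult_distrib mult.assoc[symmetric])
  then have "fock_coeffs \<nu> c" using integrable_fock_iff[OF \<nu> c(1)] unfolding geq by blast
  moreover have "F = (\<lambda>(z, w). s * (\<Sum>n. c n * ((z + \<i> * w) / of_real (sqrt 2)) ^ n))"
    using Fg unfolding geq by auto
  ultimately show "\<exists>c. fock_coeffs \<nu> c \<and>
    F = (\<lambda>(z, w). of_real (sqrt (\<nu> / pi)) * (\<Sum>n. c n * ((z + \<i> * w) / of_real (sqrt 2)) ^ n))"
    unfolding s_def by blast
next
  assume "\<exists>c. fock_coeffs \<nu> c \<and>
    F = (\<lambda>(z, w). of_real (sqrt (\<nu> / pi)) * (\<Sum>n. c n * ((z + \<i> * w) / of_real (sqrt 2)) ^ n))"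
  then obtain c where c: "fock_coeffs \<nu> c"
    and F: "F = (\<lambda>(z, w). of_real (sqrt (\<nu> / pi)) * (\<Sum>n. c n * ((z + \<i> * w) / of_real (sqrt 2)) ^ n))" by blast
  define g where "g u = of_real (sqrt (\<nu> / pi)) * (\<Sum>n. c n * u ^ n)" for u
  have Fg: "F = (\<lambda>p. g (fst (rot2 p)))" by (auto simp: F g_def rot2_def)
  have e: "entire_coeffs c" by (rule fock_coeffs_entire[OF \<nu> c])
  have "g holomorphic_on UNIV"
    unfolding g_def by (intro holomorphic_intros entire_power_series_holomorphic e)
  then have "\<exists>D. (g has_field_derivative D) (at u)" for u
    by (simp add: holomorphic_on_def field_differentiable_def)
  then obtain g' where g': "\<And>u. (g has_field_derivative g' u) (at u)" by metis
  have [measurable]: "g \<in> borel_measurable borel" unfolding g_def by measurable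
  have "integrable lborel (\<lambda>u. (norm (of_real (sqrt (\<nu> / pi)) :: complex))\<^sup>2 * ((norm (\<Sum>n. c n * u ^ n))\<^sup>2 * exp (- \<nu> * (norm u)\<^sup>2)))"
    using c integrable_fock_iff[OF \<nu> e] by (intro integrable_mult_right) blast
  then have "integrable lborel (\<lambda>u. (norm (g u))\<^sup>2 * exp (- \<nu> * (norm u)\<^sup>2))"
    by (simp only: g_def norm_mult power_mult_distrib mult.assoc)
  then have int: "integrable lborel (\<lambda>p. (norm (F p))\<^sup>2 * exp (- \<nu> * (norm p)\<^sup>2))"
    unfolding Fg by (subst integrable_fock2_iff[OF \<nu>]) auto
  have der: "(F has_derivative (\<lambda>(h, k). (g' (fst (rot2 p)) / of_real (sqrt 2)) * h + (\<i> * g' (fst (rot2 p)) / of_real (sqrt 2)) * k)) (at p)" for p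
  proof -
    have "bounded_linear (\<lambda>p. fst (rot2 p))"
      using orthogonal_transformation_linear[OF orthogonal_rot2]
      by (intro bounded_linear_compose[OF bounded_linear_fst]) (simp add: linear_conv_bounded_linear)
    then have "((\<lambda>p. fst (rot2 p)) has_derivative (\<lambda>p. fst (rot2 p))) (at p)"
      by (rule bounded_linear_imp_has_derivative)
    from has_derivative_compose[OF this g'[of "fst (rot2 p)", unfolded has_field_derivative_def]]
    show ?thesis unfolding Fg
      by (rule has_derivative_eq_rhs) (auto simp: rot2_def fun_eq_iff add_divide_distrib distrib_left)
  qed
  have "deriv (\<lambda>\<zeta>. F (\<zeta>, w)) z + \<i> * deriv (\<lambda>\<omega>. F (z, \<omega>)) w = 0" for z w
  proof -
    let ?d = "g' (fst (rot2 (z, w))) / of_real (sqrt 2)" and ?e = "\<i> * g' (fst (rot2 (z, w))) / of_real (sqrt 2)"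
    have "((\<lambda>\<zeta>. F (\<zeta>, w)) has_field_derivative ?d) (at z)"
      using has_field_derivative_compose2[where p="\<lambda>\<zeta>. \<zeta>" and q="\<lambda>\<zeta>. w", OF der DERIV_ident DERIV_const] by simp
    then have 1: "deriv (\<lambda>\<zeta>. F (\<zeta>, w)) z = ?d" by (rule DERIV_imp_deriv)
    have "((\<lambda>\<omega>. F (z, \<omega>)) has_field_derivative ?e) (at w)"
      using has_field_derivative_compose2[where p="\<lambda>\<omega>. z" and q="\<lambda>\<omega>. \<omega>", OF der DERIV_const DERIV_ident] by simp
    then have 2: "deriv (\<lambda>\<omega>. F (z, \<omega>)) w = ?e" by (rule DERIV_imp_deriv)
    have "\<i> * ?e = - ?d" by (simp add: mult.assoc[symmetric])
    then show ?thesis unfolding 1 2 by simp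
  qed
  moreover have "holomorphic2 F" unfolding holomorphic2_def using der by blast
  ultimately show "F \<in> A2 \<nu>" using int unfolding A2_def Fock2_def by blast
qed

text \<open>On \<open>\<complex>\<^sub>i\<close> quaternionic conjugation is complex conjugation, so
  the powers of the conjugate of \<xi> are admissible right coefficients. Their Fock condition is
  the exponential series at \<nu> |\<xi>|^2.\<close>

lemma K_H_eq_slice_series:
  assumes \<nu>: "\<nu> > 0" and i: "i \<in> quat_sphere"
  shows "(\<lambda>q. K_H \<nu> q (slice_emb i \<xi>)) = slice_series i (\<lambda>n. of_real (\<nu> / pi * (\<nu> ^ n / fact n)) * cnj \<xi> ^ n)"
    and "fock_coeffs \<nu> (\<lambda>n. of_real (\<nu> / pi * (\<nu> ^ n / fact n)) * cnj \<xi> ^ n)"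
proof -
  define c where "c n = complex_of_real (\<nu> / pi * (\<nu> ^ n / fact n)) * cnj \<xi> ^ n" for n
  have nc: "norm (c n) = \<nu> / pi * ((\<nu> * norm \<xi>) ^ n / fact n)" for n
    unfolding c_def norm_mult norm_of_real norm_power complex_mod_cnj
    using \<nu> by (simp add: power_mult_distrib)
  have "(norm (c n))\<^sup>2 * (fact n / \<nu> ^ n) = (\<nu> / pi)\<^sup>2 * ((\<nu> * (norm \<xi>)\<^sup>2) ^ n /\<^sub>R fact n)" for n
    using \<nu> unfolding nc by (simp add: power2_eq_square power_mult_distrib field_simps)
  then show fock: "fock_coeffs \<nu> (\<lambda>n. of_real (\<nu> / pi * (\<nu> ^ n / fact n)) * cnj \<xi> ^ n)"
    using summable_mult[OF summable_exp_generic[of "\<nu> * (norm \<xi>)\<^sup>2"], of "(\<nu> / pi)\<^sup>2"]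
    unfolding fock_coeffs_def c_def by simp
  interpret e: bounded_linear "slice_emb i" by (rule bounded_linear_slice_emb)
  have eq: "q ^ n * slice_emb i (c n) = of_real (\<nu> / pi) * (of_real (\<nu> ^ n / fact n) * (q ^ n * quat_cnj (slice_emb i \<xi>) ^ n))" for q n
  proof -
    have "slice_emb i (c n) = of_real (\<nu> / pi) * (of_real (\<nu> ^ n / fact n) * (quat_cnj (slice_emb i \<xi>) ^ n))"
      unfolding slice_emb_cnj[OF i, symmetric] slice_emb_power[OF i, symmetric] c_def
      by (simp only: of_real_mult mult.assoc slice_emb_mult[OF i] slice_emb_of_real)
    moreover have "q ^ n * (of_real r * p) = of_real r * (q ^ n * p)" for p r
      by (simp add: of_real_def)
    ultimately show ?thesis by (simp only:)
  qed
  have ent: "entire_coeffs c" using fock_coeffs_entire[OF \<nu> fock] by (simp add: c_def[abs_def])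
  show "(\<lambda>q. K_H \<nu> q (slice_emb i \<xi>)) = slice_series i (\<lambda>n. of_real (\<nu> / pi * (\<nu> ^ n / fact n)) * cnj \<xi> ^ n)"
    unfolding c_def[symmetric]
  proof
    fix q
    have "summable (\<lambda>n. of_real (\<nu> / pi) * (of_real (\<nu> ^ n / fact n) * (q ^ n * quat_cnj (slice_emb i \<xi>) ^ n)))"
      using summable_norm_cancel[OF summable_slice_series[OF ent i, of q]] by (simp only: eq)
    \<comment> \<open>In \<open>K_H\<close> the constant stands outside the infinite sum. Pulling it
      in requires summability of the series without it, which is obtained by multiplying by the
      inverse.\<close>
    then have "summable (\<lambda>n. inverse (of_real (\<nu> / pi)) * (of_real (\<nu> / pi) * (of_real (\<nu> ^ n / fact n) * (q ^ n * quat_cnj (slice_emb i \<xi>) ^ n))))"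
      by (rule summable_mult)
    moreover have "inverse (of_real (\<nu> / pi)) * (of_real (\<nu> / pi) * p) = p" for p :: quat
    proof -
      have nz: "of_real (\<nu> / pi) \<noteq> (0 :: quat)" unfolding of_real_eq_0_iff using \<nu> by simp
      show ?thesis by (simp only: mult.assoc[symmetric] left_inverse[OF nz] mult_1_left)
    qed
    ultimately have "summable (\<lambda>n. of_real (\<nu> ^ n / fact n) * (q ^ n * quat_cnj (slice_emb i \<xi>) ^ n))"
      by (simp only:)
    then show "K_H \<nu> q (slice_emb i \<xi>) = slice_series i c q"
      unfolding K_H_def slice_series_def eq by (rule suminf_mult[symmetric])
  qed
qed

text \<open>The second clause compares quaternions, as \<open>F\<close> has quaternion values;
  \<open>slice_emb i\<close> is injective, so it determines \<open>J\<close>. In the kernel formula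
  (z, w) is the first argument of \<open>K2\<close>, the one in which \<open>K2\<close> is
  holomorphic. The constants are (\<nu> / pi)^(1/2) from \<open>J\<close>, \<nu> / pi from
  \<open>K_H\<close> and (\<nu> / pi)^2 in \<open>K2\<close>, whence the factor
  \<open>sqrt (pi / \<nu>)\<close>.\<close>

theorem theorem3p6:
  fixes \<nu> :: real and i :: quat
  assumes "\<nu> > 0" and "i \<in> quat_sphere"
  shows "J i \<nu> ` Fock_slice_pres i \<nu> = A2 \<nu>
    \<and> (\<forall>F\<in>Fock_slice_pres i \<nu>. \<forall>z w.
         slice_emb i (J i \<nu> F (z, w)) =
           of_real (sqrt (\<nu> / pi)) * F (slice_emb i ((z + \<i> * w) / of_real (sqrt 2))))
    \<and> (\<forall>\<xi> z w.
         J i \<nu> (\<lambda>q. K_H \<nu> q (slice_emb i \<xi>)) (z, w) =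
           of_real (sqrt (pi / \<nu>)) *
             K2 \<nu> (z, w) (\<xi> / of_real (sqrt 2), - \<i> * \<xi> / of_real (sqrt 2)))"
proof (intro conjI ballI allI)
  have "H \<in> A2 \<nu> \<longleftrightarrow> (\<exists>c. fock_coeffs \<nu> c \<and> H = J i \<nu> (slice_series i c))" for H
    unfolding A2_iff[OF assms(1)] by (simp add: J_slice_series[OF assms] cong: conj_cong)
  moreover have "H \<in> J i \<nu> ` Fock_slice_pres i \<nu> \<longleftrightarrow> (\<exists>c. fock_coeffs \<nu> c \<and> H = J i \<nu> (slice_series i c))" for H
    unfolding image_iff Bex_def Fock_slice_pres_iff[OF assms] by blast
  ultimately show "J i \<nu> ` Fock_slice_pres i \<nu> = A2 \<nu>" by (intro set_eqI) (simp only:)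
next
  fix F z w assume "F \<in> Fock_slice_pres i \<nu>"
  then obtain c where c: "fock_coeffs \<nu> c" and F: "F = slice_series i c"
    using Fock_slice_pres_iff[OF assms] by blast
  show "slice_emb i (J i \<nu> F (z, w)) = of_real (sqrt (\<nu> / pi)) * F (slice_emb i ((z + \<i> * w) / of_real (sqrt 2)))"
    unfolding F J_slice_series[OF assms c] slice_series_slice[OF fock_coeffs_entire[OF assms(1) c] assms(2)]
    by (simp only: case_prod_conv slice_emb_mult[OF assms(2)] slice_emb_of_real)
next
  fix \<xi> z w :: complex
  define u where "u = (z + \<i> * w) / of_real (sqrt 2)"
  \<comment> \<open>Conjugating the second coordinate turns -\<i> \<xi> into \<i> times the
    conjugate of \<xi>, so the two products combine to a multiple of z + \<i> w.\<close>
  have u: "of_real \<nu> * (cnj \<xi> * u) = of_real \<nu> * (z * cnj (\<xi> / of_real (sqrt 2)) + w * cnj (- \<i> * \<xi> / of_real (sqrt 2)))"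
    by (simp add: u_def add_divide_distrib algebra_simps)
  have sq: "sqrt (\<nu> / pi) * (\<nu> / pi) = sqrt (pi / \<nu>) * (\<nu> / pi)\<^sup>2"
    using assms(1) by (simp add: real_sqrt_divide power2_eq_square field_simps)
  have "(\<Sum>n. (of_real (\<nu> / pi * (\<nu> ^ n / fact n)) * cnj \<xi> ^ n) * u ^ n) = of_real (\<nu> / pi) * exp (of_real \<nu> * (cnj \<xi> * u))"
  proof -
    have "(of_real (\<nu> / pi * (\<nu> ^ n / fact n)) * cnj \<xi> ^ n) * u ^ n = of_real (\<nu> / pi) * ((of_real \<nu> * (cnj \<xi> * u)) ^ n /\<^sub>R fact n)" for n
      by (simp add: power_mult_distrib scaleR_conv_of_real field_simps)
    then show ?thesis by (simp only: sums_unique[OF sums_mult[OF exp_converges]])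
  qed
  then have "J i \<nu> (\<lambda>q. K_H \<nu> q (slice_emb i \<xi>)) (z, w) = of_real (sqrt (\<nu> / pi)) * (of_real (\<nu> / pi) * exp (of_real \<nu> * (cnj \<xi> * u)))"
    unfolding K_H_eq_slice_series(1)[OF assms] J_slice_series[OF assms K_H_eq_slice_series(2)[OF assms]]
    by (simp only: case_prod_conv u_def)
  also have "\<dots> = of_real (sqrt (\<nu> / pi) * (\<nu> / pi)) * exp (of_real \<nu> * (cnj \<xi> * u))"
    by (simp only: of_real_mult mult.assoc)
  also have "\<dots> = of_real (sqrt (pi / \<nu>)) * K2 \<nu> (z, w) (\<xi> / of_real (sqrt 2), - \<i> * \<xi> / of_real (sqrt 2))"
    unfolding sq u by (simp only: K2_def case_prod_conv of_real_mult mult.assoc)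
  finally show "J i \<nu> (\<lambda>q. K_H \<nu> q (slice_emb i \<xi>)) (z, w) =
    of_real (sqrt (pi / \<nu>)) * K2 \<nu> (z, w) (\<xi> / of_real (sqrt 2), - \<i> * \<xi> / of_real (sqrt 2))" .
qed

end
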